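(* Let $\mathscr T$ be a rigidly-compactly generated tensor triangulated category. If the Balmer spectrum $\mathrm{Spc}(\mathscr T^c)$ is Hochster weakly scattered, then $\mathscr T$ satisfies the local-to-global principle.
   Context: A rigidly-compactly generated tensor triangulated category $\mathscr T$ is a triangulated category with small coproducts and a compatible closed symmetric monoidal structure $(\otimes,\mathbb 1)$, compactly generated, whose compact objects coincide with its rigid (dualizable) objects (so $\mathbb 1$ is compact). $\mathscr T^c$ is the full subcategory of compact objects. $\mathrm{Spc}(\mathscr T^c)$ is the set of prime thick tensor ideals $\mathscr P$ of $\mathscr T^c$; for $a\in\mathscr T^c$ put $\mathrm{supp}(a)=\{\mathscr P: a\notin\mathscr P\}$, and these sets form a basis of closed subsets of the topology. It is a spectral space. Let $X$ be a spectral space. A subset of $X$ is Thomason if it is a union of closed subsets each of which has quasi-compact complement. The Thomason subsets are the open sets of a topology on $X$, the Hochster dual topology; write $X^*$ for the resulting space. A subset $W\subseteq X$ is weakly visible if $W=U\cap V^c$ for Thomason subsets $U,V$. In a topological space $Y$, a point $x$ is a weakly isolated point of a subset $S$ if there is an open $U\subseteq Y$ with $\{x\}\subseteq U\cap S\subseteq\overline{\{x\}}$. $Y$ is weakly scattered if every nonempty closed subset of $Y$ has a weakly isolated point. A spectral space $X$ is Hochster weakly scattered if $X^*$ is weakly scattered. For a Thomason subset $Y\subseteq \mathrm{Spc}(\mathscr T^c)$ let $\mathscr T^c_Y=\{a\in\mathscr T^c:\mathrm{supp}(a)\subseteq Y\}$. There is an exact triangle $e_Y\to\mathbb 1\to f_Y\to\Sigma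 e_Y$, unique up to unique isomorphism, with $e_Y$ in the localizing subcategory $\mathrm{Loc}\langle\mathscr T^c_Y\rangle$ and $\mathrm{Hom}_{\mathscr T}(s,f_Y)=0$ for all $s\in\mathrm{Loc}\langle\mathscr T^c_Y\rangle$. For a weakly visible $W=U\cap V^c$ put $g_W=e_U\otimes f_V$ (independent of the choice of $U,V$ up to isomorphism). $\mathrm{Loc}_\otimes\langle\mathscr E\rangle$ denotes the localizing ideal generated by $\mathscr E$ (smallest localizing subcategory containing $\mathscr E$ and closed under tensoring with arbitrary objects of $\mathscr T$). $\mathscr T$ satisfies the local-to-global principle if $\mathrm{Loc}_\otimes\langle t\rangle=\mathrm{Loc}_\otimes\langle t\otimes g_{W_i}\mid i\in I\rangle$ for every $t\in\mathscr T$ and every cover $\mathrm{Spc}(\mathscr T^c)=\bigcup_{i\in I}W_i$ by weakly visible subsets $W_i$. *)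

theory Defs
  imports
    "HOL-Algebra.FiniteProduct"
    "HOL-Algebra.Product_Groups"
    "HOL-Analysis.Abstract_Topology"
begin

unbundle cardinal_syntax

section \<open>Smallness\<close>

text \<open>
  ``Small'' is relative to a Grothendieck universe, given by a strongly inaccessible cardinal
  \<open>\<kappa>\<close>: a set is small if its cardinality is less than \<open>\<kappa>\<close>. Hom sets have to be small too, and
  the inaccessibility of \<open>\<kappa>\<close> is then no real restriction: if \<open>x\<close> is nonzero and the coproduct
  \<open>c\<close> of \<open>\<lambda>\<close> copies of \<open>x\<close> exists, then \<open>Hom c x\<close> has at least \<open>2 ^ \<lambda>\<close> elements.
\<close>

definition inaccessible :: "'k rel \<Rightarrow> bool" where
  "inaccessible \<kappa> \<longleftrightarrow>
     Card_order \<kappa> \<and> natLeq <o \<kappa> \<and> regularCard \<kappa> \<and>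
     (\<forall>A :: 'k set. |A| <o \<kappa> \<longrightarrow> |Pow A| <o \<kappa>)"


section \<open>Categories\<close>

record ('o, 'a) pre_category =
  Obj :: "'o set"
  Arr :: "'a set"
  Dom :: "'a \<Rightarrow> 'o"
  Cod :: "'a \<Rightarrow> 'o"
  Ident :: "'o \<Rightarrow> 'a"  (\<open>\<I>\<index>\<close>)
  Comp :: "'a \<Rightarrow> 'a \<Rightarrow> 'a"  (infixr \<open>\<cdot>\<index>\<close> 75)

definition Hom :: "('o, 'a, 'm) pre_category_scheme \<Rightarrow> 'o \<Rightarrow> 'o \<Rightarrow> 'a set" where
  "Hom C x y = {f \<in> Arr C. Dom C f = x \<and> Cod C f = y}"

locale category =
  fixes C :: "('o, 'a, 'm) pre_category_scheme" (structure)
  assumes dom_in_Obj: "f \<in> Arr C \<Longrightarrow> Dom C f \<in> Obj C"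
    and cod_in_Obj: "f \<in> Arr C \<Longrightarrow> Cod C f \<in> Obj C"
    and ident_in_Hom: "x \<in> Obj C \<Longrightarrow> \<I> x \<in> Hom C x x"
    and comp_in_Hom: "\<lbrakk>f \<in> Hom C x y; g \<in> Hom C y z\<rbrakk> \<Longrightarrow> g \<cdot> f \<in> Hom C x z"
    and ident_comp: "f \<in> Hom C x y \<Longrightarrow> \<I> y \<cdot> f = f"
    and comp_ident: "f \<in> Hom C x y \<Longrightarrow> f \<cdot> \<I> x = f"
    and comp_assoc: "\<lbrakk>f \<in> Hom C w x; g \<in> Hom C x y; h \<in> Hom C y z\<rbrakk>
                      \<Longrightarrow> (h \<cdot> g) \<cdot> f = h \<cdot> (g \<cdot> f)"

definition inverse_arrows ::
    "('o, 'a, 'm) pre_category_scheme \<Rightarrow> 'a \<Rightarrow> 'a \<Rightarrow> bool" where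
  "inverse_arrows C f g \<longleftrightarrow>
     f \<in> Arr C \<and> g \<in> Hom C (Cod C f) (Dom C f) \<and>
     g \<cdot>\<^bsub>C\<^esub> f = \<I>\<^bsub>C\<^esub> (Dom C f) \<and> f \<cdot>\<^bsub>C\<^esub> g = \<I>\<^bsub>C\<^esub> (Cod C f)"

definition is_iso :: "('o, 'a, 'm) pre_category_scheme \<Rightarrow> 'a \<Rightarrow> bool" where
  "is_iso C f \<longleftrightarrow> (\<exists>g. inverse_arrows C f g)"

definition inv_arrow :: "('o, 'a, 'm) pre_category_scheme \<Rightarrow> 'a \<Rightarrow> 'a" where
  "inv_arrow C f = (THE g. inverse_arrows C f g)"

definition isomorphic :: "('o, 'a, 'm) pre_category_scheme \<Rightarrow> 'o \<Rightarrow> 'o \<Rightarrow> bool" where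
  "isomorphic C x y \<longleftrightarrow> (\<exists>f \<in> Hom C x y. is_iso C f)"

definition is_zero_object :: "('o, 'a, 'm) pre_category_scheme \<Rightarrow> 'o \<Rightarrow> bool" where
  "is_zero_object C z \<longleftrightarrow>
     z \<in> Obj C \<and> (\<forall>x \<in> Obj C. (\<exists>!f. f \<in> Hom C z x) \<and> (\<exists>!f. f \<in> Hom C x z))"

definition is_coproduct ::
    "('o, 'a, 'm) pre_category_scheme \<Rightarrow> 'i set \<Rightarrow> ('i \<Rightarrow> 'o) \<Rightarrow> 'o \<Rightarrow> ('i \<Rightarrow> 'a) \<Rightarrow> bool" where
  "is_coproduct C I t c \<iota> \<longleftrightarrow>
     c \<in> Obj C \<and> (\<forall>i \<in> I. \<iota> i \<in> Hom C (t i) c) \<and>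
     (\<forall>y \<in> Obj C. \<forall>f. (\<forall>i \<in> I. f i \<in> Hom C (t i) y) \<longrightarrow>
        (\<exists>!g. g \<in> Hom C c y \<and> (\<forall>i \<in> I. g \<cdot>\<^bsub>C\<^esub> \<iota> i = f i)))"

text \<open>Every small family can be reindexed by a subset of the underlying type of \<open>\<kappa>\<close>.\<close>

definition has_small_coproducts ::
    "'k rel \<Rightarrow> ('o, 'a, 'm) pre_category_scheme \<Rightarrow> bool" where
  "has_small_coproducts \<kappa> C \<longleftrightarrow>
     (\<forall>(I :: 'k set) t. |I| <o \<kappa> \<longrightarrow> t \<in> I \<rightarrow> Obj C \<longrightarrow> (\<exists>c \<iota>. is_coproduct C I t c \<iota>))"

locale endofunctor = category C
  for C :: "('o, 'a, 'm) pre_category_scheme" (structure) +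
  fixes Fo :: "'o \<Rightarrow> 'o" and Fa :: "'a \<Rightarrow> 'a"
  assumes map_Obj: "x \<in> Obj C \<Longrightarrow> Fo x \<in> Obj C"
    and map_Hom: "f \<in> Hom C x y \<Longrightarrow> Fa f \<in> Hom C (Fo x) (Fo y)"
    and map_ident: "x \<in> Obj C \<Longrightarrow> Fa (\<I> x) = \<I> (Fo x)"
    and map_comp: "\<lbrakk>f \<in> Hom C x y; g \<in> Hom C y z\<rbrakk> \<Longrightarrow> Fa (g \<cdot> f) = Fa g \<cdot> Fa f"


section \<open>Additive categories\<close>

record ('o, 'a) pre_additive_category = "('o, 'a) pre_category" +
  Plus :: "'a \<Rightarrow> 'a \<Rightarrow> 'a"
  Zero :: "'o \<Rightarrow> 'o \<Rightarrow> 'a"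

definition hom_group ::
    "('o, 'a, 'm) pre_additive_category_scheme \<Rightarrow> 'o \<Rightarrow> 'o \<Rightarrow> 'a monoid" where
  "hom_group C x y = \<lparr>carrier = Hom C x y, monoid.mult = Plus C, one = Zero C x y\<rparr>"

definition neg :: "('o, 'a, 'm) pre_additive_category_scheme \<Rightarrow> 'a \<Rightarrow> 'a" where
  "neg C f = m_inv (hom_group C (Dom C f) (Cod C f)) f"

definition is_biproduct ::
    "('o, 'a, 'm) pre_additive_category_scheme \<Rightarrow> 'o \<Rightarrow> 'o \<Rightarrow> 'o \<Rightarrow> 'a \<Rightarrow> 'a \<Rightarrow> 'a \<Rightarrow> 'a \<Rightarrow> bool"
  where
  "is_biproduct C x y b i j p q \<longleftrightarrow>
     i \<in> Hom C x b \<and> j \<in> Hom C y b \<and> p \<in> Hom C b x \<and> q \<in> Hom C b y \<and>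
     p \<cdot>\<^bsub>C\<^esub> i = \<I>\<^bsub>C\<^esub> x \<and> q \<cdot>\<^bsub>C\<^esub> j = \<I>\<^bsub>C\<^esub> y \<and>
     p \<cdot>\<^bsub>C\<^esub> j = Zero C y x \<and> q \<cdot>\<^bsub>C\<^esub> i = Zero C x y \<and>
     Plus C (i \<cdot>\<^bsub>C\<^esub> p) (j \<cdot>\<^bsub>C\<^esub> q) = \<I>\<^bsub>C\<^esub> b"

definition direct_summand ::
    "('o, 'a, 'm) pre_additive_category_scheme \<Rightarrow> 'o \<Rightarrow> 'o \<Rightarrow> bool" where
  "direct_summand C x b \<longleftrightarrow> (\<exists>y i j p q. is_biproduct C x y b i j p q)"

locale additive_category = category C
  for C :: "('o, 'a, 'm) pre_additive_category_scheme" (structure) +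
  assumes hom_comm_group: "\<lbrakk>x \<in> Obj C; y \<in> Obj C\<rbrakk> \<Longrightarrow> comm_group (hom_group C x y)"
    and comp_plus: "\<lbrakk>f \<in> Hom C x y; g \<in> Hom C y z; g' \<in> Hom C y z\<rbrakk>
                     \<Longrightarrow> Plus C g g' \<cdot> f = Plus C (g \<cdot> f) (g' \<cdot> f)"
    and plus_comp: "\<lbrakk>f \<in> Hom C x y; f' \<in> Hom C x y; g \<in> Hom C y z\<rbrakk>
                     \<Longrightarrow> g \<cdot> Plus C f f' = Plus C (g \<cdot> f) (g \<cdot> f')"
    and ex_zero_object: "\<exists>z. is_zero_object C z"
    and ex_biproduct: "\<lbrakk>x \<in> Obj C; y \<in> Obj C\<rbrakk> \<Longrightarrow> \<exists>b i j p q. is_biproduct C x y b i j p q"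

locale additive_endofunctor = endofunctor C Fo Fa
  for C :: "('o, 'a, 'm) pre_additive_category_scheme" (structure)
    and Fo :: "'o \<Rightarrow> 'o" and Fa :: "'a \<Rightarrow> 'a" +
  assumes map_plus: "\<lbrakk>f \<in> Hom C x y; g \<in> Hom C x y\<rbrakk> \<Longrightarrow> Fa (Plus C f g) = Plus C (Fa f) (Fa g)"


section \<open>Triangulated categories\<close>

text \<open>The suspension is a pair of maps on objects and on arrows; \<open>Tri\<close> is the class of exact
  (distinguished) triangles.\<close>

record ('o, 'a) pre_triangulated_category = "('o, 'a) pre_additive_category" +
  SuspO :: "'o \<Rightarrow> 'o"  (\<open>\<Sigma>\<^sub>o\<index>\<close>)
  SuspA :: "'a \<Rightarrow> 'a"  (\<open>\<Sigma>\<^sub>a\<index>\<close>)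
  Tri :: "('a \<times> 'a \<times> 'a) set"

definition candidate_triangle ::
    "('o, 'a, 'm) pre_triangulated_category_scheme \<Rightarrow> 'o \<Rightarrow> 'o \<Rightarrow> 'o \<Rightarrow> 'a \<Rightarrow> 'a \<Rightarrow> 'a \<Rightarrow> bool"
  where
  "candidate_triangle C x y z f g h \<longleftrightarrow>
     f \<in> Hom C x y \<and> g \<in> Hom C y z \<and> h \<in> Hom C z (\<Sigma>\<^sub>o\<^bsub>C\<^esub> x)"

definition exact_triangle ::
    "('o, 'a, 'm) pre_triangulated_category_scheme \<Rightarrow> 'o \<Rightarrow> 'o \<Rightarrow> 'o \<Rightarrow> 'a \<Rightarrow> 'a \<Rightarrow> 'a \<Rightarrow> bool"
  where
  "exact_triangle C x y z f g h \<longleftrightarrow> candidate_triangle C x y z f g h \<and> (f, g, h) \<in> Tri C"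

text \<open>The suspension is only required to be an auto-equivalence, not an automorphism.\<close>

locale triangulated_category = additive_category C
  for C :: "('o, 'a, 'm) pre_triangulated_category_scheme" (structure) +
  assumes susp_additive: "additive_endofunctor C (SuspO C) (SuspA C)"
    and susp_fully_faithful:
      "\<lbrakk>x \<in> Obj C; y \<in> Obj C\<rbrakk> \<Longrightarrow> bij_betw (SuspA C) (Hom C x y) (Hom C (\<Sigma>\<^sub>o x) (\<Sigma>\<^sub>o y))"
    and susp_ess_surj: "y \<in> Obj C \<Longrightarrow> \<exists>x \<in> Obj C. isomorphic C (\<Sigma>\<^sub>o x) y"
    and Tri_candidate: "(f, g, h) \<in> Tri C \<Longrightarrow> \<exists>x y z. candidate_triangle C x y z f g h"
    and TR1_iso:
      "\<lbrakk>exact_triangle C x y z f g h; candidate_triangle C x' y' z' f' g' h';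
        u \<in> Hom C x x'; v \<in> Hom C y y'; w \<in> Hom C z z'; is_iso C u; is_iso C v; is_iso C w;
        v \<cdot> f = f' \<cdot> u; w \<cdot> g = g' \<cdot> v; \<Sigma>\<^sub>a u \<cdot> h = h' \<cdot> w\<rbrakk>
       \<Longrightarrow> exact_triangle C x' y' z' f' g' h'"
    and TR1_ident:
      "\<lbrakk>x \<in> Obj C; is_zero_object C z\<rbrakk>
       \<Longrightarrow> exact_triangle C x x z (\<I> x) (Zero C x z) (Zero C z (\<Sigma>\<^sub>o x))"
    and TR1_cone: "f \<in> Hom C x y \<Longrightarrow> \<exists>z g h. exact_triangle C x y z f g h"
    and TR2:
      "candidate_triangle C x y z f g h \<Longrightarrow>
       exact_triangle C x y z f g h \<longleftrightarrow> exact_triangle C y z (\<Sigma>\<^sub>o x) g h (neg C (\<Sigma>\<^sub>a f))"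
    and TR3:
      "\<lbrakk>exact_triangle C x y z f g h; exact_triangle C x' y' z' f' g' h';
        u \<in> Hom C x x'; v \<in> Hom C y y'; v \<cdot> f = f' \<cdot> u\<rbrakk>
       \<Longrightarrow> \<exists>w \<in> Hom C z z'. w \<cdot> g = g' \<cdot> v \<and> \<Sigma>\<^sub>a u \<cdot> h = h' \<cdot> w"
    and TR4_octahedral:
      "\<lbrakk>exact_triangle C x y z' f f' f''; exact_triangle C y z x' g g' g'';
        exact_triangle C x z y' (g \<cdot> f) h' h''\<rbrakk>
       \<Longrightarrow> \<exists>u v. exact_triangle C z' y' x' u v (\<Sigma>\<^sub>a f' \<cdot> g'') \<and>
             u \<cdot> f' = h' \<cdot> g \<and> h'' \<cdot> u = f'' \<and> v \<cdot> h' = g' \<and> g'' \<cdot> v = \<Sigma>\<^sub>a f \<cdot> h''"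

locale exact_endofunctor = additive_endofunctor C Fo Fa
  for C :: "('o, 'a, 'm) pre_triangulated_category_scheme" (structure)
    and Fo :: "'o \<Rightarrow> 'o" and Fa :: "'a \<Rightarrow> 'a" +
  assumes exact:
    "\<exists>\<phi>. (\<forall>x \<in> Obj C. \<phi> x \<in> Hom C (Fo (\<Sigma>\<^sub>o x)) (\<Sigma>\<^sub>o (Fo x)) \<and> is_iso C (\<phi> x)) \<and>
         (\<forall>x y. \<forall>f \<in> Hom C x y. \<phi> y \<cdot> Fa (\<Sigma>\<^sub>a f) = \<Sigma>\<^sub>a (Fa f) \<cdot> \<phi> x) \<and>
         (\<forall>x y z f g h. exact_triangle C x y z f g h \<longrightarrow>
            exact_triangle C (Fo x) (Fo y) (Fo z) (Fa f) (Fa g) (\<phi> x \<cdot> Fa h))"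

text \<open>Full subcategories are given by their sets of objects, and are closed under
  isomorphism.\<close>

definition triangulated_subcategory ::
    "('o, 'a, 'm) pre_triangulated_category_scheme \<Rightarrow> 'o set \<Rightarrow> bool" where
  "triangulated_subcategory C S \<longleftrightarrow>
     S \<subseteq> Obj C \<and> S \<noteq> {} \<and>
     (\<forall>x y. x \<in> S \<longrightarrow> isomorphic C x y \<longrightarrow> y \<in> S) \<and>
     (\<forall>x \<in> Obj C. \<Sigma>\<^sub>o\<^bsub>C\<^esub> x \<in> S \<longleftrightarrow> x \<in> S) \<and>
     (\<forall>x y z f g h. exact_triangle C x y z f g h \<longrightarrow> x \<in> S \<longrightarrow> y \<in> S \<longrightarrow> z \<in> S)"

definition thick_subcategory ::
    "('o, 'a, 'm) pre_triangulated_category_scheme \<Rightarrow> 'o set \<Rightarrow> bool" where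
  "thick_subcategory C S \<longleftrightarrow>
     triangulated_subcategory C S \<and> (\<forall>x y. y \<in> S \<longrightarrow> direct_summand C x y \<longrightarrow> x \<in> S)"

definition localizing_subcategory ::
    "'k rel \<Rightarrow> ('o, 'a, 'm) pre_triangulated_category_scheme \<Rightarrow> 'o set \<Rightarrow> bool" where
  "localizing_subcategory \<kappa> C S \<longleftrightarrow>
     triangulated_subcategory C S \<and>
     (\<forall>(I :: 'k set) t c \<iota>. |I| <o \<kappa> \<longrightarrow> t \<in> I \<rightarrow> S \<longrightarrow> is_coproduct C I t c \<iota> \<longrightarrow> c \<in> S)"

definition Loc ::
    "'k rel \<Rightarrow> ('o, 'a, 'm) pre_triangulated_category_scheme \<Rightarrow> 'o set \<Rightarrow> 'o set" where
  "Loc \<kappa> C E = \<Inter>{S. localizing_subcategory \<kappa> C S \<and> E \<subseteq> S}"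

text \<open>An object \<open>x\<close> is compact if, for every small coproduct, the canonical homomorphism from the
  direct sum of the groups \<open>Hom x (t i)\<close> to \<open>Hom x c\<close> is bijective.\<close>

definition compact_object ::
    "'k rel \<Rightarrow> ('o, 'a, 'm) pre_triangulated_category_scheme \<Rightarrow> 'o \<Rightarrow> bool" where
  "compact_object \<kappa> C x \<longleftrightarrow>
     x \<in> Obj C \<and>
     (\<forall>(I :: 'k set) t c \<iota>. |I| <o \<kappa> \<longrightarrow> t \<in> I \<rightarrow> Obj C \<longrightarrow> is_coproduct C I t c \<iota> \<longrightarrow>
        (\<lambda>h. finprod (hom_group C x c) (\<lambda>i. \<iota> i \<cdot>\<^bsub>C\<^esub> h i) {i \<in> I. h i \<noteq> Zero C x (t i)})
          \<in> Group.iso (sum_group I (\<lambda>i. hom_group C x (t i))) (hom_group C x c))"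

definition compact_objects ::
    "'k rel \<Rightarrow> ('o, 'a, 'm) pre_triangulated_category_scheme \<Rightarrow> 'o set" where
  "compact_objects \<kappa> C = {x. compact_object \<kappa> C x}"

text \<open>Maps from the desuspensions of \<open>g\<close> to \<open>t\<close> are expressed as maps from \<open>g\<close> to suspensions
  of \<open>t\<close>.\<close>

definition compactly_generated ::
    "'k rel \<Rightarrow> ('o, 'a, 'm) pre_triangulated_category_scheme \<Rightarrow> bool" where
  "compactly_generated \<kappa> C \<longleftrightarrow>
     (\<exists>G \<subseteq> compact_objects \<kappa> C. |G| <o \<kappa> \<and>
        (\<forall>t \<in> Obj C.
           (\<forall>g \<in> G. \<forall>n.
              Hom C ((SuspO C ^^ n) g) t = {Zero C ((SuspO C ^^ n) g) t} \<and>
              Hom C g ((SuspO C ^^ n) t) = {Zero C g ((SuspO C ^^ n) t)}) \<longrightarrow>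
           is_zero_object C t))"


section \<open>Tensor triangulated categories\<close>

record ('o, 'a) pre_tt_category = "('o, 'a) pre_triangulated_category" +
  Unit :: 'o  (\<open>\<one>\<^sub>u\<index>\<close>)
  TensO :: "'o \<Rightarrow> 'o \<Rightarrow> 'o"  (infixr \<open>\<otimes>\<^sub>o\<index>\<close> 80)
  TensA :: "'a \<Rightarrow> 'a \<Rightarrow> 'a"  (infixr \<open>\<otimes>\<^sub>a\<index>\<close> 80)
  Assoc :: "'o \<Rightarrow> 'o \<Rightarrow> 'o \<Rightarrow> 'a"  (\<open>\<alpha>\<^sub>u\<index>\<close>)
  LUnit :: "'o \<Rightarrow> 'a"  (\<open>\<lambda>\<^sub>u\<index>\<close>)
  RUnit :: "'o \<Rightarrow> 'a"  (\<open>\<rho>\<^sub>u\<index>\<close>)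
  Braid :: "'o \<Rightarrow> 'o \<Rightarrow> 'a"  (\<open>\<beta>\<^sub>u\<index>\<close>)

locale symmetric_monoidal_category = category C
  for C :: "('o, 'a, 'm) pre_tt_category_scheme" (structure) +
  assumes unit_in_Obj: "\<one>\<^sub>u \<in> Obj C"
    and tens_in_Obj: "\<lbrakk>x \<in> Obj C; y \<in> Obj C\<rbrakk> \<Longrightarrow> x \<otimes>\<^sub>o y \<in> Obj C"
    and tens_in_Hom: "\<lbrakk>f \<in> Hom C x x'; g \<in> Hom C y y'\<rbrakk> \<Longrightarrow> f \<otimes>\<^sub>a g \<in> Hom C (x \<otimes>\<^sub>o y) (x' \<otimes>\<^sub>o y')"
    and tens_ident: "\<lbrakk>x \<in> Obj C; y \<in> Obj C\<rbrakk> \<Longrightarrow> \<I> x \<otimes>\<^sub>a \<I> y = \<I> (x \<otimes>\<^sub>o y)"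
    and tens_comp:
      "\<lbrakk>f \<in> Hom C x x'; f' \<in> Hom C x' x''; g \<in> Hom C y y'; g' \<in> Hom C y' y''\<rbrakk>
       \<Longrightarrow> (f' \<cdot> f) \<otimes>\<^sub>a (g' \<cdot> g) = (f' \<otimes>\<^sub>a g') \<cdot> (f \<otimes>\<^sub>a g)"
    and assoc_iso:
      "\<lbrakk>x \<in> Obj C; y \<in> Obj C; z \<in> Obj C\<rbrakk>
       \<Longrightarrow> \<alpha>\<^sub>u x y z \<in> Hom C ((x \<otimes>\<^sub>o y) \<otimes>\<^sub>o z) (x \<otimes>\<^sub>o (y \<otimes>\<^sub>o z)) \<and> is_iso C (\<alpha>\<^sub>u x y z)"
    and assoc_natural:
      "\<lbrakk>f \<in> Hom C x x'; g \<in> Hom C y y'; h \<in> Hom C z z'\<rbrakk>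
       \<Longrightarrow> \<alpha>\<^sub>u x' y' z' \<cdot> ((f \<otimes>\<^sub>a g) \<otimes>\<^sub>a h) = (f \<otimes>\<^sub>a (g \<otimes>\<^sub>a h)) \<cdot> \<alpha>\<^sub>u x y z"
    and lunit_iso: "x \<in> Obj C \<Longrightarrow> \<lambda>\<^sub>u x \<in> Hom C (\<one>\<^sub>u \<otimes>\<^sub>o x) x \<and> is_iso C (\<lambda>\<^sub>u x)"
    and lunit_natural: "f \<in> Hom C x y \<Longrightarrow> \<lambda>\<^sub>u y \<cdot> (\<I> \<one>\<^sub>u \<otimes>\<^sub>a f) = f \<cdot> \<lambda>\<^sub>u x"
    and runit_iso: "x \<in> Obj C \<Longrightarrow> \<rho>\<^sub>u x \<in> Hom C (x \<otimes>\<^sub>o \<one>\<^sub>u) x \<and> is_iso C (\<rho>\<^sub>u x)"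
    and runit_natural: "f \<in> Hom C x y \<Longrightarrow> \<rho>\<^sub>u y \<cdot> (f \<otimes>\<^sub>a \<I> \<one>\<^sub>u) = f \<cdot> \<rho>\<^sub>u x"
    and braid_in_Hom: "\<lbrakk>x \<in> Obj C; y \<in> Obj C\<rbrakk> \<Longrightarrow> \<beta>\<^sub>u x y \<in> Hom C (x \<otimes>\<^sub>o y) (y \<otimes>\<^sub>o x)"
    and braid_natural:
      "\<lbrakk>f \<in> Hom C x x'; g \<in> Hom C y y'\<rbrakk> \<Longrightarrow> \<beta>\<^sub>u x' y' \<cdot> (f \<otimes>\<^sub>a g) = (g \<otimes>\<^sub>a f) \<cdot> \<beta>\<^sub>u x y"
    and pentagon:
      "\<lbrakk>w \<in> Obj C; x \<in> Obj C; y \<in> Obj C; z \<in> Obj C\<rbrakk>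
       \<Longrightarrow> (\<I> w \<otimes>\<^sub>a \<alpha>\<^sub>u x y z) \<cdot> \<alpha>\<^sub>u w (x \<otimes>\<^sub>o y) z \<cdot> (\<alpha>\<^sub>u w x y \<otimes>\<^sub>a \<I> z)
           = \<alpha>\<^sub>u w x (y \<otimes>\<^sub>o z) \<cdot> \<alpha>\<^sub>u (w \<otimes>\<^sub>o x) y z"
    and triangle_identity:
      "\<lbrakk>x \<in> Obj C; y \<in> Obj C\<rbrakk> \<Longrightarrow> (\<I> x \<otimes>\<^sub>a \<lambda>\<^sub>u y) \<cdot> \<alpha>\<^sub>u x \<one>\<^sub>u y = \<rho>\<^sub>u x \<otimes>\<^sub>a \<I> y"
    and braid_symmetric: "\<lbrakk>x \<in> Obj C; y \<in> Obj C\<rbrakk> \<Longrightarrow> \<beta>\<^sub>u y x \<cdot> \<beta>\<^sub>u x y = \<I> (x \<otimes>\<^sub>o y)"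
    and hexagon:
      "\<lbrakk>x \<in> Obj C; y \<in> Obj C; z \<in> Obj C\<rbrakk>
       \<Longrightarrow> \<alpha>\<^sub>u y z x \<cdot> \<beta>\<^sub>u x (y \<otimes>\<^sub>o z) \<cdot> \<alpha>\<^sub>u x y z
           = (\<I> y \<otimes>\<^sub>a \<beta>\<^sub>u x z) \<cdot> \<alpha>\<^sub>u y x z \<cdot> (\<beta>\<^sub>u x y \<otimes>\<^sub>a \<I> z)"

text \<open>Closedness: each functor \<open>\<lambda>z. z \<otimes>\<^sub>o x\<close> has a right adjoint, given by universal arrows
  \<open>e : h \<otimes>\<^sub>o x \<rightarrow> y\<close>.\<close>

locale closed_symmetric_monoidal_category = symmetric_monoidal_category C
  for C :: "('o, 'a, 'm) pre_tt_category_scheme" (structure) +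
  assumes closed:
    "\<lbrakk>x \<in> Obj C; y \<in> Obj C\<rbrakk> \<Longrightarrow>
     \<exists>h \<in> Obj C. \<exists>e \<in> Hom C (h \<otimes>\<^sub>o x) y.
       \<forall>z \<in> Obj C. \<forall>f \<in> Hom C (z \<otimes>\<^sub>o x) y. \<exists>!g. g \<in> Hom C z h \<and> e \<cdot> (g \<otimes>\<^sub>a \<I> x) = f"

text \<open>The monoidal structure is compatible with the triangulation in the sense that the tensor
  product is exact in each variable. Further coherence conditions that some authors impose,
  such as the sign of the symmetry on \<open>\<Sigma>\<^sub>o \<one>\<^sub>u \<otimes>\<^sub>o \<Sigma>\<^sub>o \<one>\<^sub>u\<close>, are not assumed.\<close>

locale tt_category =
  triangulated_category C + closed_symmetric_monoidal_category C
  for C :: "('o, 'a, 'm) pre_tt_category_scheme" (structure) +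
  assumes tens_exact_left: "w \<in> Obj C \<Longrightarrow> exact_endofunctor C (\<lambda>x. x \<otimes>\<^sub>o w) (\<lambda>f. f \<otimes>\<^sub>a \<I> w)"
    and tens_exact_right: "w \<in> Obj C \<Longrightarrow> exact_endofunctor C (\<lambda>x. w \<otimes>\<^sub>o x) (\<lambda>f. \<I> w \<otimes>\<^sub>a f)"

definition rigid_object :: "('o, 'a, 'm) pre_tt_category_scheme \<Rightarrow> 'o \<Rightarrow> bool" where
  "rigid_object C x \<longleftrightarrow>
     x \<in> Obj C \<and>
     (\<exists>y \<in> Obj C. \<exists>\<eta> \<in> Hom C \<one>\<^sub>u\<^bsub>C\<^esub> (x \<otimes>\<^sub>o\<^bsub>C\<^esub> y). \<exists>\<epsilon> \<in> Hom C (y \<otimes>\<^sub>o\<^bsub>C\<^esub> x) \<one>\<^sub>u\<^bsub>C\<^esub>.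
        \<rho>\<^sub>u\<^bsub>C\<^esub> x \<cdot>\<^bsub>C\<^esub> (\<I>\<^bsub>C\<^esub> x \<otimes>\<^sub>a\<^bsub>C\<^esub> \<epsilon>) \<cdot>\<^bsub>C\<^esub> \<alpha>\<^sub>u\<^bsub>C\<^esub> x y x \<cdot>\<^bsub>C\<^esub> (\<eta> \<otimes>\<^sub>a\<^bsub>C\<^esub> \<I>\<^bsub>C\<^esub> x) = \<lambda>\<^sub>u\<^bsub>C\<^esub> x \<and>
        \<lambda>\<^sub>u\<^bsub>C\<^esub> y \<cdot>\<^bsub>C\<^esub> (\<epsilon> \<otimes>\<^sub>a\<^bsub>C\<^esub> \<I>\<^bsub>C\<^esub> y) \<cdot>\<^bsub>C\<^esub> inv_arrow C (\<alpha>\<^sub>u\<^bsub>C\<^esub> y x y) \<cdot>\<^bsub>C\<^esub> (\<I>\<^bsub>C\<^esub> y \<otimes>\<^sub>a\<^bsub>C\<^esub> \<eta>)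
          = \<rho>\<^sub>u\<^bsub>C\<^esub> y)"

locale rigidly_compactly_generated_tt_category = tt_category C
  for C :: "('o, 'a, 'm) pre_tt_category_scheme" (structure) +
  fixes \<kappa> :: "'k rel"
  assumes inaccessible: "inaccessible \<kappa>"
    and locally_small: "\<lbrakk>x \<in> Obj C; y \<in> Obj C\<rbrakk> \<Longrightarrow> |Hom C x y| <o \<kappa>"
    and small_coproducts: "has_small_coproducts \<kappa> C"
    and compactly_generated: "compactly_generated \<kappa> C"
    and compact_iff_rigid: "compact_object \<kappa> C x \<longleftrightarrow> rigid_object C x"

definition localizing_ideal ::
    "'k rel \<Rightarrow> ('o, 'a, 'm) pre_tt_category_scheme \<Rightarrow> 'o set \<Rightarrow> bool" where
  "localizing_ideal \<kappa> C S \<longleftrightarrow>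
     localizing_subcategory \<kappa> C S \<and> (\<forall>t \<in> Obj C. \<forall>x \<in> S. t \<otimes>\<^sub>o\<^bsub>C\<^esub> x \<in> S)"

definition Loc_ideal ::
    "'k rel \<Rightarrow> ('o, 'a, 'm) pre_tt_category_scheme \<Rightarrow> 'o set \<Rightarrow> 'o set" where
  "Loc_ideal \<kappa> C E = \<Inter>{S. localizing_ideal \<kappa> C S \<and> E \<subseteq> S}"


section \<open>The Balmer spectrum\<close>

definition thick_tensor_ideal ::
    "'k rel \<Rightarrow> ('o, 'a, 'm) pre_tt_category_scheme \<Rightarrow> 'o set \<Rightarrow> bool" where
  "thick_tensor_ideal \<kappa> C P \<longleftrightarrow>
     P \<subseteq> compact_objects \<kappa> C \<and> thick_subcategory C P \<and>
     (\<forall>a \<in> compact_objects \<kappa> C. \<forall>b \<in> P. a \<otimes>\<^sub>o\<^bsub>C\<^esub> b \<in> P)"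

definition Spc :: "'k rel \<Rightarrow> ('o, 'a, 'm) pre_tt_category_scheme \<Rightarrow> 'o set set" where
  "Spc \<kappa> C =
     {P. thick_tensor_ideal \<kappa> C P \<and> P \<noteq> compact_objects \<kappa> C \<and>
         (\<forall>a \<in> compact_objects \<kappa> C. \<forall>b \<in> compact_objects \<kappa> C.
            a \<otimes>\<^sub>o\<^bsub>C\<^esub> b \<in> P \<longrightarrow> a \<in> P \<or> b \<in> P)}"

definition supp :: "'k rel \<Rightarrow> ('o, 'a, 'm) pre_tt_category_scheme \<Rightarrow> 'o \<Rightarrow> 'o set set" where
  "supp \<kappa> C a = {P \<in> Spc \<kappa> C. a \<notin> P}"

text \<open>The supports form a basis of closed subsets, i.e. their complements a basis of open
  subsets.\<close>

definition Balmer_spectrum ::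
    "'k rel \<Rightarrow> ('o, 'a, 'm) pre_tt_category_scheme \<Rightarrow> 'o set topology" where
  "Balmer_spectrum \<kappa> C =
     topology (arbitrary union_of (\<lambda>U. \<exists>a \<in> compact_objects \<kappa> C. U = Spc \<kappa> C - supp \<kappa> C a))"


section \<open>Hochster duality and weakly scattered spaces\<close>

definition thomason :: "'p topology \<Rightarrow> 'p set \<Rightarrow> bool" where
  "thomason X S \<longleftrightarrow>
     (\<exists>\<Z>. S = \<Union>\<Z> \<and> (\<forall>Z \<in> \<Z>. closedin X Z \<and> compactin X (topspace X - Z)))"

definition Hochster_dual :: "'p topology \<Rightarrow> 'p topology" where
  "Hochster_dual X = topology (thomason X)"

lemma istopology_thomason: "istopology (thomason X)"
  unfolding istopology_def
proof (intro conjI allI impI)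
  fix S T assume "thomason X S" "thomason X T"
  then obtain \<A> \<B> where A: "S = \<Union>\<A>" "\<And>Z. Z \<in> \<A> \<Longrightarrow> closedin X Z \<and> compactin X (topspace X - Z)"
    and B: "T = \<Union>\<B>" "\<And>Z. Z \<in> \<B> \<Longrightarrow> closedin X Z \<and> compactin X (topspace X - Z)"
    unfolding thomason_def by metis
  have "closedin X (Y \<inter> Z) \<and> compactin X (topspace X - Y \<inter> Z)" if "Y \<in> \<A>" "Z \<in> \<B>" for Y Z
    using A(2)[OF that(1)] B(2)[OF that(2)] by (auto simp: Diff_Int intro: compactin_Un)
  moreover have "S \<inter> T = \<Union>{Y \<inter> Z | Y Z. Y \<in> \<A> \<and> Z \<in> \<B>}"
    using A(1) B(1) by auto
  ultimately show "thomason X (S \<inter> T)"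
    unfolding thomason_def by (intro exI[of _ "{Y \<inter> Z | Y Z. Y \<in> \<A> \<and> Z \<in> \<B>}"]) auto
next
  fix \<K> assume "\<forall>K\<in>\<K>. thomason X K"
  then obtain F where F: "\<And>K. K \<in> \<K> \<Longrightarrow> K = \<Union>(F K)"
    "\<And>K Z. K \<in> \<K> \<Longrightarrow> Z \<in> F K \<Longrightarrow> closedin X Z \<and> compactin X (topspace X - Z)"
    unfolding thomason_def by metis
  have "\<Union>\<K> = \<Union>(\<Union>(F ` \<K>))"
    using F(1) by blast
  with F(2) show "thomason X (\<Union>\<K>)"
    unfolding thomason_def by (intro exI[of _ "\<Union>(F ` \<K>)"]) auto
qed

lemma openin_Hochster_dual: "openin (Hochster_dual X) S \<longleftrightarrow> thomason X S"
  by (simp add: Hochster_dual_def istopology_thomason topology_inverse')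

definition weakly_isolated_point :: "'p topology \<Rightarrow> 'p set \<Rightarrow> 'p \<Rightarrow> bool" where
  "weakly_isolated_point Y S x \<longleftrightarrow>
     (\<exists>U. openin Y U \<and> {x} \<subseteq> U \<inter> S \<and> U \<inter> S \<subseteq> Y closure_of {x})"

definition weakly_scattered :: "'p topology \<Rightarrow> bool" where
  "weakly_scattered Y \<longleftrightarrow>
     (\<forall>S. closedin Y S \<longrightarrow> S \<noteq> {} \<longrightarrow> (\<exists>x. weakly_isolated_point Y S x))"

definition Hochster_weakly_scattered :: "'p topology \<Rightarrow> bool" where
  "Hochster_weakly_scattered X \<longleftrightarrow> weakly_scattered (Hochster_dual X)"

definition weakly_visible :: "'p topology \<Rightarrow> 'p set \<Rightarrow> bool" where
  "weakly_visible X W \<longleftrightarrow> (\<exists>U V. thomason X U \<and> thomason X V \<and> W = U \<inter> (topspace X - V))"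


section \<open>The local-to-global principle\<close>

definition compacts_supported_on ::
    "'k rel \<Rightarrow> ('o, 'a, 'm) pre_tt_category_scheme \<Rightarrow> 'o set set \<Rightarrow> 'o set" where
  "compacts_supported_on \<kappa> C Y = {a \<in> compact_objects \<kappa> C. supp \<kappa> C a \<subseteq> Y}"

text \<open>The triangle \<open>e \<rightarrow> \<one>\<^sub>u \<rightarrow> f \<rightarrow> \<Sigma>\<^sub>o e\<close> attached to \<open>Y\<close> is unique up to unique isomorphism only,
  so \<open>e\<close> and \<open>f\<close> are described by a relation instead of being picked by a choice operator.\<close>

definition idempotent_triangle ::
    "'k rel \<Rightarrow> ('o, 'a, 'm) pre_tt_category_scheme \<Rightarrow> 'o set set \<Rightarrow> 'o \<Rightarrow> 'o \<Rightarrow> bool" where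
  "idempotent_triangle \<kappa> C Y e f \<longleftrightarrow>
     (\<exists>u v w. exact_triangle C e \<one>\<^sub>u\<^bsub>C\<^esub> f u v w) \<and>
     e \<in> Loc \<kappa> C (compacts_supported_on \<kappa> C Y) \<and>
     (\<forall>s \<in> Loc \<kappa> C (compacts_supported_on \<kappa> C Y). Hom C s f = {Zero C s f})"

definition is_g ::
    "'k rel \<Rightarrow> ('o, 'a, 'm) pre_tt_category_scheme \<Rightarrow> 'o set set \<Rightarrow> 'o \<Rightarrow> bool" where
  "is_g \<kappa> C W g \<longleftrightarrow>
     (\<exists>U V eU fU eV fV.
        thomason (Balmer_spectrum \<kappa> C) U \<and> thomason (Balmer_spectrum \<kappa> C) V \<and>
        W = U \<inter> (Spc \<kappa> C - V) \<and>
        idempotent_triangle \<kappa> C U eU fU \<and> idempotent_triangle \<kappa> C V eV fV \<and>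
        g = eU \<otimes>\<^sub>o\<^bsub>C\<^esub> fV)"

text \<open>The principle is required for every choice of representatives \<open>g W\<close>; a different choice
  gives isomorphic objects. An indexed cover enters only through the set of its members.\<close>

definition local_to_global_principle ::
    "'k rel \<Rightarrow> ('o, 'a, 'm) pre_tt_category_scheme \<Rightarrow> bool" where
  "local_to_global_principle \<kappa> C \<longleftrightarrow>
     (\<forall>t \<in> Obj C. \<forall>\<W> g.
        (\<forall>W \<in> \<W>. weakly_visible (Balmer_spectrum \<kappa> C) W \<and> is_g \<kappa> C W (g W)) \<longrightarrow>
        Spc \<kappa> C = \<Union>\<W> \<longrightarrow>
        Loc_ideal \<kappa> C {t} = Loc_ideal \<kappa> C {t \<otimes>\<^sub>o\<^bsub>C\<^esub> g W | W. W \<in> \<W>})"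

end

theory Submission
  imports Defs
begin

text \<open>
  Let \<open>L\<close> be the localizing ideal generated by the objects \<open>t \<otimes> g W\<close>. The compact objects \<open>a\<close> with
  \<open>a \<otimes> t \<in> L\<close> form a thick ideal, which is radical because compact objects are rigid, so it consists
  of all compact objects supported on the Thomason set \<open>Y\<close>, the union of the supports of its members.
  If \<open>Y\<close> is not the whole spectrum, its complement has a weakly isolated point \<open>x\<close> in the Hochster dual
  topology; let \<open>W = U - V\<close> be a member of the cover containing \<open>x\<close>. Some compact \<open>a\<close> has \<open>x\<close> in its
  support, is supported on \<open>U\<close>, and satisfies \<open>supp a \<inter> V \<subseteq> Y\<close>, since the dual closure of \<open>x\<close> avoids
  \<open>V\<close>. The last inclusion gives \<open>e\<^sub>V \<otimes> a \<otimes> t \<in> L\<close>; together with \<open>t \<otimes> e\<^sub>U \<otimes> f\<^sub>V \<in> L\<close> it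
  yields \<open>e\<^sub>U \<otimes> a \<otimes> t \<in> L\<close>, hence \<open>a \<otimes> t \<in> L\<close> because \<open>a\<close> is a retract of \<open>e\<^sub>U \<otimes> a\<close>. So
  \<open>x \<in> Y\<close>, a contradiction. Thus \<open>Y\<close> is everything, the unit lies in the thick ideal, and \<open>t \<in> L\<close>.

  Compactness of \<open>x\<close> is used in the form: every map from \<open>x\<close> to a coproduct is fixed by the truncation
  of the coproduct to finitely many summands.
\<close>

section \<open>Categories and symmetric monoidal categories\<close>

text \<open>The dual closure of \<open>x\<close> avoids \<open>V\<close> because Thomason sets are
  open in the dual topology: the complement of \<open>V\<close> is dual-closed and contains
  \<open>x\<close>. The passage between topology and ideals imitates commutative algebra. An ideal
  maximal among those disjoint from a tensor-multiplicative set is prime; this one argument gives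
  both the quasi-compactness of complements of supports and the fact that a compact object belongs
  to a localizing ideal as soon as its support is covered by the supports of the compact objects in
  that ideal. Three obstacles shape the preliminaries. The definition of compactness compares groups
  of families, which is awkward under functors; truncations are arrows of the category, and
  suspension and tensor functors carry them to truncations. The suspension is only an equivalence,
  so coproducts have to be transported back along it. Finally, duality and the vanishing of maps
  produce retracts without complements, whereas localizing subcategories are defined by triangles
  and coproducts; a countable swindle closes them under retracts.\<close>

lemma Hom_iff: "f \<in> Hom C x y \<longleftrightarrow> f \<in> Arr C \<and> Dom C f = x \<and> Cod C f = y"
  by (simp add: Hom_def)

context category
begin

lemma arr_Hom: "f \<in> Arr C \<Longrightarrow> f \<in> Hom C (Dom C f) (Cod C f)"
  by (simp add: Hom_iff)

lemma Hom_Obj: "f \<in> Hom C x y \<Longrightarrow> x \<in> Obj C \<and> y \<in> Obj C"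
  using dom_in_Obj cod_in_Obj by (auto simp: Hom_iff)

lemma comp_arr:
  assumes "f \<in> Arr C" "g \<in> Arr C" "Dom C g = Cod C f"
  shows "g \<cdot> f \<in> Arr C" "Dom C (g \<cdot> f) = Dom C f" "Cod C (g \<cdot> f) = Cod C g"
  using comp_in_Hom[of f "Dom C f" "Cod C f" g "Cod C g"] assms by (auto simp: Hom_iff)

lemma ident_arr:
  assumes "x \<in> Obj C"
  shows "\<I> x \<in> Arr C" "Dom C (\<I> x) = x" "Cod C (\<I> x) = x"
  using ident_in_Hom[OF assms] by (auto simp: Hom_iff)

lemma ident_comp_arr: "\<lbrakk>f \<in> Arr C; Cod C f = x\<rbrakk> \<Longrightarrow> \<I> x \<cdot> f = f"
  using ident_comp[of f "Dom C f" x] by (auto simp: Hom_iff)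

lemma comp_ident_arr: "\<lbrakk>f \<in> Arr C; Dom C f = x\<rbrakk> \<Longrightarrow> f \<cdot> \<I> x = f"
  using comp_ident[of f x "Cod C f"] by (auto simp: Hom_iff)

lemma comp_assoc_arr:
  "\<lbrakk>f \<in> Arr C; g \<in> Arr C; h \<in> Arr C; Dom C g = Cod C f; Dom C h = Cod C g\<rbrakk>
   \<Longrightarrow> (h \<cdot> g) \<cdot> f = h \<cdot> g \<cdot> f"
  using comp_assoc[of f "Dom C f" "Cod C f" g "Cod C g" h "Cod C h"] by (auto simp: Hom_iff)

text \<open>The locale axioms are phrased with \<open>Hom\<close>, whose objects the simplifier
  would have to guess. With \<open>Arr\<close>, \<open>Dom\<close> and \<open>Cod\<close> the side
  conditions become equations, so this set normalizes composites to right-nested form and checks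
  their typing by rewriting.\<close>

lemmas cat_simps = comp_arr ident_arr ident_comp_arr comp_ident_arr comp_assoc_arr
  dom_in_Obj cod_in_Obj

lemma is_isoE:
  assumes "is_iso C f" "f \<in> Hom C x y"
  obtains g where "g \<in> Hom C y x" "g \<cdot> f = \<I> x" "f \<cdot> g = \<I> y"
  using assms by (auto simp: is_iso_def inverse_arrows_def Hom_iff)

lemma is_isoI:
  assumes "f \<in> Hom C x y" "g \<in> Hom C y x" "g \<cdot> f = \<I> x" "f \<cdot> g = \<I> y"
  shows "is_iso C f"
  unfolding is_iso_def inverse_arrows_def using assms by (auto simp: Hom_iff)

text \<open>A two-sided inverse is unique, so the definite description in \<open>inv_arrow\<close>
  denotes it. The second zigzag identity of \<open>rigid_object\<close> refers to the inverse
  associator in this form.\<close>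

lemma inv_arrow_props:
  assumes "is_iso C f" "f \<in> Hom C x y"
  shows "inv_arrow C f \<in> Hom C y x" "inv_arrow C f \<cdot> f = \<I> x" "f \<cdot> inv_arrow C f = \<I> y"
proof -
  obtain g where g: "g \<in> Hom C y x" "g \<cdot> f = \<I> x" "f \<cdot> g = \<I> y"
    using assms by (rule is_isoE)
  have "inv_arrow C f = g"
    unfolding inv_arrow_def
  proof (rule the_equality)
    show "inverse_arrows C f g"
      using g assms by (auto simp: inverse_arrows_def Hom_iff)
    fix h assume "inverse_arrows C f h"
    then have h: "h \<in> Hom C y x" "h \<cdot> f = \<I> x" 
      using assms by (auto simp: inverse_arrows_def Hom_iff)
    have "h = h \<cdot> f \<cdot> g"
      using g h comp_ident[of h y x] by simp
    also have "... = (h \<cdot> f) \<cdot> g"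
      using comp_assoc g h assms by metis
    finally show "h = g"
      using g h ident_comp[of g y x] by simp
  qed
  with g show "inv_arrow C f \<in> Hom C y x" "inv_arrow C f \<cdot> f = \<I> x" "f \<cdot> inv_arrow C f = \<I> y"
    by simp_all
qed

lemma iso_cancel_left:
  assumes "is_iso C u" "u \<in> Hom C y z" "f \<in> Hom C x y" "g \<in> Hom C x y" "u \<cdot> f = u \<cdot> g"
  shows "f = g"
proof -
  obtain v where v: "v \<in> Hom C z y" "v \<cdot> u = \<I> y"
    using assms is_isoE by metis
  have "(v \<cdot> u) \<cdot> f = (v \<cdot> u) \<cdot> g"
    using comp_assoc[OF assms(3,2) v(1)] comp_assoc[OF assms(4,2) v(1)] assms(5) by simp
  then show ?thesis
    using v(2) ident_comp[OF assms(3)] ident_comp[OF assms(4)] by simp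
qed

lemma iso_cancel_right:
  assumes "is_iso C u" "u \<in> Hom C x y" "f \<in> Hom C y z" "g \<in> Hom C y z" "f \<cdot> u = g \<cdot> u"
  shows "f = g"
proof -
  obtain v where v: "v \<in> Hom C y x" "u \<cdot> v = \<I> y"
    using assms is_isoE by metis
  have "f \<cdot> (u \<cdot> v) = g \<cdot> (u \<cdot> v)"
    using comp_assoc[OF v(1) assms(2,3)] comp_assoc[OF v(1) assms(2,4)] assms(5) by simp
  then show ?thesis
    using v(2) comp_ident[OF assms(3)] comp_ident[OF assms(4)] by simp
qed

lemma isomorphicE:
  assumes "isomorphic C x y"
  obtains u v where "u \<in> Hom C x y" "v \<in> Hom C y x" "v \<cdot> u = \<I> x" "u \<cdot> v = \<I> y"
  using assms unfolding isomorphic_def by (blast elim: is_isoE)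

lemma isomorphicI:
  assumes "u \<in> Hom C x y" "v \<in> Hom C y x" "v \<cdot> u = \<I> x" "u \<cdot> v = \<I> y"
  shows "isomorphic C x y"
  using assms is_isoI unfolding isomorphic_def by blast

lemma isomorphic_sym: "isomorphic C x y \<Longrightarrow> isomorphic C y x"
  by (blast elim: isomorphicE intro: isomorphicI)

lemma isomorphic_Obj: "isomorphic C x y \<Longrightarrow> x \<in> Obj C \<and> y \<in> Obj C"
  by (blast elim: isomorphicE dest: Hom_Obj)

lemma is_iso_comp:
  assumes "f \<in> Hom C x y" "g \<in> Hom C y z" "is_iso C f" "is_iso C g"
  shows "is_iso C (g \<cdot> f)"
proof -
  obtain f' where f': "f' \<in> Hom C y x" "f' \<cdot> f = \<I> x" "f \<cdot> f' = \<I> y"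
    using assms is_isoE by metis
  obtain g' where g': "g' \<in> Hom C z y" "g' \<cdot> g = \<I> y" "g \<cdot> g' = \<I> z"
    using assms is_isoE by metis
  have "(f' \<cdot> g') \<cdot> (g \<cdot> f) = f' \<cdot> (g' \<cdot> g) \<cdot> f"
    using assms f'(1) g'(1) by (simp add: Hom_iff cat_simps)
  moreover have "(g \<cdot> f) \<cdot> (f' \<cdot> g') = g \<cdot> (f \<cdot> f') \<cdot> g'"
    using assms f'(1) g'(1) by (simp add: Hom_iff cat_simps)
  ultimately show ?thesis
    using f' g' assms
    by (intro is_isoI[of _ x z "f' \<cdot> g'"]) (auto simp: Hom_iff cat_simps)
qed

lemma isomorphic_trans: "\<lbrakk>isomorphic C x y; isomorphic C y z\<rbrakk> \<Longrightarrow> isomorphic C x z"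
  unfolding isomorphic_def using is_iso_comp comp_in_Hom by blast

lemma isomorphic_refl: "x \<in> Obj C \<Longrightarrow> isomorphic C x x"
  using isomorphicI[of "\<I> x" x x "\<I> x"] ident_in_Hom[of x] ident_comp[of "\<I> x" x x]
  by blast

end

section \<open>Symmetric monoidal categories: typing rules and canonical isomorphisms\<close>

context symmetric_monoidal_category
begin

lemma tens_arr:
  assumes "f \<in> Arr C" "g \<in> Arr C"
  shows "f \<otimes>\<^sub>a g \<in> Arr C" "Dom C (f \<otimes>\<^sub>a g) = Dom C f \<otimes>\<^sub>o Dom C g"
    "Cod C (f \<otimes>\<^sub>a g) = Cod C f \<otimes>\<^sub>o Cod C g"
  using tens_in_Hom[OF arr_Hom[OF assms(1)] arr_Hom[OF assms(2)]] by (auto simp: Hom_iff)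

lemma tens_comp_arr:
  assumes "f \<in> Arr C" "f' \<in> Arr C" "g \<in> Arr C" "g' \<in> Arr C" "Dom C f' = Cod C f" "Dom C g' = Cod C g"
  shows "(f' \<otimes>\<^sub>a g') \<cdot> (f \<otimes>\<^sub>a g) = (f' \<cdot> f) \<otimes>\<^sub>a (g' \<cdot> g)"
  using tens_comp[of f "Dom C f" "Cod C f" f' "Cod C f'" g "Dom C g" "Cod C g" g' "Cod C g'"] assms
  by (auto simp: Hom_iff)

text \<open>The interchange law with a tail \<open>h\<close>: composites are right-nested, so
  \<open>tens_comp_arr\<close> matches only the last two factors of a chain and this variant is
  needed everywhere else.\<close>

lemma tens_comp_comp_arr:
  assumes "f \<in> Arr C" "f' \<in> Arr C" "g \<in> Arr C" "g' \<in> Arr C" "Dom C f' = Cod C f" "Dom C g' = Cod C g"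
    "h \<in> Arr C" "Cod C h = Dom C f \<otimes>\<^sub>o Dom C g"
  shows "(f' \<otimes>\<^sub>a g') \<cdot> (f \<otimes>\<^sub>a g) \<cdot> h = ((f' \<cdot> f) \<otimes>\<^sub>a (g' \<cdot> g)) \<cdot> h"
  by (subst tens_comp_arr[symmetric, OF assms(1-6)])
    (simp add: assms comp_assoc_arr tens_arr)

lemma assoc_arr:
  assumes "x \<in> Obj C" "y \<in> Obj C" "z \<in> Obj C"
  shows "\<alpha>\<^sub>u x y z \<in> Arr C" "Dom C (\<alpha>\<^sub>u x y z) = (x \<otimes>\<^sub>o y) \<otimes>\<^sub>o z" "Cod C (\<alpha>\<^sub>u x y z) = x \<otimes>\<^sub>o (y \<otimes>\<^sub>o z)"
    "is_iso C (\<alpha>\<^sub>u x y z)"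
  using assoc_iso[OF assms] by (auto simp: Hom_iff)

lemma unit_arr:
  assumes "x \<in> Obj C"
  shows "\<lambda>\<^sub>u x \<in> Arr C" "Dom C (\<lambda>\<^sub>u x) = \<one>\<^sub>u \<otimes>\<^sub>o x" "Cod C (\<lambda>\<^sub>u x) = x" "is_iso C (\<lambda>\<^sub>u x)"
    "\<rho>\<^sub>u x \<in> Arr C" "Dom C (\<rho>\<^sub>u x) = x \<otimes>\<^sub>o \<one>\<^sub>u" "Cod C (\<rho>\<^sub>u x) = x" "is_iso C (\<rho>\<^sub>u x)"
  using lunit_iso[OF assms] runit_iso[OF assms] by (auto simp: Hom_iff)

lemma braid_arr:
  assumes "x \<in> Obj C" "y \<in> Obj C"
  shows "\<beta>\<^sub>u x y \<in> Arr C" "Dom C (\<beta>\<^sub>u x y) = x \<otimes>\<^sub>o y" "Cod C (\<beta>\<^sub>u x y) = y \<otimes>\<^sub>o x"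
  using braid_in_Hom[OF assms] by (auto simp: Hom_iff)

lemmas mon_simps = cat_simps tens_arr assoc_arr unit_arr braid_arr unit_in_Obj tens_in_Obj tens_ident

lemma is_iso_tens:
  assumes "f \<in> Hom C x x'" "g \<in> Hom C y y'" "is_iso C f" "is_iso C g"
  shows "is_iso C (f \<otimes>\<^sub>a g)"
proof -
  obtain f' where f': "f' \<in> Hom C x' x" "f' \<cdot> f = \<I> x" "f \<cdot> f' = \<I> x'"
    using assms is_isoE by metis
  obtain g' where g': "g' \<in> Hom C y' y" "g' \<cdot> g = \<I> y" "g \<cdot> g' = \<I> y'"
    using assms is_isoE by metis
  have "x \<in> Obj C" "x' \<in> Obj C" "y \<in> Obj C" "y' \<in> Obj C"
    using Hom_Obj assms by auto
  then show ?thesis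
    using assms f' g'
    by (intro is_isoI[of _ "x \<otimes>\<^sub>o y" "x' \<otimes>\<^sub>o y'" "f' \<otimes>\<^sub>a g'"])
      (auto simp: Hom_iff tens_comp_arr mon_simps)
qed

lemma isomorphic_tens:
  "\<lbrakk>isomorphic C x x'; isomorphic C y y'\<rbrakk> \<Longrightarrow> isomorphic C (x \<otimes>\<^sub>o y) (x' \<otimes>\<^sub>o y')"
  unfolding isomorphic_def using is_iso_tens tens_in_Hom by blast

lemma isomorphic_assoc:
  "\<lbrakk>x \<in> Obj C; y \<in> Obj C; z \<in> Obj C\<rbrakk> \<Longrightarrow> isomorphic C ((x \<otimes>\<^sub>o y) \<otimes>\<^sub>o z) (x \<otimes>\<^sub>o (y \<otimes>\<^sub>o z))"
  using assoc_iso unfolding isomorphic_def by blast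

lemma isomorphic_braid:
  "\<lbrakk>x \<in> Obj C; y \<in> Obj C\<rbrakk> \<Longrightarrow> isomorphic C (x \<otimes>\<^sub>o y) (y \<otimes>\<^sub>o x)"
  using isomorphicI[OF braid_in_Hom braid_in_Hom] braid_symmetric by blast

lemma isomorphic_left_commute:
  assumes "x \<in> Obj C" "y \<in> Obj C" "z \<in> Obj C"
  shows "isomorphic C (x \<otimes>\<^sub>o (y \<otimes>\<^sub>o z)) (y \<otimes>\<^sub>o (x \<otimes>\<^sub>o z))"
proof -
  have "isomorphic C ((x \<otimes>\<^sub>o y) \<otimes>\<^sub>o z) ((y \<otimes>\<^sub>o x) \<otimes>\<^sub>o z)"
    using assms isomorphic_tens isomorphic_braid isomorphic_refl by blast
  then show ?thesis
    using isomorphic_trans[OF isomorphic_trans[OF isomorphic_sym[OF isomorphic_assoc]] isomorphic_assoc]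
      assms by simp
qed

lemma isomorphic_lunit: "x \<in> Obj C \<Longrightarrow> isomorphic C (\<one>\<^sub>u \<otimes>\<^sub>o x) x"
  using lunit_iso unfolding isomorphic_def by blast

text \<open>Naturality of \<open>\<rho>\<^sub>u\<close> makes
  \<open>f \<otimes>\<^sub>a \<I> \<one>\<^sub>u\<close> conjugate to \<open>f\<close>, so tensoring
  with the unit reflects equality. This is what lets coherence identities be checked after adding a
  unit factor.\<close>

lemma runit_faithful:
  assumes "f \<in> Hom C x y" "g \<in> Hom C x y" "f \<otimes>\<^sub>a \<I> \<one>\<^sub>u = g \<otimes>\<^sub>a \<I> \<one>\<^sub>u"
  shows "f = g"
proof -
  have "f \<cdot> \<rho>\<^sub>u x = g \<cdot> \<rho>\<^sub>u x"
    using runit_natural assms by metis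
  then show ?thesis
    using iso_cancel_right runit_iso Hom_Obj assms by metis
qed

lemma lunit_faithful:
  assumes "f \<in> Hom C x y" "g \<in> Hom C x y" "\<I> \<one>\<^sub>u \<otimes>\<^sub>a f = \<I> \<one>\<^sub>u \<otimes>\<^sub>a g"
  shows "f = g"
proof -
  have "f \<cdot> \<lambda>\<^sub>u x = g \<cdot> \<lambda>\<^sub>u x"
    using lunit_natural assms by metis
  then show ?thesis
    using iso_cancel_right lunit_iso Hom_Obj assms by metis
qed

end


section \<open>Additive and triangulated categories\<close>

context additive_category
begin

lemma zero_in_Hom: "\<lbrakk>x \<in> Obj C; y \<in> Obj C\<rbrakk> \<Longrightarrow> Zero C x y \<in> Hom C x y"
  using monoid.one_closed[OF group.is_monoid[OF comm_group.axioms(2)[OF hom_comm_group]], of x y]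
  by (simp add: hom_group_def)

context
  fixes x y f
  assumes f: "f \<in> Hom C x y"
begin

interpretation G: comm_group "hom_group C x y"
  using hom_comm_group Hom_Obj[OF f] by blast

lemma plus_in_Hom: "g \<in> Hom C x y \<Longrightarrow> Plus C f g \<in> Hom C x y"
  using f G.m_closed[of f g] by (simp add: hom_group_def)

lemma plus_assoc:
  "\<lbrakk>g \<in> Hom C x y; h \<in> Hom C x y\<rbrakk> \<Longrightarrow> Plus C (Plus C f g) h = Plus C f (Plus C g h)"
  using f G.m_assoc[of f g h] by (simp add: hom_group_def)

lemma plus_comm: "g \<in> Hom C x y \<Longrightarrow> Plus C f g = Plus C g f"
  using f G.m_comm[of f g] by (simp add: hom_group_def)

lemma plus_zero: "Plus C f (Zero C x y) = f"
  using f G.r_one[of f] by (simp add: hom_group_def)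

lemma zero_plus: "Plus C (Zero C x y) f = f"
  using f G.l_one[of f] by (simp add: hom_group_def)

lemma neg_in_Hom: "neg C f \<in> Hom C x y"
  using f G.inv_closed[of f] by (simp add: hom_group_def neg_def Hom_iff)

lemma plus_neg: "Plus C f (neg C f) = Zero C x y"
  using f G.r_inv[of f] by (simp add: hom_group_def neg_def Hom_iff)

lemma neg_plus: "Plus C (neg C f) f = Zero C x y"
  using f G.l_inv[of f] by (simp add: hom_group_def neg_def Hom_iff)

lemma neg_unique: "\<lbrakk>g \<in> Hom C x y; Plus C g f = Zero C x y\<rbrakk> \<Longrightarrow> neg C f = g"
  using f G.inv_equality[of g f] by (simp add: hom_group_def neg_def Hom_iff)

lemma plus_idem_zero: "Plus C f f = f \<Longrightarrow> f = Zero C x y"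
  using f G.r_cancel_one[of f f] by (simp add: hom_group_def)

end

lemma neg_neg: "f \<in> Hom C x y \<Longrightarrow> neg C (neg C f) = f"
  using neg_unique[OF neg_in_Hom _ plus_neg] by blast

lemma neg_inject: "\<lbrakk>f \<in> Hom C x y; g \<in> Hom C x y; neg C f = neg C g\<rbrakk> \<Longrightarrow> f = g"
  using neg_neg by metis

lemma eq_if_diff_zero:
  assumes "f \<in> Hom C x y" "g \<in> Hom C x y" "Plus C f (neg C g) = Zero C x y"
  shows "f = g"
  using neg_unique[OF neg_in_Hom[OF assms(2)] assms(1,3)] neg_neg[OF assms(2)]
  by simp

lemma plus_diff_cancel:
  assumes "f \<in> Hom C x y" "g \<in> Hom C x y"
  shows "Plus C g (Plus C f (neg C g)) = f"
proof -
  have "Plus C g (Plus C f (neg C g)) = Plus C (Plus C f (neg C g)) g"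
    using assms plus_comm plus_in_Hom neg_in_Hom by blast
  also have "... = Plus C f (Plus C (neg C g) g)"
    using assms plus_assoc neg_in_Hom by blast
  finally show ?thesis
    using assms by (simp add: neg_plus plus_zero)
qed

text \<open>By distributivity the composite equals its own double, and in a group only the neutral
  element does.\<close>

lemma comp_zero:
  assumes "g \<in> Hom C y z" "x \<in> Obj C"
  shows "g \<cdot> Zero C x y = Zero C x z"
proof -
  have 0: "Zero C x y \<in> Hom C x y"
    using assms zero_in_Hom Hom_Obj by blast
  then have "g \<cdot> Zero C x y \<in> Hom C x z"
    using comp_in_Hom assms by blast
  moreover have "Plus C (g \<cdot> Zero C x y) (g \<cdot> Zero C x y) = g \<cdot> Zero C x y"
    using plus_comp[OF 0 0 assms(1)] plus_zero[OF 0] by simp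
  ultimately show ?thesis
    by (rule plus_idem_zero)
qed

lemma zero_comp:
  assumes "f \<in> Hom C x y" "z \<in> Obj C"
  shows "Zero C y z \<cdot> f = Zero C x z"
proof -
  have 0: "Zero C y z \<in> Hom C y z"
    using assms zero_in_Hom Hom_Obj by blast
  then have "Zero C y z \<cdot> f \<in> Hom C x z"
    using comp_in_Hom assms by blast
  moreover have "Plus C (Zero C y z \<cdot> f) (Zero C y z \<cdot> f) = Zero C y z \<cdot> f"
    using comp_plus[OF assms(1) 0 0] plus_zero[OF 0] by simp
  ultimately show ?thesis
    by (rule plus_idem_zero)
qed

lemma neg_comp:
  assumes "f \<in> Hom C x y" "g \<in> Hom C y z"
  shows "neg C g \<cdot> f = neg C (g \<cdot> f)"
proof (rule neg_unique[symmetric])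
  show "g \<cdot> f \<in> Hom C x z" "neg C g \<cdot> f \<in> Hom C x z"
    using assms comp_in_Hom neg_in_Hom by blast+
  show "Plus C (neg C g \<cdot> f) (g \<cdot> f) = Zero C x z"
    using comp_plus[OF assms(1) neg_in_Hom[OF assms(2)] assms(2)] neg_plus[OF assms(2)]
      zero_comp[OF assms(1)] Hom_Obj[OF assms(2)] by simp
qed

lemma comp_neg:
  assumes "f \<in> Hom C x y" "g \<in> Hom C y z"
  shows "g \<cdot> neg C f = neg C (g \<cdot> f)"
proof (rule neg_unique[symmetric])
  show "g \<cdot> f \<in> Hom C x z" "g \<cdot> neg C f \<in> Hom C x z"
    using assms comp_in_Hom neg_in_Hom by blast+
  show "Plus C (g \<cdot> neg C f) (g \<cdot> f) = Zero C x z"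
    using plus_comp[OF neg_in_Hom[OF assms(1)] assms(1,2)] neg_plus[OF assms(1)]
      comp_zero[OF assms(2)] Hom_Obj[OF assms(1)] by simp
qed

lemma zero_objectI:
  assumes "z \<in> Obj C" "\<I> z = Zero C z z"
  shows "is_zero_object C z"
proof -
  have "f = Zero C z x" if "f \<in> Hom C z x" for f x
    using comp_zero[OF that assms(1)] comp_ident[OF that] assms(2) by simp
  moreover have "f = Zero C x z" if "f \<in> Hom C x z" for f x
    using zero_comp[OF that assms(1)] ident_comp[OF that] assms(2) by simp
  ultimately show ?thesis
    unfolding is_zero_object_def using assms(1) zero_in_Hom by blast
qed

lemma zero_objectD:
  assumes "is_zero_object C z"
  shows "z \<in> Obj C" "f \<in> Hom C z x \<Longrightarrow> f = Zero C z x" "f \<in> Hom C x z \<Longrightarrow> f = Zero C x z"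
proof -
  show z: "z \<in> Obj C"
    using assms unfolding is_zero_object_def by blast
  have *: "(\<exists>!f. f \<in> Hom C z x) \<and> (\<exists>!f. f \<in> Hom C x z)" if "x \<in> Obj C" for x
    using assms that unfolding is_zero_object_def by blast
  show "f = Zero C z x" if "f \<in> Hom C z x"
    using *[of x] that zero_in_Hom[OF z, of x] Hom_Obj[OF that] by blast
  show "f = Zero C x z" if "f \<in> Hom C x z"
    using *[of x] that zero_in_Hom[OF _ z, of x] Hom_Obj[OF that] by blast
qed

end


context additive_endofunctor
begin

lemma map_zero:
  assumes "additive_category C" "x \<in> Obj C" "y \<in> Obj C"
  shows "Fa (Zero C x y) = Zero C (Fo x) (Fo y)"
proof -
  interpret additive_category C by fact
  have 0: "Zero C x y \<in> Hom C x y"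
    using assms zero_in_Hom by blast
  have "Plus C (Fa (Zero C x y)) (Fa (Zero C x y)) = Fa (Zero C x y)"
    using map_plus[OF 0 0] plus_zero[OF 0] by simp
  then show ?thesis
    using plus_idem_zero map_Hom[OF 0] by blast
qed

end

context endofunctor
begin

lemma map_iso:
  assumes "f \<in> Hom C x y" "is_iso C f"
  shows "is_iso C (Fa f)"
proof -
  obtain g where g: "g \<in> Hom C y x" "g \<cdot> f = \<I> x" "f \<cdot> g = \<I> y"
    using assms is_isoE by metis
  have "Fa g \<cdot> Fa f = \<I> (Fo x)" "Fa f \<cdot> Fa g = \<I> (Fo y)"
    using map_comp[OF assms(1) g(1)] map_comp[OF g(1) assms(1)] g map_ident Hom_Obj[OF g(1)] by auto
  then show ?thesis
    using is_isoI[OF map_Hom[OF assms(1)] map_Hom[OF g(1)]] by blast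
qed

lemma map_isomorphic: "isomorphic C x y \<Longrightarrow> isomorphic C (Fo x) (Fo y)"
  unfolding isomorphic_def using map_Hom map_iso by blast

end


section \<open>Triangles: weak kernels, weak cokernels and split triangles\<close>

context triangulated_category
begin

sublocale susp: additive_endofunctor C "SuspO C" "SuspA C"
  by (rule susp_additive)

lemma susp_inject:
  assumes "f \<in> Hom C x y" "g \<in> Hom C x y" "\<Sigma>\<^sub>a f = \<Sigma>\<^sub>a g"
  shows "f = g"
  using susp_fully_faithful[of x y] assms Hom_Obj[OF assms(1)] unfolding bij_betw_def inj_on_def
  by blast

lemma susp_full:
  assumes "f \<in> Hom C (\<Sigma>\<^sub>o x) (\<Sigma>\<^sub>o y)" "x \<in> Obj C" "y \<in> Obj C"
  obtains g where "g \<in> Hom C x y" "\<Sigma>\<^sub>a g = f"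
proof -
  have "f \<in> SuspA C ` Hom C x y"
    using bij_betw_imp_surj_on[OF susp_fully_faithful[OF assms(2,3)]] assms(1) by simp
  then show thesis
    using that by blast
qed

lemma susp_zero: "\<lbrakk>x \<in> Obj C; y \<in> Obj C\<rbrakk> \<Longrightarrow> \<Sigma>\<^sub>a (Zero C x y) = Zero C (\<Sigma>\<^sub>o x) (\<Sigma>\<^sub>o y)"
  using susp.map_zero additive_category_axioms by blast

lemma susp_zero_object:
  assumes "is_zero_object C z"
  shows "is_zero_object C (\<Sigma>\<^sub>o z)"
proof (rule zero_objectI)
  have z: "z \<in> Obj C"
    using assms zero_objectD by blast
  then show "\<Sigma>\<^sub>o z \<in> Obj C"
    by (rule susp.map_Obj)
  show "\<I> (\<Sigma>\<^sub>o z) = Zero C (\<Sigma>\<^sub>o z) (\<Sigma>\<^sub>o z)"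
    using zero_objectD(2)[OF assms ident_in_Hom[OF z]] susp.map_ident[OF z] susp_zero[OF z z] by simp
qed

lemma exact_Hom:
  assumes "exact_triangle C x y z f g h"
  shows "f \<in> Hom C x y" "g \<in> Hom C y z" "h \<in> Hom C z (\<Sigma>\<^sub>o x)" "x \<in> Obj C" "y \<in> Obj C" "z \<in> Obj C"
  using assms Hom_Obj[of f x y] Hom_Obj[of g y z] unfolding exact_triangle_def candidate_triangle_def
  by auto

lemma rotate:
  assumes "exact_triangle C x y z f g h"
  shows "exact_triangle C y z (\<Sigma>\<^sub>o x) g h (neg C (\<Sigma>\<^sub>a f))"
  using assms TR2[of x y z f g h] unfolding exact_triangle_def by blast

text \<open>The identity triangle ending in the zero object \<open>\<Sigma>\<^sub>o z\<close>,
  rotated backwards by reading \<open>TR2\<close> from right to left.\<close>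

lemma exact_zero_ident:
  assumes "w \<in> Obj C" "is_zero_object C z"
  shows "exact_triangle C z w w (Zero C z w) (\<I> w) (Zero C w (\<Sigma>\<^sub>o z))"
proof -
  have z: "z \<in> Obj C" "\<Sigma>\<^sub>o z \<in> Obj C" "\<Sigma>\<^sub>o w \<in> Obj C"
    using assms zero_objectD susp.map_Obj by blast+
  have "candidate_triangle C z w w (Zero C z w) (\<I> w) (Zero C w (\<Sigma>\<^sub>o z))"
    unfolding candidate_triangle_def using assms z zero_in_Hom ident_in_Hom by blast
  moreover have "neg C (\<Sigma>\<^sub>a (Zero C z w)) = Zero C (\<Sigma>\<^sub>o z) (\<Sigma>\<^sub>o w)"
    using zero_objectD(2)[OF susp_zero_object[OF assms(2)]]
      neg_in_Hom[OF susp.map_Hom[OF zero_in_Hom[OF z(1) assms(1)]]] by blast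
  moreover have "exact_triangle C w w (\<Sigma>\<^sub>o z) (\<I> w) (Zero C w (\<Sigma>\<^sub>o z)) (Zero C (\<Sigma>\<^sub>o z) (\<Sigma>\<^sub>o w))"
    using TR1_ident[OF assms(1) susp_zero_object[OF assms(2)]] .
  ultimately show ?thesis
    using TR2 by simp
qed

text \<open>\<open>TR3\<close> applied to the map into the triangle \<open>0, w, w\<close> with
  components zero and \<open>\<phi>\<close>; its third component is the factorization.\<close>

lemma weak_cokernel:
  assumes tri: "exact_triangle C x y z f g h" and \<phi>: "\<phi> \<in> Hom C y w" "\<phi> \<cdot> f = Zero C x w"
  obtains \<psi> where "\<psi> \<in> Hom C z w" "\<psi> \<cdot> g = \<phi>"
proof -
  note T = exact_Hom[OF tri]
  obtain o' where o': "is_zero_object C o'"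
    using ex_zero_object by blast
  have w: "w \<in> Obj C" "o' \<in> Obj C"
    using \<phi>(1) Hom_Obj zero_objectD(1)[OF o'] by blast+
  have "\<phi> \<cdot> f = Zero C o' w \<cdot> Zero C x o'"
    using zero_comp[of "Zero C x o'" x o' w] zero_in_Hom T(4) w \<phi>(2) by simp
  then obtain \<psi> where "\<psi> \<in> Hom C z w" "\<psi> \<cdot> g = \<I> w \<cdot> \<phi>"
    using TR3[OF tri exact_zero_ident[OF w(1) o'], of "Zero C x o'" \<phi>] zero_in_Hom[OF T(4) w(2)] \<phi>(1)
    by blast
  then show thesis
    using that ident_comp[OF \<phi>(1)] by simp
qed

lemma triangle_comp_zero:
  assumes tri: "exact_triangle C x y z f g h"
  shows "g \<cdot> f = Zero C x z"
proof -
  note T = exact_Hom[OF tri]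
  obtain o' where o': "is_zero_object C o'"
    using ex_zero_object by blast
  obtain w where "w \<in> Hom C o' z" "w \<cdot> Zero C x o' = g \<cdot> f"
    using TR3[OF TR1_ident[OF T(4) o'] tri ident_in_Hom[OF T(4)] T(1)] by blast
  then show ?thesis
    using comp_zero[OF _ T(4)] by metis
qed

text \<open>\<open>TR3\<close> completes only the third map, whereas here the first is sought. Both
  triangles are therefore rotated, the completion is a map between suspensions, and fullness of the
  suspension brings it back; the signs from \<open>TR2\<close> occur on both sides and
  cancel.\<close>

lemma weak_kernel:
  assumes tri: "exact_triangle C x y z f g h" and \<phi>: "\<phi> \<in> Hom C w y" "g \<cdot> \<phi> = Zero C w z"
  obtains \<psi> where "\<psi> \<in> Hom C w x" "f \<cdot> \<psi> = \<phi>"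
proof -
  note T = exact_Hom[OF tri]
  obtain o' where o': "is_zero_object C o'"
    using ex_zero_object by blast
  have w: "w \<in> Obj C" "o' \<in> Obj C"
    using \<phi>(1) Hom_Obj zero_objectD(1)[OF o'] by blast+
  have "Zero C o' z \<cdot> Zero C w o' = g \<cdot> \<phi>"
    using zero_comp[of "Zero C w o'" w o' z] zero_in_Hom T(6) w \<phi>(2) by simp
  then obtain \<chi> where \<chi>: "\<chi> \<in> Hom C (\<Sigma>\<^sub>o w) (\<Sigma>\<^sub>o x)"
      "\<Sigma>\<^sub>a \<phi> \<cdot> neg C (\<Sigma>\<^sub>a (\<I> w)) = neg C (\<Sigma>\<^sub>a f) \<cdot> \<chi>"
    using TR3[OF rotate[OF TR1_ident[OF w(1) o']] rotate[OF tri] \<phi>(1) zero_in_Hom[OF w(2) T(6)]]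
    by blast
  obtain \<psi> where \<psi>: "\<psi> \<in> Hom C w x" "\<Sigma>\<^sub>a \<psi> = \<chi>"
    using susp_full[OF \<chi>(1) w(1) T(4)] .
  have f\<psi>: "f \<cdot> \<psi> \<in> Hom C w y"
    using comp_in_Hom[OF \<psi>(1) T(1)] .
  have "neg C (\<Sigma>\<^sub>a \<phi>) = neg C (\<Sigma>\<^sub>a (f \<cdot> \<psi>))"
    using \<chi>(2) neg_comp[OF \<chi>(1) susp.map_Hom[OF T(1)]] susp.map_comp[OF \<psi>(1) T(1)] \<psi>(2)
      comp_neg[OF susp.map_Hom[OF ident_in_Hom[OF w(1)]] susp.map_Hom[OF \<phi>(1)]]
      susp.map_comp[OF ident_in_Hom[OF w(1)] \<phi>(1)] comp_ident[OF \<phi>(1)] by simp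
  then have "\<phi> = f \<cdot> \<psi>"
    using neg_inject[OF susp.map_Hom[OF \<phi>(1)] susp.map_Hom[OF f\<psi>]] susp_inject[OF \<phi>(1) f\<psi>] by simp
  with \<psi>(1) that show thesis
    by blast
qed

text \<open>Since \<open>p\<close> retracts \<open>i\<close>, the equation
  \<open>\<Sigma>\<^sub>a i \<cdot> h = 0\<close> forces \<open>h = 0\<close>. Let \<open>w\<close>
  factor \<open>q\<close> through \<open>g\<close>. Then \<open>g \<cdot> j\<close> and
  \<open>w\<close> are inverse to each other: the difference of
  \<open>(g \<cdot> j) \<cdot> w\<close> and the identity kills \<open>g\<close>, hence factors
  through \<open>h = 0\<close>.\<close>

lemma split_triangle_cone:
  assumes bi: "is_biproduct C x y b i j p q" and tri: "exact_triangle C x b z i g h"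
  shows "isomorphic C y z"
proof -
  have i: "i \<in> Hom C x b" and j: "j \<in> Hom C y b" and p: "p \<in> Hom C b x" and q: "q \<in> Hom C b y"
    and pi: "p \<cdot> i = \<I> x" and qj: "q \<cdot> j = \<I> y" and qi: "q \<cdot> i = Zero C x y"
    and sum: "Plus C (i \<cdot> p) (j \<cdot> q) = \<I> b"
    using bi unfolding is_biproduct_def by auto
  note T = exact_Hom[OF tri]
  have obj: "y \<in> Obj C"
    using Hom_Obj[OF j] by blast
  have "neg C (\<Sigma>\<^sub>a i) \<cdot> h = Zero C z (\<Sigma>\<^sub>o b)"
    using triangle_comp_zero[OF rotate[OF rotate[OF tri]]] .
  then have "neg C (\<Sigma>\<^sub>a i \<cdot> h) = neg C (Zero C z (\<Sigma>\<^sub>o b))"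
    using neg_comp[OF T(3) susp.map_Hom[OF i]] neg_unique zero_in_Hom plus_zero T susp.map_Obj by metis
  then have "\<Sigma>\<^sub>a i \<cdot> h = Zero C z (\<Sigma>\<^sub>o b)"
    using neg_inject comp_in_Hom[OF T(3) susp.map_Hom[OF i]] zero_in_Hom T(5,6) susp.map_Obj by metis
  then have "(\<Sigma>\<^sub>a p \<cdot> \<Sigma>\<^sub>a i) \<cdot> h = Zero C z (\<Sigma>\<^sub>o x)"
    using comp_assoc[OF T(3) susp.map_Hom[OF i] susp.map_Hom[OF p]] comp_zero[OF susp.map_Hom[OF p] T(6)]
    by simp
  then have h0: "h = Zero C z (\<Sigma>\<^sub>o x)"
    using susp.map_comp[OF i p] pi susp.map_ident[OF T(4)] ident_comp[OF T(3)] by simp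
  obtain w where w: "w \<in> Hom C z y" "w \<cdot> g = q"
    using weak_cokernel[OF tri q qi] .
  have gj: "g \<cdot> j \<in> Hom C y z"
    using comp_in_Hom[OF j T(2)] .
  have gjw: "(g \<cdot> j) \<cdot> w \<in> Hom C z z"
    using comp_in_Hom[OF w(1) gj] .
  have "w \<cdot> (g \<cdot> j) = \<I> y"
    using comp_assoc[OF j T(2) w(1)] w(2) qj by simp
  moreover have "(g \<cdot> j) \<cdot> w = \<I> z"
  proof -
    have "g = g \<cdot> Plus C (i \<cdot> p) (j \<cdot> q)"
      using sum comp_ident[OF T(2)] by simp
    also have "... = Plus C (g \<cdot> i \<cdot> p) (g \<cdot> j \<cdot> q)"
      using plus_comp[OF comp_in_Hom[OF p i] comp_in_Hom[OF q j] T(2)] .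
    also have "g \<cdot> i \<cdot> p = Zero C b z"
      using comp_assoc[OF p i T(2)] triangle_comp_zero[OF tri] zero_comp[OF p T(6)] by simp
    also have "Plus C (Zero C b z) (g \<cdot> j \<cdot> q) = g \<cdot> j \<cdot> q"
      using zero_plus[OF comp_in_Hom[OF comp_in_Hom[OF q j] T(2)]] .
    also have "g \<cdot> j \<cdot> q = ((g \<cdot> j) \<cdot> w) \<cdot> g"
      using comp_assoc[OF T(2) w(1) gj] comp_assoc[OF q j T(2)] w(2) by simp
    finally have *: "((g \<cdot> j) \<cdot> w) \<cdot> g = g" ..
    let ?d = "Plus C ((g \<cdot> j) \<cdot> w) (neg C (\<I> z))"
    have d: "?d \<in> Hom C z z"
      using plus_in_Hom[OF gjw neg_in_Hom[OF ident_in_Hom[OF T(6)]]] .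
    have "?d \<cdot> g = Zero C b z"
      using comp_plus[OF T(2) gjw neg_in_Hom[OF ident_in_Hom[OF T(6)]]] * plus_neg[OF T(2)]
        neg_comp[OF T(2) ident_in_Hom[OF T(6)]] ident_comp[OF T(2)] by simp
    then obtain \<psi> where "\<psi> \<in> Hom C (\<Sigma>\<^sub>o x) z" "\<psi> \<cdot> h = ?d"
      using weak_cokernel[OF rotate[OF tri] d] by blast
    then have "?d = Zero C z z"
      using h0 comp_zero[OF _ T(6)] by metis
    then show ?thesis
      using eq_if_diff_zero[OF gjw ident_in_Hom[OF T(6)]] by blast
  qed
  ultimately show ?thesis
    using isomorphicI[OF gj w(1)] by blast
qed

section \<open>Closure properties of triangulated subcategories\<close>

context
  fixes S
  assumes S: "triangulated_subcategory C S"
begin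

lemma sub_Obj: "x \<in> S \<Longrightarrow> x \<in> Obj C"
  and sub_iso: "\<lbrakk>x \<in> S; isomorphic C x y\<rbrakk> \<Longrightarrow> y \<in> S"
  and sub_susp: "x \<in> Obj C \<Longrightarrow> \<Sigma>\<^sub>o x \<in> S \<longleftrightarrow> x \<in> S"
  and sub_cone: "\<lbrakk>exact_triangle C x y z f g h; x \<in> S; y \<in> S\<rbrakk> \<Longrightarrow> z \<in> S"
  using S unfolding triangulated_subcategory_def by blast+

lemma sub_middle: "\<lbrakk>exact_triangle C x y z f g h; x \<in> S; z \<in> S\<rbrakk> \<Longrightarrow> y \<in> S"
  using sub_cone rotate sub_susp exact_Hom by metis

lemma sub_fibre: "\<lbrakk>exact_triangle C x y z f g h; y \<in> S; z \<in> S\<rbrakk> \<Longrightarrow> x \<in> S"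
  using sub_cone rotate sub_susp exact_Hom by metis

lemma sub_zero: "is_zero_object C z \<Longrightarrow> z \<in> S"
proof -
  assume z: "is_zero_object C z"
  obtain x where x: "x \<in> S"
    using S unfolding triangulated_subcategory_def by blast
  show "z \<in> S"
    using sub_cone[OF TR1_ident[OF sub_Obj[OF x] z] x x] .
qed

text \<open>Complete the inclusion \<open>i\<close> to a triangle: by
  \<open>split_triangle_cone\<close> its cone is isomorphic to \<open>y\<close>.\<close>

lemma sub_biproduct: "\<lbrakk>is_biproduct C x y b i j p q; x \<in> S; y \<in> S\<rbrakk> \<Longrightarrow> b \<in> S"
  using TR1_cone[of i x b] split_triangle_cone sub_middle sub_iso unfolding is_biproduct_def by metis

text \<open>The same triangle read from the other end. In this form a decomposition of
  \<open>B\<close> as the sum of \<open>x\<close> and \<open>B\<close> puts \<open>x\<close> into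
  \<open>S\<close>.\<close>

lemma sub_biproduct_fibre: "\<lbrakk>is_biproduct C x y b i j p q; b \<in> S; y \<in> S\<rbrakk> \<Longrightarrow> x \<in> S"
  using TR1_cone[of i x b] split_triangle_cone sub_fibre sub_iso unfolding is_biproduct_def by metis

end

end


section \<open>Coproducts and compactness\<close>

text \<open>An infinite \<open>A\<close> is harmless, since both products then default to the
  neutral element and homomorphisms preserve it.\<close>

lemma hom_finprod:
  assumes "comm_group G" "comm_group H" "f \<in> hom G H" "a \<in> A \<rightarrow> carrier G"
  shows "f (finprod G a A) = finprod H (\<lambda>i. f (a i)) A"
proof -
  interpret G: comm_group G by fact
  interpret H: comm_group H by fact
  have one: "f \<one>\<^bsub>G\<^esub> = \<one>\<^bsub>H\<^esub>"
    using hom_one[OF assms(3) G.is_group H.is_group] .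
  show ?thesis
    using assms(4)
  proof (induction A rule: infinite_finite_induct)
    case (insert k A)
    then have a: "a \<in> A \<rightarrow> carrier G" "a k \<in> carrier G"
      by auto
    have fa: "(\<lambda>i. f (a i)) \<in> A \<rightarrow> carrier H" "f (a k) \<in> carrier H"
      using a hom_in_carrier[OF assms(3)] by auto
    show ?case
      using G.finprod_insert[OF insert.hyps a] H.finprod_insert[OF insert.hyps fa] insert.IH[OF a(1)]
        hom_mult[OF assms(3) a(2) G.finprod_closed[OF a(1)]] by simp
  qed (simp_all add: one)
qed

context category
begin

lemma coproductD:
  assumes "is_coproduct C I t c \<iota>"
  shows "c \<in> Obj C" "i \<in> I \<Longrightarrow> \<iota> i \<in> Hom C (t i) c"
  using assms unfolding is_coproduct_def by blast+

lemma coproduct_map: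
  assumes "is_coproduct C I t c \<iota>" "y \<in> Obj C" "\<And>i. i \<in> I \<Longrightarrow> f i \<in> Hom C (t i) y"
  obtains g where "g \<in> Hom C c y" "\<And>i. i \<in> I \<Longrightarrow> g \<cdot> \<iota> i = f i"
proof -
  have "\<exists>!g. g \<in> Hom C c y \<and> (\<forall>i \<in> I. g \<cdot> \<iota> i = f i)"
    using assms unfolding is_coproduct_def by simp
  then show thesis
    using that by blast
qed

lemma coproduct_eqI:
  assumes "is_coproduct C I t c \<iota>" "g \<in> Hom C c y" "h \<in> Hom C c y"
    and "\<And>i. i \<in> I \<Longrightarrow> g \<cdot> \<iota> i = h \<cdot> \<iota> i"
  shows "g = h"
proof -
  have "y \<in> Obj C" "\<And>i. i \<in> I \<Longrightarrow> h \<cdot> \<iota> i \<in> Hom C (t i) y"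
    using Hom_Obj[OF assms(2)] comp_in_Hom[OF coproductD(2)[OF assms(1)] assms(3)] by auto
  then have "\<exists>!g. g \<in> Hom C c y \<and> (\<forall>i \<in> I. g \<cdot> \<iota> i = h \<cdot> \<iota> i)"
    using assms(1) unfolding is_coproduct_def by simp
  then show ?thesis
    by (rule ex1E) (metis assms(2-4))
qed

lemma coproductI:
  assumes "c \<in> Obj C" "\<And>i. i \<in> I \<Longrightarrow> \<iota> i \<in> Hom C (t i) c"
    and ex: "\<And>y f. \<lbrakk>y \<in> Obj C; \<And>i. i \<in> I \<Longrightarrow> f i \<in> Hom C (t i) y\<rbrakk>
        \<Longrightarrow> \<exists>g \<in> Hom C c y. \<forall>i \<in> I. g \<cdot> \<iota> i = f i"
    and un: "\<And>y g h. \<lbrakk>g \<in> Hom C c y; h \<in> Hom C c y; \<And>i. i \<in> I \<Longrightarrow> g \<cdot> \<iota> i = h \<cdot> \<iota> i\<rbrakk> \<Longrightarrow> g = h"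
  shows "is_coproduct C I t c \<iota>"
  unfolding is_coproduct_def
proof (intro conjI ballI allI impI)
  fix y f assume y: "y \<in> Obj C" and f: "\<forall>i \<in> I. f i \<in> Hom C (t i) y"
  obtain g where g: "g \<in> Hom C c y" "\<forall>i \<in> I. g \<cdot> \<iota> i = f i"
    using ex[of y f] y f by blast
  show "\<exists>!g. g \<in> Hom C c y \<and> (\<forall>i \<in> I. g \<cdot> \<iota> i = f i)"
  proof (rule ex1I[of _ g])
    fix h assume "h \<in> Hom C c y \<and> (\<forall>i \<in> I. h \<cdot> \<iota> i = f i)"
    then show "h = g"
      using un[of h y g] g by simp
  qed (use g in simp)
qed (use assms in simp_all)

text \<open>Smallness refers to index sets inside the type of \<open>\<kappa>\<close>; this turns a
  coproduct over an embedded copy of the natural numbers into one indexed by the numbers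
  themselves.\<close>

lemma coproduct_reindex:
  assumes "is_coproduct C (k ` A) t c \<iota>" "inj_on k A"
  shows "is_coproduct C A (\<lambda>a. t (k a)) c (\<lambda>a. \<iota> (k a))"
proof (rule coproductI)
  show "\<iota> (k a) \<in> Hom C (t (k a)) c" if "a \<in> A" for a
    using coproductD[OF assms(1)] that by auto
  show "c \<in> Obj C"
    using coproductD[OF assms(1)] by simp
  show "\<exists>g \<in> Hom C c y. \<forall>a \<in> A. g \<cdot> \<iota> (k a) = f a"
    if y: "y \<in> Obj C" and f: "\<And>a. a \<in> A \<Longrightarrow> f a \<in> Hom C (t (k a)) y" for y f
  proof -
    have "f (inv_into A k i) \<in> Hom C (t i) y" if "i \<in> k ` A" for i
      using f[of "inv_into A k i"] inv_into_into[OF that] f_inv_into_f[OF that] by simp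
    then obtain g where "g \<in> Hom C c y" "\<And>i. i \<in> k ` A \<Longrightarrow> g \<cdot> \<iota> i = f (inv_into A k i)"
      using coproduct_map[OF assms(1) y, of "\<lambda>i. f (inv_into A k i)"] by blast
    then show ?thesis
      using inv_into_f_f[OF assms(2)] by (intro bexI[of _ g]) auto
  qed
  show "g = h" if "g \<in> Hom C c y" "h \<in> Hom C c y" "\<And>a. a \<in> A \<Longrightarrow> g \<cdot> \<iota> (k a) = h \<cdot> \<iota> (k a)" for y g h
    using coproduct_eqI[OF assms(1) that(1,2)] that(3) by blast
qed

end


section \<open>Truncations of coproducts and the compactness criterion\<close>

context additive_category
begin

text \<open>The projection of the coproduct onto the part indexed by \<open>F\<close>, as an
  endomorphism of \<open>c\<close>. It is pinned down by its composites with the injections alone,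
  so additive functors that preserve the coproduct send it to the corresponding truncation.\<close>

definition truncation ::
    "'i set \<Rightarrow> ('i \<Rightarrow> 'o) \<Rightarrow> 'o \<Rightarrow> ('i \<Rightarrow> 'a) \<Rightarrow> 'i set \<Rightarrow> 'a" where
  "truncation I t c \<iota> F =
     (THE e. e \<in> Hom C c c \<and> (\<forall>i \<in> I. e \<cdot> \<iota> i = (if i \<in> F then \<iota> i else Zero C (t i) c)))"

context
  fixes I :: "'i set" and t c \<iota>
  assumes cop: "is_coproduct C I t c \<iota>"
begin

lemma cop_Obj: "c \<in> Obj C" "i \<in> I \<Longrightarrow> t i \<in> Obj C"
  using coproductD[OF cop] Hom_Obj by blast+

lemma truncation_unique:
  assumes "e \<in> Hom C c c" "\<And>i. i \<in> I \<Longrightarrow> e \<cdot> \<iota> i = (if i \<in> F then \<iota> i else Zero C (t i) c)"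
  shows "truncation I t c \<iota> F = e"
  unfolding truncation_def
proof (rule the_equality)
  show "e \<in> Hom C c c \<and> (\<forall>i \<in> I. e \<cdot> \<iota> i = (if i \<in> F then \<iota> i else Zero C (t i) c))"
    using assms by simp
  fix h assume "h \<in> Hom C c c \<and> (\<forall>i \<in> I. h \<cdot> \<iota> i = (if i \<in> F then \<iota> i else Zero C (t i) c))"
  then show "h = e"
    using coproduct_eqI[OF cop, of h c e] assms by simp
qed

lemma truncation:
  shows truncation_in_Hom: "truncation I t c \<iota> F \<in> Hom C c c"
    and truncation_comp:
      "i \<in> I \<Longrightarrow> truncation I t c \<iota> F \<cdot> \<iota> i = (if i \<in> F then \<iota> i else Zero C (t i) c)"
proof -
  have "(if i \<in> F then \<iota> i else Zero C (t i) c) \<in> Hom C (t i) c" if "i \<in> I" for i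
    using coproductD(2)[OF cop that] zero_in_Hom[OF cop_Obj(2)[OF that] cop_Obj(1)] by simp
  then obtain e where e: "e \<in> Hom C c c"
    "\<And>i. i \<in> I \<Longrightarrow> e \<cdot> \<iota> i = (if i \<in> F then \<iota> i else Zero C (t i) c)"
    using coproduct_map[OF cop cop_Obj(1), of "\<lambda>i. if i \<in> F then \<iota> i else Zero C (t i) c"] by blast
  then have "truncation I t c \<iota> F = e"
    using truncation_unique by blast
  with e show "truncation I t c \<iota> F \<in> Hom C c c"
    "i \<in> I \<Longrightarrow> truncation I t c \<iota> F \<cdot> \<iota> i = (if i \<in> F then \<iota> i else Zero C (t i) c)"
    by simp_all
qed

text \<open>A map fixed by one truncation is fixed by every larger one; this allows two finite sets
  to be merged into their union.\<close>

lemma truncation_absorb: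
  assumes "F \<subseteq> G"
  shows "truncation I t c \<iota> G \<cdot> truncation I t c \<iota> F = truncation I t c \<iota> F"
proof (rule truncation_unique[symmetric])
  note e = truncation_in_Hom
  show "truncation I t c \<iota> G \<cdot> truncation I t c \<iota> F \<in> Hom C c c"
    using comp_in_Hom[OF e e] .
  fix i assume i: "i \<in> I"
  have "(truncation I t c \<iota> G \<cdot> truncation I t c \<iota> F) \<cdot> \<iota> i =
      truncation I t c \<iota> G \<cdot> truncation I t c \<iota> F \<cdot> \<iota> i"
    using comp_assoc[OF coproductD(2)[OF cop i] e e] .
  also have "... = (if i \<in> F then \<iota> i else Zero C (t i) c)"
    using truncation_comp[OF i] comp_zero[OF e cop_Obj(2)[OF i]] assms by auto
  finally show "(truncation I t c \<iota> G \<cdot> truncation I t c \<iota> F) \<cdot> \<iota> i =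
      (if i \<in> F then \<iota> i else Zero C (t i) c)" .
qed

lemma coproduct_projection:
  assumes "j \<in> I"
  obtains \<pi> where "\<pi> \<in> Hom C c (t j)"
    "\<And>i. i \<in> I \<Longrightarrow> \<pi> \<cdot> \<iota> i = (if i = j then \<I> (t j) else Zero C (t i) (t j))"
proof -
  have "(if i = j then \<I> (t j) else Zero C (t i) (t j)) \<in> Hom C (t i) (t j)" if "i \<in> I" for i
    using ident_in_Hom[OF cop_Obj(2)[OF that]] zero_in_Hom[OF cop_Obj(2)[OF that] cop_Obj(2)[OF assms]]
    by auto
  then show thesis
    using coproduct_map[OF cop cop_Obj(2)[OF assms], of "\<lambda>i. if i = j then \<I> (t j) else Zero C (t i) (t j)"]
      that by blast
qed

end

lemma hom_group_simps [simp]: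
  "carrier (hom_group C x y) = Hom C x y" "\<one>\<^bsub>hom_group C x y\<^esub> = Zero C x y"
  "f \<otimes>\<^bsub>hom_group C x y\<^esub> g = Plus C f g"
  by (simp_all add: hom_group_def)

lemma comp_finprod:
  assumes "\<And>i. i \<in> A \<Longrightarrow> a i \<in> Hom C x y" "g \<in> Hom C y z" "x \<in> Obj C"
  shows "g \<cdot> finprod (hom_group C x y) a A = finprod (hom_group C x z) (\<lambda>i. g \<cdot> a i) A"
proof (rule hom_finprod)
  show "(\<lambda>k. g \<cdot> k) \<in> hom (hom_group C x y) (hom_group C x z)"
    using comp_in_Hom[OF _ assms(2)] plus_comp[OF _ _ assms(2)] by (intro homI) simp_all
qed (use assms hom_comm_group Hom_Obj[OF assms(2)] in auto)

lemma finprod_comp: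
  assumes "\<And>i. i \<in> A \<Longrightarrow> a i \<in> Hom C y z" "f \<in> Hom C x y" "z \<in> Obj C"
  shows "finprod (hom_group C y z) a A \<cdot> f = finprod (hom_group C x z) (\<lambda>i. a i \<cdot> f) A"
proof (rule hom_finprod)
  show "(\<lambda>k. k \<cdot> f) \<in> hom (hom_group C y z) (hom_group C x z)"
    using comp_in_Hom[OF assms(2)] comp_plus[OF assms(2)] by (intro homI) simp_all
qed (use assms hom_comm_group Hom_Obj[OF assms(2)] in auto)

text \<open>The canonical map in the definition of compactness is always an injective homomorphism, so
  that only its surjectivity is a condition.\<close>

lemma canonical_map_iso_iff:
  assumes cop: "is_coproduct C I t c \<iota>" and x: "x \<in> Obj C"
  shows "(\<lambda>h. finprod (hom_group C x c) (\<lambda>i. \<iota> i \<cdot> h i) {i \<in> I. h i \<noteq> Zero C x (t i)})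
           \<in> Group.iso (sum_group I (\<lambda>i. hom_group C x (t i))) (hom_group C x c) \<longleftrightarrow>
         (\<forall>\<phi> \<in> Hom C x c. \<exists>F \<subseteq> I. finite F \<and> truncation I t c \<iota> F \<cdot> \<phi> = \<phi>)"
    (is "?\<Phi> \<in> Group.iso ?S ?H \<longleftrightarrow> ?R")
proof -
  note c = cop_Obj(1)[OF cop] and t = cop_Obj(2)[OF cop] and \<iota> = coproductD(2)[OF cop]
  interpret H: comm_group ?H
    using hom_comm_group x c by blast
  have gr: "group (hom_group C x (t i))" if "i \<in> I" for i
    using hom_comm_group[OF x t[OF that]] by (rule comm_group.axioms(2))
  have carS: "carrier ?S = {h \<in> \<Pi>\<^sub>E i\<in>I. Hom C x (t i). finite {i \<in> I. h i \<noteq> Zero C x (t i)}}"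
    using carrier_sum_group[of I "\<lambda>i. hom_group C x (t i)", OF gr] by simp
  have carH: "carrier ?H = Hom C x c"
    by simp
  have tm: "\<iota> i \<cdot> h i \<in> Hom C x c" if "h \<in> carrier ?S" "i \<in> I" for h i
    using that \<iota> comp_in_Hom unfolding carS by (auto simp: PiE_iff)
  \<comment> \<open>The sum may run over any finite set between the support of \<open>h\<close> and
    \<open>I\<close>, as the extra terms vanish. Two families can thus be added over a common index
    set.\<close>
  have \<Phi>_mono: "?\<Phi> h = finprod ?H (\<lambda>i. \<iota> i \<cdot> h i) G"
    if h: "h \<in> carrier ?S" and G: "finite G" "{i \<in> I. h i \<noteq> Zero C x (t i)} \<subseteq> G" "G \<subseteq> I" for h G
  proof (rule H.finprod_mono_neutral_cong_left)
    show "(\<lambda>i. \<iota> i \<cdot> h i) \<in> G \<rightarrow> carrier ?H"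
      using tm[OF h] G(3) by (auto simp: carH)
    fix i assume "i \<in> G - {i \<in> I. h i \<noteq> Zero C x (t i)}"
    then show "\<iota> i \<cdot> h i = \<one>\<^bsub>?H\<^esub>"
      using G(3) comp_zero[OF \<iota> x] by auto
  qed (use G in auto)
  have fin: "finite {i \<in> I. h i \<noteq> Zero C x (t i)}" if "h \<in> carrier ?S" for h
    using that unfolding carS by simp
  have \<Phi>_closed: "?\<Phi> h \<in> carrier ?H" if "h \<in> carrier ?S" for h
    using tm[OF that] by (intro H.finprod_closed) (auto simp: carH)
  have hom: "?\<Phi> \<in> hom ?S ?H"
  proof (rule homI)
    fix g h assume g: "g \<in> carrier ?S" and h: "h \<in> carrier ?S"
    have "group ?S"
      using sum_group[of I "\<lambda>i. hom_group C x (t i)", OF gr] .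
    then have gh: "g \<otimes>\<^bsub>?S\<^esub> h \<in> carrier ?S"
      using monoid.m_closed[OF group.is_monoid g h] by simp
    have gh_eq: "(g \<otimes>\<^bsub>?S\<^esub> h) i = Plus C (g i) (h i)" if "i \<in> I" for i
      using that by simp
    let ?G = "{i \<in> I. g i \<noteq> Zero C x (t i)} \<union> {i \<in> I. h i \<noteq> Zero C x (t i)}"
    have G: "finite ?G" "?G \<subseteq> I"
      using fin g h by auto
    have "{i \<in> I. (g \<otimes>\<^bsub>?S\<^esub> h) i \<noteq> Zero C x (t i)} \<subseteq> ?G"
      using plus_zero[OF zero_in_Hom[OF x t]] gh_eq by auto
    then have "?\<Phi> (g \<otimes>\<^bsub>?S\<^esub> h) = finprod ?H (\<lambda>i. \<iota> i \<cdot> (g \<otimes>\<^bsub>?S\<^esub> h) i) ?G"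
      using \<Phi>_mono[OF gh G(1) _ G(2)] by blast
    also have "... = finprod ?H (\<lambda>i. (\<iota> i \<cdot> g i) \<otimes>\<^bsub>?H\<^esub> (\<iota> i \<cdot> h i)) ?G"
    proof (rule H.finprod_cong')
      show "(\<lambda>i. (\<iota> i \<cdot> g i) \<otimes>\<^bsub>?H\<^esub> (\<iota> i \<cdot> h i)) \<in> ?G \<rightarrow> carrier ?H"
        using H.m_closed[OF tm[OF g, folded carH] tm[OF h, folded carH]] G(2) by blast
      fix i assume "i \<in> ?G"
      then have i: "i \<in> I"
        by blast
      then have "g i \<in> Hom C x (t i)" "h i \<in> Hom C x (t i)"
        using g h unfolding carS by auto
      then show "\<iota> i \<cdot> (g \<otimes>\<^bsub>?S\<^esub> h) i = (\<iota> i \<cdot> g i) \<otimes>\<^bsub>?H\<^esub> (\<iota> i \<cdot> h i)"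
        using plus_comp[OF _ _ \<iota>[OF i]] gh_eq[OF i] by simp
    qed simp
    also have "... = finprod ?H (\<lambda>i. \<iota> i \<cdot> g i) ?G \<otimes>\<^bsub>?H\<^esub> finprod ?H (\<lambda>i. \<iota> i \<cdot> h i) ?G"
      using tm[OF g] tm[OF h] G(2) by (intro H.finprod_multf) (auto simp: carH)
    also have "... = ?\<Phi> g \<otimes>\<^bsub>?H\<^esub> ?\<Phi> h"
      using \<Phi>_mono[OF g G(1) _ G(2)] \<Phi>_mono[OF h G(1) _ G(2)] by simp
    finally show "?\<Phi> (g \<otimes>\<^bsub>?S\<^esub> h) = ?\<Phi> g \<otimes>\<^bsub>?H\<^esub> ?\<Phi> h" .
  qed (rule \<Phi>_closed)
  \<comment> \<open>Projecting the sum onto the summand \<open>j\<close> returns the component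
    \<open>h j\<close>; injectivity follows.\<close>
  have proj: "\<pi> \<cdot> ?\<Phi> h = h j"
    if h: "h \<in> carrier ?S" and j: "j \<in> I" and \<pi>: "\<pi> \<in> Hom C c (t j)"
      "\<And>i. i \<in> I \<Longrightarrow> \<pi> \<cdot> \<iota> i = (if i = j then \<I> (t j) else Zero C (t i) (t j))" for h j \<pi>
  proof -
    interpret K: comm_group "hom_group C x (t j)"
      using hom_comm_group x t[OF j] by blast
    let ?G = "insert j {i \<in> I. h i \<noteq> Zero C x (t i)}"
    have G: "finite ?G" "?G \<subseteq> I"
      using fin[OF h] j by auto
    have hi: "h i \<in> Hom C x (t i)" if "i \<in> I" for i
      using h that unfolding carS by auto
    have "\<pi> \<cdot> ?\<Phi> h = \<pi> \<cdot> finprod ?H (\<lambda>i. \<iota> i \<cdot> h i) ?G"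
      using \<Phi>_mono[OF h G(1) subset_insertI G(2)] by (rule arg_cong)
    also have "... = finprod (hom_group C x (t j)) (\<lambda>i. \<pi> \<cdot> \<iota> i \<cdot> h i) ?G"
      using comp_finprod[OF _ \<pi>(1) x, of _ "\<lambda>i. \<iota> i \<cdot> h i"] tm[OF h] G(2) by blast
    also have "... = finprod (hom_group C x (t j)) (\<lambda>i. if j = i then h j else \<one>\<^bsub>hom_group C x (t j)\<^esub>) ?G"
    proof (rule K.finprod_cong')
      show "(\<lambda>i. if j = i then h j else \<one>\<^bsub>hom_group C x (t j)\<^esub>) \<in> ?G \<rightarrow> carrier (hom_group C x (t j))"
        using hi[OF j] zero_in_Hom[OF x t[OF j]] by auto
      fix i assume "i \<in> ?G"
      then have i: "i \<in> I"
        using G(2) by blast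
      have "\<pi> \<cdot> \<iota> i \<cdot> h i = (\<pi> \<cdot> \<iota> i) \<cdot> h i"
        using comp_assoc[OF hi[OF i] \<iota>[OF i] \<pi>(1)] by simp
      then show "\<pi> \<cdot> \<iota> i \<cdot> h i = (if j = i then h j else \<one>\<^bsub>hom_group C x (t j)\<^esub>)"
        using \<pi>(2)[OF i] ident_comp[OF hi[OF j]] zero_comp[OF hi[OF i] t[OF j]] by auto
    qed simp
    also have "... = h j"
      using K.finprod_singleton[OF insertI1 G(1), of "\<lambda>_. h j"] hi[OF j] by simp
    finally show ?thesis .
  qed
  have inj: "inj_on ?\<Phi> (carrier ?S)"
  proof (rule inj_onI)
    fix g h assume g: "g \<in> carrier ?S" and h: "h \<in> carrier ?S" and eq: "?\<Phi> g = ?\<Phi> h"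
    have "g j = h j" if j: "j \<in> I" for j
    proof -
      obtain \<pi> where \<pi>: "\<pi> \<in> Hom C c (t j)"
        "\<And>i. i \<in> I \<Longrightarrow> \<pi> \<cdot> \<iota> i = (if i = j then \<I> (t j) else Zero C (t i) (t j))"
        using coproduct_projection[OF cop j] by metis
      show ?thesis
        using proj[OF g j \<pi>] proj[OF h j \<pi>] eq by metis
    qed
    then show "g = h"
      using g h unfolding carS by (auto intro: PiE_ext)
  qed
  let ?e = "truncation I t c \<iota>"
  \<comment> \<open>One direction of the criterion: a sum of maps through the summands in a finite
    set is fixed by the truncation to that set.\<close>
  have fixed: "?e {i \<in> I. h i \<noteq> Zero C x (t i)} \<cdot> ?\<Phi> h = ?\<Phi> h" if h: "h \<in> carrier ?S" for h
  proof -
    let ?F = "{i \<in> I. h i \<noteq> Zero C x (t i)}"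
    have hi: "h i \<in> Hom C x (t i)" if "i \<in> I" for i
      using h that unfolding carS by auto
    have "?e ?F \<cdot> ?\<Phi> h = finprod ?H (\<lambda>i. ?e ?F \<cdot> \<iota> i \<cdot> h i) ?F"
      using comp_finprod[OF _ truncation_in_Hom[OF cop] x, of ?F "\<lambda>i. \<iota> i \<cdot> h i"]
        tm[OF h] by blast
    also have "... = ?\<Phi> h"
    proof (rule H.finprod_cong')
      show "(\<lambda>i. \<iota> i \<cdot> h i) \<in> ?F \<rightarrow> carrier ?H"
        using tm[OF h] by (auto simp: carH)
      fix i assume i: "i \<in> ?F"
      have "?e ?F \<cdot> \<iota> i \<cdot> h i = (?e ?F \<cdot> \<iota> i) \<cdot> h i"
        using comp_assoc[OF hi[of i] \<iota>[of i] truncation_in_Hom[OF cop]] i by simp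
      then show "?e ?F \<cdot> \<iota> i \<cdot> h i = \<iota> i \<cdot> h i"
        using truncation_comp[OF cop, of i ?F] i by simp
    qed simp
    finally show ?thesis .
  qed
  \<comment> \<open>The other direction: for finite \<open>F\<close> the truncation is the sum of
    the idempotents \<open>\<iota> i \<cdot> \<pi> i\<close>, so a map it fixes is the sum of its
    coordinates over \<open>F\<close>.\<close>
  have surj: "\<exists>h \<in> carrier ?S. ?\<Phi> h = \<phi>"
    if \<phi>: "\<phi> \<in> Hom C x c" and F: "F \<subseteq> I" "finite F" "?e F \<cdot> \<phi> = \<phi>" for \<phi> F
  proof -
    have "\<forall>j. \<exists>\<pi>. j \<in> I \<longrightarrow> \<pi> \<in> Hom C c (t j) \<and>
        (\<forall>i \<in> I. \<pi> \<cdot> \<iota> i = (if i = j then \<I> (t j) else Zero C (t i) (t j)))"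
      using coproduct_projection[OF cop] by metis
    then obtain \<pi> where \<pi>: "\<And>j. j \<in> I \<Longrightarrow> \<pi> j \<in> Hom C c (t j)"
        "\<And>i j. \<lbrakk>i \<in> I; j \<in> I\<rbrakk> \<Longrightarrow> \<pi> j \<cdot> \<iota> i = (if i = j then \<I> (t j) else Zero C (t i) (t j))"
      by metis
    \<comment> \<open>Elements of the direct sum are extensional functions, hence the restriction to
      \<open>I\<close>.\<close>
    define h where "h = (\<lambda>i\<in>I. if i \<in> F then \<pi> i \<cdot> \<phi> else Zero C x (t i))"
    have supp_h: "{i \<in> I. h i \<noteq> Zero C x (t i)} \<subseteq> F"
      unfolding h_def by auto
    have h: "h \<in> carrier ?S"
      unfolding carS using finite_subset[OF supp_h F(2)] comp_in_Hom[OF \<phi> \<pi>(1)] zero_in_Hom[OF x t]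
      by (auto simp: h_def)
    interpret E: comm_group "hom_group C c c"
      using hom_comm_group c by blast
    have \<iota>\<pi>: "\<iota> i \<cdot> \<pi> i \<in> Hom C c c" if "i \<in> F" for i
      using comp_in_Hom \<pi>(1) \<iota> F(1) that by blast
    have "?e F = finprod (hom_group C c c) (\<lambda>i. \<iota> i \<cdot> \<pi> i) F"
    proof (rule truncation_unique[OF cop])
      show "finprod (hom_group C c c) (\<lambda>i. \<iota> i \<cdot> \<pi> i) F \<in> Hom C c c"
        using E.finprod_closed[of "\<lambda>i. \<iota> i \<cdot> \<pi> i" F] \<iota>\<pi> by simp
      fix j assume j: "j \<in> I"
      let ?K = "hom_group C (t j) c"
      let ?d = "\<lambda>i. if j = i then \<iota> i else \<one>\<^bsub>?K\<^esub>"
      interpret K: comm_group ?K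
        using hom_comm_group c t[OF j] by blast
      have "finprod (hom_group C c c) (\<lambda>i. \<iota> i \<cdot> \<pi> i) F \<cdot> \<iota> j =
          finprod (?K) (\<lambda>i. (\<iota> i \<cdot> \<pi> i) \<cdot> \<iota> j) F"
        using finprod_comp[OF _ \<iota>[OF j] c, of _ "\<lambda>i. \<iota> i \<cdot> \<pi> i"] \<iota>\<pi> by blast
      also have "... = finprod (?K)
          ?d F"
      proof (rule K.finprod_cong')
        show "?d \<in> F \<rightarrow> carrier (?K)"
          using \<iota>[OF j] zero_in_Hom[OF t[OF j] c] by auto
        fix i assume "i \<in> F"
        then have i: "i \<in> I"
          using F(1) by blast
        have "(\<iota> i \<cdot> \<pi> i) \<cdot> \<iota> j = \<iota> i \<cdot> \<pi> i \<cdot> \<iota> j"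
          using comp_assoc[OF \<iota>[OF j] \<pi>(1)[OF i] \<iota>[OF i]] .
        then show "(\<iota> i \<cdot> \<pi> i) \<cdot> \<iota> j = (if j = i then \<iota> i else \<one>\<^bsub>?K\<^esub>)"
          using \<pi>(2)[OF j i] comp_ident[OF \<iota>[OF i]] comp_zero[OF \<iota>[OF i] t[OF j]]
          by auto
      qed simp
      also have "... = (if j \<in> F then \<iota> j else Zero C (t j) c)"
      proof (cases "j \<in> F")
        case True
        have "(\<lambda>_. \<iota> j) \<in> F \<rightarrow> carrier (?K)"
          using \<iota>[OF j] by simp
        then have "finprod (?K)
            (\<lambda>i. if j = i then \<iota> j else \<one>\<^bsub>?K\<^esub>) F = \<iota> j"
          using K.finprod_singleton[OF True F(2)] by blast
        moreover have "?d =
            (\<lambda>i. if j = i then \<iota> j else \<one>\<^bsub>?K\<^esub>)"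
          by auto
        ultimately show ?thesis
          using True by simp
      next
        case False
        then have "(if j = i then \<iota> i else \<one>\<^bsub>?K\<^esub>) = \<one>\<^bsub>?K\<^esub>"
          if "i \<in> F" for i
          using that by auto
        then have "finprod (?K)
            ?d F = \<one>\<^bsub>?K\<^esub>"
          by (rule K.finprod_one_eqI)
        then show ?thesis
          using False by simp
      qed
      finally show "finprod (hom_group C c c) (\<lambda>i. \<iota> i \<cdot> \<pi> i) F \<cdot> \<iota> j =
          (if j \<in> F then \<iota> j else Zero C (t j) c)" .
    qed
    then have "\<phi> = finprod (hom_group C c c) (\<lambda>i. \<iota> i \<cdot> \<pi> i) F \<cdot> \<phi>"
      using F(3) by simp
    also have "... = finprod ?H (\<lambda>i. (\<iota> i \<cdot> \<pi> i) \<cdot> \<phi>) F"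
      using finprod_comp[OF _ \<phi> c, of _ "\<lambda>i. \<iota> i \<cdot> \<pi> i"] \<iota>\<pi> by blast
    also have "... = finprod ?H (\<lambda>i. \<iota> i \<cdot> h i) F"
    proof (rule H.finprod_cong')
      show "(\<lambda>i. \<iota> i \<cdot> h i) \<in> F \<rightarrow> carrier ?H"
        using tm[OF h] F(1) by (auto simp: carH)
      fix i assume "i \<in> F"
      then show "(\<iota> i \<cdot> \<pi> i) \<cdot> \<phi> = \<iota> i \<cdot> h i"
        using comp_assoc[OF \<phi> \<pi>(1)[of i] \<iota>[of i]] F(1) by (auto simp: h_def)
    qed simp
    also have "... = ?\<Phi> h"
      using \<Phi>_mono[OF h F(2) supp_h F(1)] by simp
    finally have "?\<Phi> h = \<phi>"
      by (rule sym)
    with h show ?thesis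
      by (intro bexI[of _ h])
  qed
  have "?\<Phi> \<in> Group.iso ?S ?H \<longleftrightarrow> ?\<Phi> ` carrier ?S = Hom C x c"
    using hom inj by (auto simp: Group.iso_def bij_betw_def carH)
  also have "... \<longleftrightarrow> ?R"
  proof
    assume im: "?\<Phi> ` carrier ?S = Hom C x c"
    show ?R
    proof
      fix \<phi> assume "\<phi> \<in> Hom C x c"
      then obtain h where "h \<in> carrier ?S" "\<phi> = ?\<Phi> h"
        using im by blast
      then show "\<exists>F \<subseteq> I. finite F \<and> ?e F \<cdot> \<phi> = \<phi>"
        using fixed fin by (intro exI[of _ "{i \<in> I. h i \<noteq> Zero C x (t i)}"]) auto
    qed
  next
    assume R: ?R
    have "?\<Phi> ` carrier ?S \<subseteq> Hom C x c"
      using \<Phi>_closed carH by blast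
    moreover have "Hom C x c \<subseteq> ?\<Phi> ` carrier ?S"
    proof
      fix \<phi> assume \<phi>: "\<phi> \<in> Hom C x c"
      then obtain F where "F \<subseteq> I" "finite F" "?e F \<cdot> \<phi> = \<phi>"
        using R by blast
      then show "\<phi> \<in> ?\<Phi> ` carrier ?S"
        using surj[OF \<phi>] by blast
    qed
    ultimately show "?\<Phi> ` carrier ?S = Hom C x c"
      by blast
  qed
  finally show ?thesis .
qed

end


section \<open>Localizing subcategories and compact objects\<close>

context additive_category
begin

text \<open>The \<^emph>\<open>swindle\<close>: the shift of a countable coproduct of copies of \<open>b\<close> that moves only
  the summand \<open>x\<close> of \<open>b\<close> exhibits \<open>x \<oplus> B \<cong> B\<close>.\<close>

lemma swindle:
  assumes cop: "is_coproduct C (UNIV :: nat set) (\<lambda>_. b) B \<iota>"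
    and i: "i \<in> Hom C x b" and p: "p \<in> Hom C b x" and pi: "p \<cdot> i = \<I> x"
  obtains i' j' p' q' where "is_biproduct C x B B i' j' p' q'"
proof -
  note B = cop_Obj(1)[OF cop] and \<iota> = coproductD(2)[OF cop, OF UNIV_I]
  have b: "b \<in> Obj C" and x: "x \<in> Obj C"
    using Hom_Obj[OF i] by auto
  \<comment> \<open>\<open>e\<close> is the idempotent of \<open>b\<close> that cuts out
    \<open>x\<close>, and \<open>d\<close> is its complement; together they split every copy of
    \<open>b\<close>, although no object realizes the image of \<open>d\<close>.\<close>
  define e where "e = i \<cdot> p"
  define d where "d = Plus C (\<I> b) (neg C e)"
  have e: "e \<in> Hom C b b"
    unfolding e_def using comp_in_Hom[OF p i] .
  note ne = neg_in_Hom[OF e] and ib = ident_in_Hom[OF b]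
  have d: "d \<in> Hom C b b"
    unfolding d_def using plus_in_Hom[OF ib ne] .
  have pe: "p \<cdot> e = p"
    unfolding e_def using comp_assoc[OF p i p] pi ident_comp[OF p] by simp
  have ei: "e \<cdot> i = i"
    unfolding e_def using comp_assoc[OF i p i] pi comp_ident[OF i] by simp
  have ee: "e \<cdot> e = e"
    using comp_assoc[OF p i e] ei unfolding e_def by simp
  have pd: "p \<cdot> d = Zero C b x"
    unfolding d_def using plus_comp[OF ib ne p] comp_ident[OF p] comp_neg[OF e p] pe plus_neg[OF p] by simp
  have di: "d \<cdot> i = Zero C x b"
    unfolding d_def using comp_plus[OF i ib ne] ident_comp[OF i] neg_comp[OF i e] ei plus_neg[OF i] by simp
  have de: "d \<cdot> e = Zero C b b"
    unfolding d_def using comp_plus[OF e ib ne] ident_comp[OF e] neg_comp[OF e e] ee plus_neg[OF e] by simp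
  have ed: "e \<cdot> d = Zero C b b"
    unfolding d_def using plus_comp[OF ib ne e] comp_ident[OF e] comp_neg[OF e e] ee plus_neg[OF e] by simp
  have dd: "d \<cdot> d = d"
    using comp_plus[OF d ib ne] ident_comp[OF d] neg_comp[OF d e] ed
      neg_unique[OF zero_in_Hom[OF b b] zero_in_Hom[OF b b] plus_zero[OF zero_in_Hom[OF b b]]]
      plus_zero[OF d] unfolding d_def by simp
  have de_sum: "Plus C d e = \<I> b"
    unfolding d_def using plus_assoc[OF ib ne e] neg_plus[OF e] plus_zero[OF ib] by simp
  have \<iota>d: "\<iota> n \<cdot> d \<in> Hom C b B" and \<iota>e: "\<iota> n \<cdot> e \<in> Hom C b B" for n
    using comp_in_Hom[OF d \<iota>] comp_in_Hom[OF e \<iota>] by auto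
  have \<iota>_sum: "Plus C (\<iota> n \<cdot> d) (\<iota> n \<cdot> e) = \<iota> n" for n
    using plus_comp[OF d e \<iota>] de_sum comp_ident[OF \<iota>] by simp
  define i' where "i' = \<iota> 0 \<cdot> i"
  have i': "i' \<in> Hom C x B"
    unfolding i'_def using comp_in_Hom[OF i \<iota>] .
  have "(if n = 0 then p else Zero C b x) \<in> Hom C b x" for n :: nat
    using p zero_in_Hom[OF b x] by simp
  then obtain p' where p': "p' \<in> Hom C B x" "\<And>n. p' \<cdot> \<iota> n = (if n = 0 then p else Zero C b x)"
    using coproduct_map[OF cop x, of "\<lambda>n. if n = 0 then p else Zero C b x"] by auto
  \<comment> \<open>\<open>j'\<close> keeps the \<open>d\<close>-part of each copy in place and
    moves its \<open>e\<close>-part one copy up, which leaves the \<open>e\<close>-part of copy 0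
    free.\<close>
  obtain j' where j': "j' \<in> Hom C B B" "\<And>n. j' \<cdot> \<iota> n = Plus C (\<iota> n \<cdot> d) (\<iota> (Suc n) \<cdot> e)"
    using coproduct_map[OF cop B, of "\<lambda>n. Plus C (\<iota> n \<cdot> d) (\<iota> (Suc n) \<cdot> e)"] plus_in_Hom[OF \<iota>d \<iota>e]
    by auto
  \<comment> \<open>\<open>q'\<close> moves the \<open>e\<close>-parts back down. It kills the
    \<open>e\<close>-part of copy 0, which is the summand \<open>x\<close> seen by \<open>i'\<close>
    and \<open>p'\<close>.\<close>
  have "(if n = 0 then \<iota> 0 \<cdot> d else Plus C (\<iota> n \<cdot> d) (\<iota> (n - 1) \<cdot> e)) \<in> Hom C b B" for n
    using \<iota>d plus_in_Hom[OF \<iota>d \<iota>e] by simp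
  then obtain q' where q': "q' \<in> Hom C B B"
    "\<And>n. q' \<cdot> \<iota> n = (if n = 0 then \<iota> 0 \<cdot> d else Plus C (\<iota> n \<cdot> d) (\<iota> (n - 1) \<cdot> e))"
    using coproduct_map[OF cop B, of "\<lambda>n. if n = 0 then \<iota> 0 \<cdot> d else Plus C (\<iota> n \<cdot> d) (\<iota> (n - 1) \<cdot> e)"]
    by auto
  have assoc: "(\<iota> n \<cdot> u) \<cdot> v = \<iota> n \<cdot> u \<cdot> v" if "u \<in> Hom C b b" "v \<in> Hom C z b" for n u v z
    using comp_assoc[OF that(2,1) \<iota>] .
  have q'd: "q' \<cdot> \<iota> n \<cdot> d = \<iota> n \<cdot> d" for n
  proof -
    have "q' \<cdot> \<iota> n \<cdot> d = (q' \<cdot> \<iota> n) \<cdot> d"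
      using comp_assoc[OF d \<iota> q'(1)] by simp
    also have "... = \<iota> n \<cdot> d"
      using q'(2)[of n] assoc[OF d d] assoc[OF e d] dd ed comp_plus[OF d \<iota>d \<iota>e] comp_zero[OF \<iota> b]
        plus_zero[OF \<iota>d] by simp
    finally show ?thesis .
  qed
  have q'e: "q' \<cdot> \<iota> (Suc n) \<cdot> e = \<iota> n \<cdot> e" for n
  proof -
    have "q' \<cdot> \<iota> (Suc n) \<cdot> e = (q' \<cdot> \<iota> (Suc n)) \<cdot> e"
      using comp_assoc[OF e \<iota> q'(1)] by simp
    also have "... = \<iota> n \<cdot> e"
      using q'(2)[of "Suc n"] assoc[OF d e] assoc[OF e e] ee de comp_plus[OF e \<iota>d \<iota>e] comp_zero[OF \<iota> b]
        zero_plus[OF \<iota>e] by simp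
    finally show ?thesis .
  qed
  have j'd: "j' \<cdot> \<iota> n \<cdot> d = \<iota> n \<cdot> d" for n
    using comp_assoc[OF d \<iota> j'(1)] j'(2) comp_plus[OF d \<iota>d \<iota>e] assoc[OF d d] assoc[OF e d] dd ed
      comp_zero[OF \<iota> b] plus_zero[OF \<iota>d] by metis
  have j'e: "j' \<cdot> \<iota> n \<cdot> e = \<iota> (Suc n) \<cdot> e" for n
    using comp_assoc[OF e \<iota> j'(1)] j'(2) comp_plus[OF e \<iota>d \<iota>e] assoc[OF d e] assoc[OF e e] de ee
      comp_zero[OF \<iota> b] zero_plus[OF \<iota>e] by metis
  have "p' \<cdot> i' = \<I> x"
    unfolding i'_def using comp_assoc[OF i \<iota>[of 0] p'(1)] p'(2)[of 0] pi by simp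
  moreover have "q' \<cdot> j' = \<I> B"
  proof (rule coproduct_eqI[OF cop comp_in_Hom[OF j'(1) q'(1)] ident_in_Hom[OF B]])
    fix n
    have "(q' \<cdot> j') \<cdot> \<iota> n = q' \<cdot> Plus C (\<iota> n \<cdot> d) (\<iota> (Suc n) \<cdot> e)"
      using comp_assoc[OF \<iota> j'(1) q'(1)] j'(2) by simp
    also have "... = \<iota> n"
      using plus_comp[OF \<iota>d \<iota>e q'(1)] q'd q'e \<iota>_sum by simp
    finally show "(q' \<cdot> j') \<cdot> \<iota> n = \<I> B \<cdot> \<iota> n"
      using ident_comp[OF \<iota>] by simp
  qed
  moreover have "p' \<cdot> j' = Zero C B x"
  proof (rule coproduct_eqI[OF cop comp_in_Hom[OF j'(1) p'(1)] zero_in_Hom[OF B x]])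
    fix n
    have "(p' \<cdot> j') \<cdot> \<iota> n = p' \<cdot> Plus C (\<iota> n \<cdot> d) (\<iota> (Suc n) \<cdot> e)"
      using comp_assoc[OF \<iota> j'(1) p'(1)] j'(2) by simp
    also have "... = Plus C ((p' \<cdot> \<iota> n) \<cdot> d) ((p' \<cdot> \<iota> (Suc n)) \<cdot> e)"
      using plus_comp[OF \<iota>d \<iota>e p'(1)] comp_assoc[OF d \<iota> p'(1)] comp_assoc[OF e \<iota> p'(1)] by simp
    also have "... = Zero C b x"
      using p'(2) pd zero_comp[OF d x] zero_comp[OF e x] plus_zero[OF zero_in_Hom[OF b x]] by simp
    finally show "(p' \<cdot> j') \<cdot> \<iota> n = Zero C B x \<cdot> \<iota> n"
      using zero_comp[OF \<iota> x] by simp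
  qed
  moreover have "q' \<cdot> i' = Zero C x B"
    unfolding i'_def using comp_assoc[OF i \<iota>[of 0] q'(1)] q'(2)[of 0] assoc[OF d i] di comp_zero[OF \<iota> x] by simp
  moreover have "Plus C (i' \<cdot> p') (j' \<cdot> q') = \<I> B"
  proof (rule coproduct_eqI[OF cop plus_in_Hom[OF comp_in_Hom[OF p'(1) i'] comp_in_Hom[OF q'(1) j'(1)]]
        ident_in_Hom[OF B]])
    fix n
    have "Plus C (i' \<cdot> p') (j' \<cdot> q') \<cdot> \<iota> n = Plus C (i' \<cdot> p' \<cdot> \<iota> n) (j' \<cdot> q' \<cdot> \<iota> n)"
      using comp_plus[OF \<iota> comp_in_Hom[OF p'(1) i'] comp_in_Hom[OF q'(1) j'(1)]]
        comp_assoc[OF \<iota> p'(1) i'] comp_assoc[OF \<iota> q'(1) j'(1)] by simp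
    also have "... = \<iota> n"
    \<comment> \<open>On copy 0 the \<open>e\<close>-part comes from \<open>i' \<cdot> p'\<close>
      and the \<open>d\<close>-part from \<open>j' \<cdot> q'\<close>; on every other copy
      \<open>j' \<cdot> q'\<close> already restores both parts.\<close>
    proof (cases n)
      case 0
      have "i' \<cdot> p' \<cdot> \<iota> n = \<iota> 0 \<cdot> e"
        unfolding i'_def e_def using 0 p'(2)[of 0] comp_assoc[OF p i \<iota>] by simp
      moreover have "j' \<cdot> q' \<cdot> \<iota> n = \<iota> 0 \<cdot> d"
        using 0 q'(2)[of 0] j'd by simp
      ultimately show ?thesis
        using 0 \<iota>_sum plus_comm[OF \<iota>d \<iota>e] by simp
    next
      case (Suc m)
      have "i' \<cdot> p' \<cdot> \<iota> n = Zero C b B"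
        using Suc p'(2)[of n] comp_zero[OF i' b] by simp
      moreover have "j' \<cdot> q' \<cdot> \<iota> n = Plus C (\<iota> n \<cdot> d) (\<iota> n \<cdot> e)"
        using Suc q'(2)[of n] plus_comp[OF \<iota>d \<iota>e j'(1)] j'd j'e by simp
      ultimately show ?thesis
        using \<iota>_sum zero_plus[OF \<iota>] by simp
    qed
    finally show "Plus C (i' \<cdot> p') (j' \<cdot> q') \<cdot> \<iota> n = \<I> B \<cdot> \<iota> n"
      using ident_comp[OF \<iota>] by simp
  qed
  ultimately show thesis
    using that i' p'(1) j'(1) q'(1) unfolding is_biproduct_def by blast
qed

end


text \<open>An inaccessible cardinal is uncountable, so countable coproducts are small; the
  embedding supplies an index set of the type over which coproducts are quantified.\<close>

lemma inaccessible_nat_embedding: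
  assumes "inaccessible (\<kappa> :: 'k rel)"
  obtains k :: "nat \<Rightarrow> 'k" where "inj k" "|range k| <o \<kappa>"
proof -
  have \<kappa>: "Card_order \<kappa>" "natLeq <o \<kappa>"
    using assms unfolding inaccessible_def by auto
  have nat: "|UNIV :: nat set| <o \<kappa>"
    using ordIso_ordLess_trans[OF card_of_nat \<kappa>(2)] .
  then have "|UNIV :: nat set| \<le>o |Field \<kappa>|"
    using ordLeq_ordIso_trans[OF ordLess_imp_ordLeq ordIso_symmetric[OF card_of_Field_ordIso[OF \<kappa>(1)]]]
    by blast
  then obtain k :: "nat \<Rightarrow> 'k" where "inj k"
    using card_of_ordLeq[of "UNIV :: nat set" "Field \<kappa>"] by blast
  moreover have "|range k| <o \<kappa>"
    using ordLeq_ordLess_trans[OF card_of_image nat] .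
  ultimately show thesis
    using that by blast
qed


context triangulated_category
begin

lemma localizing_triangulated: "localizing_subcategory \<kappa> C S \<Longrightarrow> triangulated_subcategory C S"
  unfolding localizing_subcategory_def by blast

lemma localizing_coproduct:
  "\<lbrakk>localizing_subcategory (\<kappa> :: 'k rel) C S; |I :: 'k set| <o \<kappa>; \<And>i. i \<in> I \<Longrightarrow> t i \<in> S; is_coproduct C I t c \<iota>\<rbrakk> \<Longrightarrow> c \<in> S"
  proof -
  assume "localizing_subcategory \<kappa> C S" "|I| <o \<kappa>" "\<And>i. i \<in> I \<Longrightarrow> t i \<in> S" "is_coproduct C I t c \<iota>"
  moreover from this(3) have "t \<in> I \<rightarrow> S"
    by blast
  ultimately show "c \<in> S"
    unfolding localizing_subcategory_def by blast
qed

text \<open>The coproduct \<open>B\<close> of countably many copies of \<open>b\<close> lies in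
  \<open>S\<close>, and \<open>B\<close> is a biproduct of \<open>x\<close> and \<open>B\<close>;
  closure under fibres gives \<open>x\<close>. The swindle replaces a complement of \<open>x\<close>
  in \<open>b\<close>, which a retraction does not provide.\<close>

lemma localizing_retract:
  assumes \<kappa>: "inaccessible (\<kappa> :: 'k rel)" "has_small_coproducts \<kappa> C"
    and S: "localizing_subcategory \<kappa> C S" and b: "b \<in> S"
    and ip: "i \<in> Hom C x b" "p \<in> Hom C b x" "p \<cdot> i = \<I> x"
  shows "x \<in> S"
proof -
  obtain k :: "nat \<Rightarrow> 'k" where k: "inj k" "|range k| <o \<kappa>"
    using inaccessible_nat_embedding[OF \<kappa>(1)] .
  have "b \<in> Obj C"
    using Hom_Obj[OF ip(1)] by blast
  then obtain B \<iota> where B: "is_coproduct C (range k) (\<lambda>_. b) B \<iota>"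
    using \<kappa>(2) k(2) unfolding has_small_coproducts_def by (metis Pi_I)
  have "B \<in> S"
    using localizing_coproduct[OF S k(2) b B] .
  moreover obtain i' j' p' q' where "is_biproduct C x B B i' j' p' q'"
    using swindle[OF coproduct_reindex[OF B k(1)] ip] .
  ultimately show ?thesis
    using sub_biproduct_fibre[OF localizing_triangulated[OF S]] by blast
qed

section \<open>Closure properties of the compact objects\<close>

lemma compact_object_iff:
  "compact_object \<kappa> C x \<longleftrightarrow> x \<in> Obj C \<and>
     (\<forall>(I :: 'k set) t c \<iota>. |I| <o (\<kappa> :: 'k rel) \<longrightarrow> is_coproduct C I t c \<iota> \<longrightarrow>
        (\<forall>\<phi> \<in> Hom C x c. \<exists>F \<subseteq> I. finite F \<and> truncation I t c \<iota> F \<cdot> \<phi> = \<phi>))"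
proof (cases "x \<in> Obj C")
  case True
  have "t \<in> I \<rightarrow> Obj C" if "is_coproduct C I t c \<iota>" for I :: "'k set" and t c \<iota>
    using cop_Obj(2)[OF that] by blast
  note tI = this
  have eq: "(t \<in> I \<rightarrow> Obj C \<longrightarrow> is_coproduct C I t c \<iota> \<longrightarrow>
        (\<lambda>h. finprod (hom_group C x c) (\<lambda>i. \<iota> i \<cdot> h i) {i \<in> I. h i \<noteq> Zero C x (t i)})
          \<in> Group.iso (sum_group I (\<lambda>i. hom_group C x (t i))) (hom_group C x c)) \<longleftrightarrow>
      (is_coproduct C I t c \<iota> \<longrightarrow>
        (\<forall>\<phi> \<in> Hom C x c. \<exists>F \<subseteq> I. finite F \<and> truncation I t c \<iota> F \<cdot> \<phi> = \<phi>))"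
    for I :: "'k set" and t c \<iota>
  proof (cases "is_coproduct C I t c \<iota>")
    case cop: True
    show ?thesis
      using cop tI[OF cop] by (simp only: canonical_map_iso_iff[OF cop True] simp_thms)
  qed (simp only: simp_thms)
  show ?thesis
    unfolding compact_object_def eq ..
qed (simp add: compact_object_def)

lemma compactE:
  assumes "compact_object (\<kappa> :: 'k rel) C x" "|I| <o \<kappa>" "is_coproduct C (I :: 'k set) t c \<iota>" "\<phi> \<in> Hom C x c"
  obtains F where "F \<subseteq> I" "finite F" "truncation I t c \<iota> F \<cdot> \<phi> = \<phi>"
  using assms(1)[unfolded compact_object_iff, THEN conjunct2, rule_format, OF assms(2,3,4)] that by blast

lemma compactI:
  assumes "x \<in> Obj C"
    and "\<And>(I :: 'k set) t c \<iota> \<phi>. \<lbrakk>|I| <o \<kappa>; is_coproduct C I t c \<iota>; \<phi> \<in> Hom C x c\<rbrakk>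
      \<Longrightarrow> \<exists>F \<subseteq> I. finite F \<and> truncation I t c \<iota> F \<cdot> \<phi> = \<phi>"
  shows "compact_object (\<kappa> :: 'k rel) C x"
  unfolding compact_object_iff using assms by blast

lemma compact_Obj: "compact_object \<kappa> C x \<Longrightarrow> x \<in> Obj C"
  unfolding compact_object_def by blast

text \<open>Extend \<open>\<phi>\<close> to \<open>x\<close> along \<open>p\<close>, find a
  truncation fixing the extension, and restrict again along \<open>i\<close>.\<close>

lemma compact_retract:
  assumes x: "compact_object (\<kappa> :: 'k rel) C x" and ip: "i \<in> Hom C y x" "p \<in> Hom C x y" "p \<cdot> i = \<I> y"
  shows "compact_object \<kappa> C y"
proof (rule compactI)
  show "y \<in> Obj C"
    using Hom_Obj[OF ip(1)] by blast
  fix I :: "'k set" and t c \<iota> \<phi>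
  assume I: "|I| <o \<kappa>" and cop: "is_coproduct C I t c \<iota>" and \<phi>: "\<phi> \<in> Hom C y c"
  note e = truncation_in_Hom[OF cop]
  obtain F where F: "F \<subseteq> I" "finite F" "truncation I t c \<iota> F \<cdot> \<phi> \<cdot> p = \<phi> \<cdot> p"
    using compactE[OF x I cop comp_in_Hom[OF ip(2) \<phi>]] .
  have "truncation I t c \<iota> F \<cdot> \<phi> = truncation I t c \<iota> F \<cdot> (\<phi> \<cdot> p) \<cdot> i"
    using comp_assoc[OF ip(1,2) \<phi>] ip(3) comp_ident[OF \<phi>] by simp
  also have "... = (truncation I t c \<iota> F \<cdot> \<phi> \<cdot> p) \<cdot> i"
    using comp_assoc[OF ip(1) comp_in_Hom[OF ip(2) \<phi>] e] by simp
  also have "... = \<phi>"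
    using F(3) comp_assoc[OF ip(1,2) \<phi>] ip(3) comp_ident[OF \<phi>] by simp
  finally show "\<exists>F \<subseteq> I. finite F \<and> truncation I t c \<iota> F \<cdot> \<phi> = \<phi>"
    using F by blast
qed

lemma compact_isomorphic: "\<lbrakk>compact_object \<kappa> C x; isomorphic C x y\<rbrakk> \<Longrightarrow> compact_object \<kappa> C y"
  by (elim isomorphicE) (rule compact_retract)

text \<open>A two-step approximation. Some \<open>F\<close> fixes \<open>\<phi> \<cdot> g\<close>;
  the error left on \<open>\<phi>\<close> kills \<open>g\<close>, hence factors through the compact
  object \<open>\<Sigma>\<^sub>o x\<close>, where some \<open>G\<close> fixes it. The union of
  \<open>F\<close> and \<open>G\<close> fixes both contributions.\<close>

lemma compact_cone:
  assumes tri: "exact_triangle C x y z f g h"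
    and y: "compact_object (\<kappa> :: 'k rel) C y" and sx: "compact_object \<kappa> C (\<Sigma>\<^sub>o x)"
  shows "compact_object \<kappa> C z"
proof (rule compactI)
  note T = exact_Hom[OF tri]
  show "z \<in> Obj C"
    by fact
  fix I :: "'k set" and t c \<iota> \<phi>
  assume I: "|I| <o \<kappa>" and cop: "is_coproduct C I t c \<iota>" and \<phi>: "\<phi> \<in> Hom C z c"
  let ?e = "truncation I t c \<iota>"
  note e = truncation_in_Hom[OF cop]
  obtain F where F: "F \<subseteq> I" "finite F" "?e F \<cdot> \<phi> \<cdot> g = \<phi> \<cdot> g"
    using compactE[OF y I cop comp_in_Hom[OF T(2) \<phi>]] .
  have e\<phi>: "?e G \<cdot> \<phi> \<in> Hom C z c" for G
    using comp_in_Hom[OF \<phi> e] .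
  let ?d = "Plus C \<phi> (neg C (?e F \<cdot> \<phi>))"
  have d: "?d \<in> Hom C z c"
    using plus_in_Hom[OF \<phi> neg_in_Hom[OF e\<phi>]] .
  have "?d \<cdot> g = Zero C y c"
    using comp_plus[OF T(2) \<phi> neg_in_Hom[OF e\<phi>]] neg_comp[OF T(2) e\<phi>] comp_assoc[OF T(2) \<phi> e] F(3)
      plus_neg[OF comp_in_Hom[OF T(2) \<phi>]] by simp
  then obtain \<psi> where \<psi>: "\<psi> \<in> Hom C (\<Sigma>\<^sub>o x) c" "\<psi> \<cdot> h = ?d"
    using weak_cokernel[OF rotate[OF tri] d] by blast
  obtain G where G: "G \<subseteq> I" "finite G" "?e G \<cdot> \<psi> = \<psi>"
    using compactE[OF sx I cop \<psi>(1)] .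
  have eF: "?e (F \<union> G) \<cdot> ?e F \<cdot> \<phi> = ?e F \<cdot> \<phi>"
    using comp_assoc[OF \<phi> e[of F] e[of "F \<union> G"]] truncation_absorb[OF cop, of F "F \<union> G"] by simp
  have eG: "?e (F \<union> G) \<cdot> ?d = ?d"
  proof -
    have "?e (F \<union> G) \<cdot> \<psi> = ?e (F \<union> G) \<cdot> ?e G \<cdot> \<psi>"
      using G(3) by simp
    also have "... = \<psi>"
      using comp_assoc[OF \<psi>(1) e[of G] e[of "F \<union> G"]] truncation_absorb[OF cop, of G "F \<union> G"] G(3) by simp
    finally show ?thesis
      using comp_assoc[OF T(3) \<psi>(1) e] \<psi>(2) by metis
  qed
  have "?e (F \<union> G) \<cdot> \<phi> = ?e (F \<union> G) \<cdot> Plus C (?e F \<cdot> \<phi>) ?d"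
    using plus_diff_cancel[OF \<phi> e\<phi>] by simp
  also have "... = \<phi>"
    using plus_comp[OF e\<phi>[of F] d e[of "F \<union> G"]] eF eG plus_diff_cancel[OF \<phi> e\<phi>[of F]] by simp
  finally show "\<exists>F \<subseteq> I. finite F \<and> ?e F \<cdot> \<phi> = \<phi>"
    using F G by (intro exI[of _ "F \<union> G"]) simp
qed

lemma desusp:
  "y \<in> Obj C \<Longrightarrow> \<exists>y' u v. y' \<in> Obj C \<and> u \<in> Hom C (\<Sigma>\<^sub>o y') y \<and> v \<in> Hom C y (\<Sigma>\<^sub>o y') \<and>
     v \<cdot> u = \<I> (\<Sigma>\<^sub>o y') \<and> u \<cdot> v = \<I> y"
  by (drule susp_ess_surj) (blast elim: isomorphicE)

text \<open>An equivalence preserves coproducts. A target \<open>y\<close> is replaced by the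
  suspension of some \<open>y'\<close>, and maps between suspensions are lifted by full
  faithfulness.\<close>

lemma susp_coproduct:
  assumes cop: "is_coproduct C I t c \<iota>"
  shows "is_coproduct C I (\<lambda>i. \<Sigma>\<^sub>o (t i)) (\<Sigma>\<^sub>o c) (\<lambda>i. \<Sigma>\<^sub>a (\<iota> i))"
proof (rule coproductI)
  note c = cop_Obj(1)[OF cop] and t = cop_Obj(2)[OF cop] and \<iota> = coproductD(2)[OF cop]
  show "\<Sigma>\<^sub>o c \<in> Obj C"
    using susp.map_Obj[OF c] .
  show "\<Sigma>\<^sub>a (\<iota> i) \<in> Hom C (\<Sigma>\<^sub>o (t i)) (\<Sigma>\<^sub>o c)" if "i \<in> I" for i
    using susp.map_Hom[OF \<iota>[OF that]] .
  show "\<exists>g \<in> Hom C (\<Sigma>\<^sub>o c) y. \<forall>i \<in> I. g \<cdot> \<Sigma>\<^sub>a (\<iota> i) = f i"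
    if y: "y \<in> Obj C" and f: "\<And>i. i \<in> I \<Longrightarrow> f i \<in> Hom C (\<Sigma>\<^sub>o (t i)) y" for y f
  proof -
    obtain y' u v where y': "y' \<in> Obj C" and u: "u \<in> Hom C (\<Sigma>\<^sub>o y') y" and v: "v \<in> Hom C y (\<Sigma>\<^sub>o y')"
      and uv: "u \<cdot> v = \<I> y"
      using desusp[OF y] by blast
    have "\<forall>i. \<exists>f'. i \<in> I \<longrightarrow> f' \<in> Hom C (t i) y' \<and> \<Sigma>\<^sub>a f' = v \<cdot> f i"
      using susp_full[OF comp_in_Hom[OF f v] t y'] by metis
    then obtain f' where f': "\<And>i. i \<in> I \<Longrightarrow> f' i \<in> Hom C (t i) y'" "\<And>i. i \<in> I \<Longrightarrow> \<Sigma>\<^sub>a (f' i) = v \<cdot> f i"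
      by metis
    obtain g' where g': "g' \<in> Hom C c y'" "\<And>i. i \<in> I \<Longrightarrow> g' \<cdot> \<iota> i = f' i"
      using coproduct_map[OF cop y' f'(1)] by blast
    have "(u \<cdot> \<Sigma>\<^sub>a g') \<cdot> \<Sigma>\<^sub>a (\<iota> i) = f i" if i: "i \<in> I" for i
    proof -
      have "(u \<cdot> \<Sigma>\<^sub>a g') \<cdot> \<Sigma>\<^sub>a (\<iota> i) = u \<cdot> \<Sigma>\<^sub>a (g' \<cdot> \<iota> i)"
        using comp_assoc[OF susp.map_Hom[OF \<iota>[OF i]] susp.map_Hom[OF g'(1)] u]
          susp.map_comp[OF \<iota>[OF i] g'(1)] by simp
      also have "... = (u \<cdot> v) \<cdot> f i"
        using g'(2)[OF i] f'(2)[OF i] comp_assoc[OF f[OF i] v u] by simp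
      finally show ?thesis
        using uv ident_comp[OF f[OF i]] by simp
    qed
    then show ?thesis
      using comp_in_Hom[OF susp.map_Hom[OF g'(1)] u] by blast
  qed
  show "g = h" if g: "g \<in> Hom C (\<Sigma>\<^sub>o c) y" and h: "h \<in> Hom C (\<Sigma>\<^sub>o c) y"
    and eq: "\<And>i. i \<in> I \<Longrightarrow> g \<cdot> \<Sigma>\<^sub>a (\<iota> i) = h \<cdot> \<Sigma>\<^sub>a (\<iota> i)" for y g h
  proof -
    have y: "y \<in> Obj C"
      using Hom_Obj[OF g] by blast
    obtain y' u v where y': "y' \<in> Obj C" and u: "u \<in> Hom C (\<Sigma>\<^sub>o y') y" and v: "v \<in> Hom C y (\<Sigma>\<^sub>o y')"
      and uv: "u \<cdot> v = \<I> y"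
      using desusp[OF y] by blast
    obtain g' where g': "g' \<in> Hom C c y'" "\<Sigma>\<^sub>a g' = v \<cdot> g"
      using susp_full[OF comp_in_Hom[OF g v] c y'] .
    obtain h' where h': "h' \<in> Hom C c y'" "\<Sigma>\<^sub>a h' = v \<cdot> h"
      using susp_full[OF comp_in_Hom[OF h v] c y'] .
    have "g' \<cdot> \<iota> i = h' \<cdot> \<iota> i" if i: "i \<in> I" for i
    proof (rule susp_inject[OF comp_in_Hom[OF \<iota>[OF i] g'(1)] comp_in_Hom[OF \<iota>[OF i] h'(1)]])
      show "\<Sigma>\<^sub>a (g' \<cdot> \<iota> i) = \<Sigma>\<^sub>a (h' \<cdot> \<iota> i)"
        using susp.map_comp[OF \<iota>[OF i] g'(1)] susp.map_comp[OF \<iota>[OF i] h'(1)] g'(2) h'(2)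
          comp_assoc[OF susp.map_Hom[OF \<iota>[OF i]] g v] comp_assoc[OF susp.map_Hom[OF \<iota>[OF i]] h v] eq[OF i]
        by simp
    qed
    then have "v \<cdot> g = v \<cdot> h"
      using coproduct_eqI[OF cop g'(1) h'(1)] g'(2) h'(2) by simp
    then show ?thesis
      using comp_assoc[OF g v u] comp_assoc[OF h v u] uv ident_comp[OF g] ident_comp[OF h] by simp
  qed
qed

lemma susp_truncation:
  assumes cop: "is_coproduct C I t c \<iota>"
  shows "truncation I (\<lambda>i. \<Sigma>\<^sub>o (t i)) (\<Sigma>\<^sub>o c) (\<lambda>i. \<Sigma>\<^sub>a (\<iota> i)) F =
    \<Sigma>\<^sub>a (truncation I t c \<iota> F)"
proof (rule truncation_unique[OF susp_coproduct[OF cop]])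
  note e = truncation_in_Hom[OF cop]
  show "\<Sigma>\<^sub>a (truncation I t c \<iota> F) \<in> Hom C (\<Sigma>\<^sub>o c) (\<Sigma>\<^sub>o c)"
    using susp.map_Hom[OF e] .
  fix i assume i: "i \<in> I"
  show "\<Sigma>\<^sub>a (truncation I t c \<iota> F) \<cdot> \<Sigma>\<^sub>a (\<iota> i) =
      (if i \<in> F then \<Sigma>\<^sub>a (\<iota> i) else Zero C (\<Sigma>\<^sub>o (t i)) (\<Sigma>\<^sub>o c))"
    using susp.map_comp[OF coproductD(2)[OF cop i] e, symmetric] truncation_comp[OF cop i]
      susp_zero[OF cop_Obj(2)[OF cop i] cop_Obj(1)[OF cop]] by simp
qed

text \<open>Suspend the map into the coproduct, truncate there, and return by faithfulness; the
  suspension commutes with truncations.\<close>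

lemma compact_desusp:
  assumes sx: "compact_object (\<kappa> :: 'k rel) C (\<Sigma>\<^sub>o x)" and x: "x \<in> Obj C"
  shows "compact_object \<kappa> C x"
proof (rule compactI)
  fix I :: "'k set" and t c \<iota> \<phi>
  assume I: "|I| <o \<kappa>" and cop: "is_coproduct C I t c \<iota>" and \<phi>: "\<phi> \<in> Hom C x c"
  note e = truncation_in_Hom[OF cop]
  obtain F where F: "F \<subseteq> I" "finite F" "\<Sigma>\<^sub>a (truncation I t c \<iota> F) \<cdot> \<Sigma>\<^sub>a \<phi> = \<Sigma>\<^sub>a \<phi>"
    using compactE[OF sx I susp_coproduct[OF cop] susp.map_Hom[OF \<phi>]] susp_truncation[OF cop]
    by metis
  then have "truncation I t c \<iota> F \<cdot> \<phi> = \<phi>"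
    using susp.map_comp[OF \<phi> e] susp_inject[OF comp_in_Hom[OF \<phi> e] \<phi>] by simp
  then show "\<exists>F \<subseteq> I. finite F \<and> truncation I t c \<iota> F \<cdot> \<phi> = \<phi>"
    using F by blast
qed (rule x)

text \<open>To test \<open>\<Sigma>\<^sub>o x\<close> for compactness, a map into \<open>c\<close>
  must be pulled back to a map out of \<open>x\<close>. Neither \<open>c\<close> nor its summands
  need literally be suspensions, so they are replaced by chosen desuspensions \<open>c'\<close> and
  \<open>t'\<close>; conjugation by \<open>\<theta>\<close> and \<open>\<theta>'\<close> matches the
  two families of truncations.\<close>

lemma desusp_coproduct:
  assumes cop: "is_coproduct C I t c \<iota>"
  obtains t' c' \<iota>' \<theta> \<theta>' where "is_coproduct C I t' c' \<iota>'"
    "\<theta> \<in> Hom C (\<Sigma>\<^sub>o c') c" "\<theta>' \<in> Hom C c (\<Sigma>\<^sub>o c')" "\<theta> \<cdot> \<theta>' = \<I> c"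
    "\<And>F. truncation I t c \<iota> F = \<theta> \<cdot> \<Sigma>\<^sub>a (truncation I t' c' \<iota>' F) \<cdot> \<theta>'"
proof -
  note c = cop_Obj(1)[OF cop] and t = cop_Obj(2)[OF cop] and \<iota> = coproductD(2)[OF cop]
  obtain c' \<theta> \<theta>' where c': "c' \<in> Obj C" and \<theta>: "\<theta> \<in> Hom C (\<Sigma>\<^sub>o c') c" "\<theta>' \<in> Hom C c (\<Sigma>\<^sub>o c')"
      "\<theta>' \<cdot> \<theta> = \<I> (\<Sigma>\<^sub>o c')" "\<theta> \<cdot> \<theta>' = \<I> c"
    using desusp[OF c] by blast
  have "\<forall>i. \<exists>y' u v. i \<in> I \<longrightarrow> y' \<in> Obj C \<and> u \<in> Hom C (\<Sigma>\<^sub>o y') (t i) \<and> v \<in> Hom C (t i) (\<Sigma>\<^sub>o y') \<and>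
      v \<cdot> u = \<I> (\<Sigma>\<^sub>o y') \<and> u \<cdot> v = \<I> (t i)"
    using desusp[OF t] by blast
  then obtain t' u v where t': "\<And>i. i \<in> I \<Longrightarrow> t' i \<in> Obj C"
    and u: "\<And>i. i \<in> I \<Longrightarrow> u i \<in> Hom C (\<Sigma>\<^sub>o (t' i)) (t i)" and v: "\<And>i. i \<in> I \<Longrightarrow> v i \<in> Hom C (t i) (\<Sigma>\<^sub>o (t' i))"
    and vu: "\<And>i. i \<in> I \<Longrightarrow> v i \<cdot> u i = \<I> (\<Sigma>\<^sub>o (t' i))" and uv: "\<And>i. i \<in> I \<Longrightarrow> u i \<cdot> v i = \<I> (t i)"
    by metis
  \<comment> \<open>The new injections are the lifts of the old ones, transported by the
    isomorphisms of source and target with suspensions.\<close>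
  have "\<forall>i. \<exists>j. i \<in> I \<longrightarrow> j \<in> Hom C (t' i) c' \<and> \<Sigma>\<^sub>a j = \<theta>' \<cdot> \<iota> i \<cdot> u i"
    using susp_full[OF comp_in_Hom[OF comp_in_Hom[OF u \<iota>] \<theta>(2)] t' c'] by metis
  then obtain \<iota>' where \<iota>': "\<And>i. i \<in> I \<Longrightarrow> \<iota>' i \<in> Hom C (t' i) c'"
      "\<And>i. i \<in> I \<Longrightarrow> \<Sigma>\<^sub>a (\<iota>' i) = \<theta>' \<cdot> \<iota> i \<cdot> u i"
    by metis
  have \<theta>\<iota>: "\<theta> \<cdot> \<Sigma>\<^sub>a (\<iota>' i) = \<iota> i \<cdot> u i" if i: "i \<in> I" for i
    using \<iota>'(2)[OF i] comp_assoc[OF comp_in_Hom[OF u[OF i] \<iota>[OF i]] \<theta>(2,1)] \<theta>(4)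
      ident_comp[OF comp_in_Hom[OF u[OF i] \<iota>[OF i]]] by simp
  have \<theta>\<iota>': "\<theta>' \<cdot> \<iota> i = \<Sigma>\<^sub>a (\<iota>' i) \<cdot> v i" if i: "i \<in> I" for i
    using \<iota>'(2)[OF i] comp_assoc[OF v[OF i] comp_in_Hom[OF u[OF i] \<iota>[OF i]] \<theta>(2)]
      comp_assoc[OF v[OF i] u[OF i] \<iota>[OF i]] uv[OF i] comp_ident[OF \<iota>[OF i]] by simp
  have cop': "is_coproduct C I t' c' \<iota>'"
  proof (rule coproductI[OF c' \<iota>'(1)])
    show "\<exists>g \<in> Hom C c' y. \<forall>i \<in> I. g \<cdot> \<iota>' i = f i"
      if y: "y \<in> Obj C" and f: "\<And>i. i \<in> I \<Longrightarrow> f i \<in> Hom C (t' i) y" for y f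
    proof -
      obtain g where g: "g \<in> Hom C c (\<Sigma>\<^sub>o y)" "\<And>i. i \<in> I \<Longrightarrow> g \<cdot> \<iota> i = \<Sigma>\<^sub>a (f i) \<cdot> v i"
        using coproduct_map[OF cop susp.map_Obj[OF y], of "\<lambda>i. \<Sigma>\<^sub>a (f i) \<cdot> v i"]
          comp_in_Hom[OF v susp.map_Hom[OF f]] by blast
      obtain g' where g': "g' \<in> Hom C c' y" "\<Sigma>\<^sub>a g' = g \<cdot> \<theta>"
        using susp_full[OF comp_in_Hom[OF \<theta>(1) g(1)] c' y] .
      have "g' \<cdot> \<iota>' i = f i" if i: "i \<in> I" for i
      proof (rule susp_inject[OF comp_in_Hom[OF \<iota>'(1)[OF i] g'(1)] f[OF i]])
        have "\<Sigma>\<^sub>a (g' \<cdot> \<iota>' i) = g \<cdot> \<iota> i \<cdot> u i"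
          using susp.map_comp[OF \<iota>'(1)[OF i] g'(1)] g'(2)
            comp_assoc[OF susp.map_Hom[OF \<iota>'(1)[OF i]] \<theta>(1) g(1)] \<theta>\<iota>[OF i] by simp
        also have "... = (\<Sigma>\<^sub>a (f i) \<cdot> v i) \<cdot> u i"
          using comp_assoc[OF u[OF i] \<iota>[OF i] g(1)] g(2)[OF i] by simp
        also have "... = \<Sigma>\<^sub>a (f i)"
          using comp_assoc[OF u[OF i] v[OF i] susp.map_Hom[OF f[OF i]]] vu[OF i]
            comp_ident[OF susp.map_Hom[OF f[OF i]]] by simp
        finally show "\<Sigma>\<^sub>a (g' \<cdot> \<iota>' i) = \<Sigma>\<^sub>a (f i)" .
      qed
      then show ?thesis
        using g'(1) by blast
    qed
    show "g = h" if g: "g \<in> Hom C c' y" and h: "h \<in> Hom C c' y"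
      and eq: "\<And>i. i \<in> I \<Longrightarrow> g \<cdot> \<iota>' i = h \<cdot> \<iota>' i" for y g h
    proof -
      note sg = susp.map_Hom[OF g] and sh = susp.map_Hom[OF h]
      have "\<Sigma>\<^sub>a g \<cdot> \<theta>' = \<Sigma>\<^sub>a h \<cdot> \<theta>'"
      proof (rule coproduct_eqI[OF cop comp_in_Hom[OF \<theta>(2) sg] comp_in_Hom[OF \<theta>(2) sh]])
        fix i assume i: "i \<in> I"
        have *: "(\<Sigma>\<^sub>a k \<cdot> \<theta>') \<cdot> \<iota> i = \<Sigma>\<^sub>a (k \<cdot> \<iota>' i) \<cdot> v i" if k: "k \<in> Hom C c' y" for k
          using comp_assoc[OF \<iota>[OF i] \<theta>(2) susp.map_Hom[OF k]] \<theta>\<iota>'[OF i]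
            comp_assoc[OF v[OF i] susp.map_Hom[OF \<iota>'(1)[OF i]] susp.map_Hom[OF k]]
            susp.map_comp[OF \<iota>'(1)[OF i] k] by simp
        show "(\<Sigma>\<^sub>a g \<cdot> \<theta>') \<cdot> \<iota> i = (\<Sigma>\<^sub>a h \<cdot> \<theta>') \<cdot> \<iota> i"
          using *[OF g] *[OF h] eq[OF i] by simp
      qed
      then have "\<Sigma>\<^sub>a g \<cdot> \<theta>' \<cdot> \<theta> = \<Sigma>\<^sub>a h \<cdot> \<theta>' \<cdot> \<theta>"
        using comp_assoc[OF \<theta>(1,2) sg] comp_assoc[OF \<theta>(1,2) sh] by simp
      then show ?thesis
        using \<theta>(3) comp_ident[OF sg] comp_ident[OF sh] susp_inject[OF g h] by simp
    qed
  qed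
  have trunc: "truncation I t c \<iota> F = \<theta> \<cdot> \<Sigma>\<^sub>a (truncation I t' c' \<iota>' F) \<cdot> \<theta>'" for F
  proof (rule truncation_unique[OF cop])
    let ?e = "truncation I t' c' \<iota>' F"
    note e = truncation_in_Hom[OF cop']
    note se = susp.map_Hom[OF e]
    show "\<theta> \<cdot> \<Sigma>\<^sub>a ?e \<cdot> \<theta>' \<in> Hom C c c"
      using comp_in_Hom[OF comp_in_Hom[OF \<theta>(2) se] \<theta>(1)] .
    fix i assume i: "i \<in> I"
    have "(\<theta> \<cdot> \<Sigma>\<^sub>a ?e \<cdot> \<theta>') \<cdot> \<iota> i = \<theta> \<cdot> \<Sigma>\<^sub>a ?e \<cdot> \<Sigma>\<^sub>a (\<iota>' i) \<cdot> v i"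
      using comp_assoc[OF \<iota>[OF i] comp_in_Hom[OF \<theta>(2) se] \<theta>(1)] comp_assoc[OF \<iota>[OF i] \<theta>(2) se]
        \<theta>\<iota>'[OF i] by simp
    also have "... = \<theta> \<cdot> \<Sigma>\<^sub>a (?e \<cdot> \<iota>' i) \<cdot> v i"
      using comp_assoc[OF v[OF i] susp.map_Hom[OF \<iota>'(1)[OF i]] se] susp.map_comp[OF \<iota>'(1)[OF i] e] by simp
    also have "... = (if i \<in> F then \<iota> i else Zero C (t i) c)"
    proof (cases "i \<in> F")
      case True
      have "\<theta> \<cdot> \<Sigma>\<^sub>a (\<iota>' i) \<cdot> v i = (\<iota> i \<cdot> u i) \<cdot> v i"
        using comp_assoc[OF v[OF i] susp.map_Hom[OF \<iota>'(1)[OF i]] \<theta>(1)] \<theta>\<iota>[OF i] by simp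
      then show ?thesis
        using True truncation_comp[OF cop' i] comp_assoc[OF v[OF i] u[OF i] \<iota>[OF i]] uv[OF i]
          comp_ident[OF \<iota>[OF i]] by simp
    next
      case False
      then show ?thesis
        using truncation_comp[OF cop' i] susp_zero[OF t'[OF i] c'] zero_comp[OF v[OF i]]
          susp.map_Obj[OF c'] comp_zero[OF \<theta>(1) t[OF i]] by simp
    qed
    finally show "(\<theta> \<cdot> \<Sigma>\<^sub>a ?e \<cdot> \<theta>') \<cdot> \<iota> i = (if i \<in> F then \<iota> i else Zero C (t i) c)" .
  qed
  show thesis
    using that[OF cop' \<theta>(1,2,4) trunc] .
qed

lemma compact_susp:
  assumes x: "compact_object (\<kappa> :: 'k rel) C x"
  shows "compact_object \<kappa> C (\<Sigma>\<^sub>o x)"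
proof (rule compactI)
  have xo: "x \<in> Obj C"
    using compact_Obj[OF x] .
  then show "\<Sigma>\<^sub>o x \<in> Obj C"
    by (rule susp.map_Obj)
  fix I :: "'k set" and t c \<iota> \<phi>
  assume I: "|I| <o \<kappa>" and cop: "is_coproduct C I t c \<iota>" and \<phi>: "\<phi> \<in> Hom C (\<Sigma>\<^sub>o x) c"
  obtain t' c' \<iota>' \<theta> \<theta>' where cop': "is_coproduct C I t' c' \<iota>'"
    and \<theta>: "\<theta> \<in> Hom C (\<Sigma>\<^sub>o c') c" "\<theta>' \<in> Hom C c (\<Sigma>\<^sub>o c')" "\<theta> \<cdot> \<theta>' = \<I> c"
    and trunc: "\<And>F. truncation I t c \<iota> F = \<theta> \<cdot> \<Sigma>\<^sub>a (truncation I t' c' \<iota>' F) \<cdot> \<theta>'"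
    using desusp_coproduct[OF cop] by metis
  let ?e = "truncation I t' c' \<iota>'"
  note e = truncation_in_Hom[OF cop']
  note se = susp.map_Hom[OF e]
  obtain \<psi> where \<psi>: "\<psi> \<in> Hom C x c'" "\<Sigma>\<^sub>a \<psi> = \<theta>' \<cdot> \<phi>"
    using susp_full[OF comp_in_Hom[OF \<phi> \<theta>(2)] xo cop_Obj(1)[OF cop']] .
  obtain F where F: "F \<subseteq> I" "finite F" "?e F \<cdot> \<psi> = \<psi>"
    using compactE[OF x I cop' \<psi>(1)] .
  have "truncation I t c \<iota> F \<cdot> \<phi> = \<theta> \<cdot> \<Sigma>\<^sub>a (?e F) \<cdot> \<theta>' \<cdot> \<phi>"
    using trunc comp_assoc[OF \<phi> comp_in_Hom[OF \<theta>(2) se] \<theta>(1)] comp_assoc[OF \<phi> \<theta>(2) se] by simp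
  also have "... = \<theta> \<cdot> \<theta>' \<cdot> \<phi>"
    using \<psi>(2) susp.map_comp[OF \<psi>(1) e] F(3) by metis
  also have "... = \<phi>"
    using comp_assoc[OF \<phi> \<theta>(2,1)] \<theta>(3) ident_comp[OF \<phi>] by simp
  finally show "\<exists>F \<subseteq> I. finite F \<and> truncation I t c \<iota> F \<cdot> \<phi> = \<phi>"
    using F by blast
qed

end


section \<open>Rigid objects\<close>

context symmetric_monoidal_category
begin

text \<open>One of the coherence identities that Kelly derived from pentagon and triangle. Tensor
  both sides with the unit on the right, where the two axioms apply; then cancel the associator and
  use that tensoring with the unit is faithful.\<close>

lemma runit_tens:
  assumes x: "x \<in> Obj C" and y: "y \<in> Obj C"
  shows "\<rho>\<^sub>u (x \<otimes>\<^sub>o y) = (\<I> x \<otimes>\<^sub>a \<rho>\<^sub>u y) \<cdot> \<alpha>\<^sub>u x y \<one>\<^sub>u"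
proof -
  let ?u = "\<one>\<^sub>u"
  note u = unit_in_Obj and xy = tens_in_Obj[OF x y]
  note simps = mon_simps x y xy u Hom_iff
  have "\<alpha>\<^sub>u x y ?u \<cdot> (\<rho>\<^sub>u (x \<otimes>\<^sub>o y) \<otimes>\<^sub>a \<I> ?u) =
      \<alpha>\<^sub>u x y ?u \<cdot> ((\<I> x \<otimes>\<^sub>a \<I> y) \<otimes>\<^sub>a \<lambda>\<^sub>u ?u) \<cdot> \<alpha>\<^sub>u (x \<otimes>\<^sub>o y) ?u ?u"
    using triangle_identity[OF xy u] by (simp add: tens_ident[OF x y])
  also have "... = (\<alpha>\<^sub>u x y ?u \<cdot> ((\<I> x \<otimes>\<^sub>a \<I> y) \<otimes>\<^sub>a \<lambda>\<^sub>u ?u)) \<cdot> \<alpha>\<^sub>u (x \<otimes>\<^sub>o y) ?u ?u"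
    by (simp add: simps)
  also have "... = ((\<I> x \<otimes>\<^sub>a (\<I> y \<otimes>\<^sub>a \<lambda>\<^sub>u ?u)) \<cdot> \<alpha>\<^sub>u x y (?u \<otimes>\<^sub>o ?u)) \<cdot> \<alpha>\<^sub>u (x \<otimes>\<^sub>o y) ?u ?u"
    using assoc_natural[of "\<I> x" x x "\<I> y" y y "\<lambda>\<^sub>u ?u" "?u \<otimes>\<^sub>o ?u" "?u"]
    by (simp add: simps)
  also have "... = (\<I> x \<otimes>\<^sub>a (\<I> y \<otimes>\<^sub>a \<lambda>\<^sub>u ?u)) \<cdot> \<alpha>\<^sub>u x y (?u \<otimes>\<^sub>o ?u) \<cdot> \<alpha>\<^sub>u (x \<otimes>\<^sub>o y) ?u ?u"
    by (simp add: simps)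
  also have "... = (\<I> x \<otimes>\<^sub>a (\<I> y \<otimes>\<^sub>a \<lambda>\<^sub>u ?u)) \<cdot>
      (\<I> x \<otimes>\<^sub>a \<alpha>\<^sub>u y ?u ?u) \<cdot> \<alpha>\<^sub>u x (y \<otimes>\<^sub>o ?u) ?u \<cdot> (\<alpha>\<^sub>u x y ?u \<otimes>\<^sub>a \<I> ?u)"
    using pentagon[OF x y u u] by simp
  also have "... = (\<I> x \<otimes>\<^sub>a ((\<I> y \<otimes>\<^sub>a \<lambda>\<^sub>u ?u) \<cdot> \<alpha>\<^sub>u y ?u ?u)) \<cdot>
      \<alpha>\<^sub>u x (y \<otimes>\<^sub>o ?u) ?u \<cdot> (\<alpha>\<^sub>u x y ?u \<otimes>\<^sub>a \<I> ?u)"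
    by (simp add: tens_comp_comp_arr simps)
  also have "... = ((\<I> x \<otimes>\<^sub>a (\<rho>\<^sub>u y \<otimes>\<^sub>a \<I> ?u)) \<cdot> \<alpha>\<^sub>u x (y \<otimes>\<^sub>o ?u) ?u) \<cdot> (\<alpha>\<^sub>u x y ?u \<otimes>\<^sub>a \<I> ?u)"
    by (simp add: triangle_identity[OF y u] simps)
  also have "... = (\<alpha>\<^sub>u x y ?u \<cdot> ((\<I> x \<otimes>\<^sub>a \<rho>\<^sub>u y) \<otimes>\<^sub>a \<I> ?u)) \<cdot> (\<alpha>\<^sub>u x y ?u \<otimes>\<^sub>a \<I> ?u)"
    using assoc_natural[of "\<I> x" x x "\<rho>\<^sub>u y" "y \<otimes>\<^sub>o ?u" y "\<I> ?u" "?u" "?u"]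
    by (simp add: simps)
  also have "... = \<alpha>\<^sub>u x y ?u \<cdot> (((\<I> x \<otimes>\<^sub>a \<rho>\<^sub>u y) \<cdot> \<alpha>\<^sub>u x y ?u) \<otimes>\<^sub>a \<I> ?u)"
    by (simp add: tens_comp_arr simps)
  finally have eq: "\<alpha>\<^sub>u x y ?u \<cdot> (\<rho>\<^sub>u (x \<otimes>\<^sub>o y) \<otimes>\<^sub>a \<I> ?u) =
      \<alpha>\<^sub>u x y ?u \<cdot> (((\<I> x \<otimes>\<^sub>a \<rho>\<^sub>u y) \<cdot> \<alpha>\<^sub>u x y ?u) \<otimes>\<^sub>a \<I> ?u)" .
  have "\<rho>\<^sub>u (x \<otimes>\<^sub>o y) \<otimes>\<^sub>a \<I> ?u = ((\<I> x \<otimes>\<^sub>a \<rho>\<^sub>u y) \<cdot> \<alpha>\<^sub>u x y ?u) \<otimes>\<^sub>a \<I> ?u"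
    by (rule iso_cancel_left[OF _ _ _ _ eq, of "(x \<otimes>\<^sub>o y) \<otimes>\<^sub>o ?u" "x \<otimes>\<^sub>o (y \<otimes>\<^sub>o ?u)"
          "((x \<otimes>\<^sub>o y) \<otimes>\<^sub>o ?u) \<otimes>\<^sub>o ?u"]) (simp_all add: simps)
  then show ?thesis
    using runit_faithful[of "\<rho>\<^sub>u (x \<otimes>\<^sub>o y)" "(x \<otimes>\<^sub>o y) \<otimes>\<^sub>o ?u" "x \<otimes>\<^sub>o y"
        "(\<I> x \<otimes>\<^sub>a \<rho>\<^sub>u y) \<cdot> \<alpha>\<^sub>u x y ?u"] by (simp add: simps)
qed

text \<open>Naturality of \<open>\<rho>\<^sub>u\<close> at its own component gives
  \<open>\<rho>\<^sub>u (\<one>\<^sub>u \<otimes>\<^sub>o \<one>\<^sub>u) = \<rho>\<^sub>u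
  \<one>\<^sub>u \<otimes>\<^sub>a \<I> \<one>\<^sub>u\<close>. The left side is rewritten by
  \<open>runit_tens\<close>, the right side by the triangle identity, and the unit factor is
  cancelled.\<close>

lemma lunit_unit: "\<lambda>\<^sub>u \<one>\<^sub>u = \<rho>\<^sub>u \<one>\<^sub>u"
proof -
  let ?u = "\<one>\<^sub>u"
  note u = unit_in_Obj
  note simps = mon_simps u Hom_iff
  have "\<rho>\<^sub>u ?u \<cdot> \<rho>\<^sub>u (?u \<otimes>\<^sub>o ?u) = \<rho>\<^sub>u ?u \<cdot> (\<rho>\<^sub>u ?u \<otimes>\<^sub>a \<I> ?u)"
    using runit_natural[of "\<rho>\<^sub>u ?u" "?u \<otimes>\<^sub>o ?u" "?u"] by (simp add: simps)
  then have "\<rho>\<^sub>u (?u \<otimes>\<^sub>o ?u) = \<rho>\<^sub>u ?u \<otimes>\<^sub>a \<I> ?u"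
    using iso_cancel_left[of "\<rho>\<^sub>u ?u" "?u \<otimes>\<^sub>o ?u" "?u" "\<rho>\<^sub>u (?u \<otimes>\<^sub>o ?u)"
        "(?u \<otimes>\<^sub>o ?u) \<otimes>\<^sub>o ?u" "\<rho>\<^sub>u ?u \<otimes>\<^sub>a \<I> ?u"] by (simp add: simps)
  then have "(\<I> ?u \<otimes>\<^sub>a \<rho>\<^sub>u ?u) \<cdot> \<alpha>\<^sub>u ?u ?u ?u = (\<I> ?u \<otimes>\<^sub>a \<lambda>\<^sub>u ?u) \<cdot> \<alpha>\<^sub>u ?u ?u ?u"
    using runit_tens[OF u u] triangle_identity[OF u u] by simp
  then have "\<I> ?u \<otimes>\<^sub>a \<rho>\<^sub>u ?u = \<I> ?u \<otimes>\<^sub>a \<lambda>\<^sub>u ?u"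
    using iso_cancel_right[of "\<alpha>\<^sub>u ?u ?u ?u" "(?u \<otimes>\<^sub>o ?u) \<otimes>\<^sub>o ?u" "?u \<otimes>\<^sub>o (?u \<otimes>\<^sub>o ?u)"
        "\<I> ?u \<otimes>\<^sub>a \<rho>\<^sub>u ?u" "?u \<otimes>\<^sub>o ?u" "\<I> ?u \<otimes>\<^sub>a \<lambda>\<^sub>u ?u"] by (simp add: simps)
  then have "\<rho>\<^sub>u ?u = \<lambda>\<^sub>u ?u"
    using lunit_faithful[of "\<rho>\<^sub>u ?u" "?u \<otimes>\<^sub>o ?u" "?u" "\<lambda>\<^sub>u ?u"] by (simp add: simps)
  then show ?thesis ..
qed

lemma inv_assoc_natural:
  assumes f: "f \<in> Hom C x x'" and g: "g \<in> Hom C y y'" and h: "h \<in> Hom C z z'"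
  shows "inv_arrow C (\<alpha>\<^sub>u x' y' z') \<cdot> (f \<otimes>\<^sub>a (g \<otimes>\<^sub>a h)) = ((f \<otimes>\<^sub>a g) \<otimes>\<^sub>a h) \<cdot> inv_arrow C (\<alpha>\<^sub>u x y z)"
proof -
  have obj: "x \<in> Obj C" "y \<in> Obj C" "z \<in> Obj C" "x' \<in> Obj C" "y' \<in> Obj C" "z' \<in> Obj C"
    using Hom_Obj assms by auto
  have 1: "\<alpha>\<^sub>u x y z \<in> Hom C ((x \<otimes>\<^sub>o y) \<otimes>\<^sub>o z) (x \<otimes>\<^sub>o (y \<otimes>\<^sub>o z))" "is_iso C (\<alpha>\<^sub>u x y z)"
    and 2: "\<alpha>\<^sub>u x' y' z' \<in> Hom C ((x' \<otimes>\<^sub>o y') \<otimes>\<^sub>o z') (x' \<otimes>\<^sub>o (y' \<otimes>\<^sub>o z'))" "is_iso C (\<alpha>\<^sub>u x' y' z')"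
    using assoc_iso obj by auto
  note i1 = inv_arrow_props[OF 1(2,1)] and i2 = inv_arrow_props[OF 2(2,1)]
  have fgh: "f \<otimes>\<^sub>a (g \<otimes>\<^sub>a h) \<in> Hom C (x \<otimes>\<^sub>o (y \<otimes>\<^sub>o z)) (x' \<otimes>\<^sub>o (y' \<otimes>\<^sub>o z'))"
    and fgh': "(f \<otimes>\<^sub>a g) \<otimes>\<^sub>a h \<in> Hom C ((x \<otimes>\<^sub>o y) \<otimes>\<^sub>o z) ((x' \<otimes>\<^sub>o y') \<otimes>\<^sub>o z')"
    using tens_in_Hom f g h by blast+
  have "(inv_arrow C (\<alpha>\<^sub>u x' y' z') \<cdot> (f \<otimes>\<^sub>a (g \<otimes>\<^sub>a h))) \<cdot> \<alpha>\<^sub>u x y z =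
      inv_arrow C (\<alpha>\<^sub>u x' y' z') \<cdot> \<alpha>\<^sub>u x' y' z' \<cdot> ((f \<otimes>\<^sub>a g) \<otimes>\<^sub>a h)"
    using comp_assoc[OF 1(1) fgh i2(1)] assoc_natural[OF f g h] by simp
  also have "... = (f \<otimes>\<^sub>a g) \<otimes>\<^sub>a h"
    using comp_assoc[OF fgh' 2(1) i2(1)] i2(2) ident_comp[OF fgh'] by simp
  also have "... = (((f \<otimes>\<^sub>a g) \<otimes>\<^sub>a h) \<cdot> inv_arrow C (\<alpha>\<^sub>u x y z)) \<cdot> \<alpha>\<^sub>u x y z"
    using comp_assoc[OF 1(1) i1(1) fgh'] i1(2) comp_ident[OF fgh'] by simp
  finally show ?thesis
    using iso_cancel_right[OF 1(2,1)] comp_in_Hom[OF fgh i2(1)] comp_in_Hom[OF i1(1) fgh'] by blast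
qed

end


section \<open>Duality, and compactness of tensor products and duals\<close>

context tt_category
begin

text \<open>\<open>\<eta>\<close> is the coevaluation, \<open>\<epsilon>\<close> the evaluation, and
  the equations are the zigzag identities with associators and unitors written out. The witnesses of
  rigidity become parameters, since later constructions refer to them.\<close>

definition duality :: "'o \<Rightarrow> 'o \<Rightarrow> 'a \<Rightarrow> 'a \<Rightarrow> bool" where
  "duality x y \<eta> \<epsilon> \<longleftrightarrow>
     x \<in> Obj C \<and> y \<in> Obj C \<and> \<eta> \<in> Hom C \<one>\<^sub>u (x \<otimes>\<^sub>o y) \<and> \<epsilon> \<in> Hom C (y \<otimes>\<^sub>o x) \<one>\<^sub>u \<and>
     \<rho>\<^sub>u x \<cdot> (\<I> x \<otimes>\<^sub>a \<epsilon>) \<cdot> \<alpha>\<^sub>u x y x \<cdot> (\<eta> \<otimes>\<^sub>a \<I> x) = \<lambda>\<^sub>u x \<and>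
     \<lambda>\<^sub>u y \<cdot> (\<epsilon> \<otimes>\<^sub>a \<I> y) \<cdot> inv_arrow C (\<alpha>\<^sub>u y x y) \<cdot> (\<I> y \<otimes>\<^sub>a \<eta>) = \<rho>\<^sub>u y"

lemma rigid_object_iff: "rigid_object C x \<longleftrightarrow> (\<exists>y \<eta> \<epsilon>. duality x y \<eta> \<epsilon>)"
  unfolding rigid_object_def duality_def by blast

lemma dualityD:
  assumes "duality x y \<eta> \<epsilon>"
  shows "x \<in> Obj C" "y \<in> Obj C" "\<eta> \<in> Hom C \<one>\<^sub>u (x \<otimes>\<^sub>o y)" "\<epsilon> \<in> Hom C (y \<otimes>\<^sub>o x) \<one>\<^sub>u"
    "\<rho>\<^sub>u x \<cdot> (\<I> x \<otimes>\<^sub>a \<epsilon>) \<cdot> \<alpha>\<^sub>u x y x \<cdot> (\<eta> \<otimes>\<^sub>a \<I> x) = \<lambda>\<^sub>u x"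
    "\<lambda>\<^sub>u y \<cdot> (\<epsilon> \<otimes>\<^sub>a \<I> y) \<cdot> inv_arrow C (\<alpha>\<^sub>u y x y) \<cdot> (\<I> y \<otimes>\<^sub>a \<eta>) = \<rho>\<^sub>u y"
  using assms unfolding duality_def by blast+

lemma duality_arr:
  assumes "duality x y \<eta> \<epsilon>"
  shows "\<eta> \<in> Arr C" "Dom C \<eta> = \<one>\<^sub>u" "Cod C \<eta> = x \<otimes>\<^sub>o y" "\<epsilon> \<in> Arr C" "Dom C \<epsilon> = y \<otimes>\<^sub>o x" "Cod C \<epsilon> = \<one>\<^sub>u"
  using dualityD(3,4)[OF assms] by (simp_all add: Hom_iff)

text \<open>The unit is its own dual, with evaluation \<open>\<rho>\<^sub>u \<one>\<^sub>u\<close>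
  and coevaluation its inverse. As the two unitors agree on the unit, the triangle identity
  collapses both zigzags.\<close>

lemma rigid_unit: "rigid_object C \<one>\<^sub>u"
proof -
  let ?u = "\<one>\<^sub>u" and ?a = "\<alpha>\<^sub>u \<one>\<^sub>u \<one>\<^sub>u \<one>\<^sub>u" and ?\<rho> = "\<rho>\<^sub>u \<one>\<^sub>u"
  note u = unit_in_Obj
  note simps = mon_simps u Hom_iff
  obtain r where r: "r \<in> Hom C ?u (?u \<otimes>\<^sub>o ?u)" "r \<cdot> ?\<rho> = \<I> (?u \<otimes>\<^sub>o ?u)" "?\<rho> \<cdot> r = \<I> ?u"
    using runit_iso[OF u] is_isoE by metis
  have r': "r \<in> Arr C" "Dom C r = ?u" "Cod C r = ?u \<otimes>\<^sub>o ?u"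
    using r(1) by (simp_all add: Hom_iff)
  have a: "?a \<in> Hom C ((?u \<otimes>\<^sub>o ?u) \<otimes>\<^sub>o ?u) (?u \<otimes>\<^sub>o (?u \<otimes>\<^sub>o ?u))" "is_iso C (?a)"
    using assoc_iso u by auto
  note ia = inv_arrow_props[OF a(2,1)]
  have ia': "inv_arrow C (?a) \<in> Arr C" "Dom C (inv_arrow C (?a)) = ?u \<otimes>\<^sub>o (?u \<otimes>\<^sub>o ?u)"
    "Cod C (inv_arrow C (?a)) = (?u \<otimes>\<^sub>o ?u) \<otimes>\<^sub>o ?u"
    using ia(1) by (simp_all add: Hom_iff)
  have tri: "(\<I> ?u \<otimes>\<^sub>a ?\<rho>) \<cdot> ?a = ?\<rho> \<otimes>\<^sub>a \<I> ?u"
    using triangle_identity[OF u u] lunit_unit by simp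
  have "?\<rho> \<cdot> (\<I> ?u \<otimes>\<^sub>a ?\<rho>) \<cdot> ?a \<cdot> (r \<otimes>\<^sub>a \<I> ?u) =
      ?\<rho> \<cdot> ((\<I> ?u \<otimes>\<^sub>a ?\<rho>) \<cdot> ?a) \<cdot> (r \<otimes>\<^sub>a \<I> ?u)"
    by (simp add: simps r')
  also have "... = ?\<rho>"
    unfolding tri using r(3) by (simp add: simps r' tens_comp_arr)
  finally have 1: "?\<rho> \<cdot> (\<I> ?u \<otimes>\<^sub>a ?\<rho>) \<cdot> ?a \<cdot> (r \<otimes>\<^sub>a \<I> ?u) = \<lambda>\<^sub>u ?u"
    using lunit_unit by simp
  have "(?\<rho> \<otimes>\<^sub>a \<I> ?u) \<cdot> inv_arrow C (?a) =
      (\<I> ?u \<otimes>\<^sub>a ?\<rho>) \<cdot> ?a \<cdot> inv_arrow C (?a)"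
    unfolding tri[symmetric] by (simp add: simps ia')
  then have inv: "(?\<rho> \<otimes>\<^sub>a \<I> ?u) \<cdot> inv_arrow C (?a) = \<I> ?u \<otimes>\<^sub>a ?\<rho>"
    using ia(3) by (simp add: simps)
  have "?\<rho> \<cdot> (?\<rho> \<otimes>\<^sub>a \<I> ?u) \<cdot> inv_arrow C (?a) \<cdot> (\<I> ?u \<otimes>\<^sub>a r) =
      ?\<rho> \<cdot> ((?\<rho> \<otimes>\<^sub>a \<I> ?u) \<cdot> inv_arrow C (?a)) \<cdot> (\<I> ?u \<otimes>\<^sub>a r)"
    by (simp add: simps r' ia')
  also have "... = ?\<rho>"
    unfolding inv using r(3) by (simp add: simps r' tens_comp_arr)
  finally have 2: "\<lambda>\<^sub>u ?u \<cdot> (?\<rho> \<otimes>\<^sub>a \<I> ?u) \<cdot> inv_arrow C (?a) \<cdot> (\<I> ?u \<otimes>\<^sub>a r) = ?\<rho>"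
    using lunit_unit by simp
  have "?\<rho> \<in> Hom C (?u \<otimes>\<^sub>o ?u) ?u"
    by (simp add: simps)
  then show ?thesis
    unfolding rigid_object_def using u r(1) 1 2 by blast
qed

text \<open>The first zigzag identity factors the identity of \<open>x\<close> through a tensor
  product with two factors \<open>x\<close>. This is the source of the radicality of tensor
  ideals.\<close>

lemma rigid_retract:
  assumes "rigid_object C x"
  obtains y i p where "y \<in> Obj C" "i \<in> Hom C x ((x \<otimes>\<^sub>o y) \<otimes>\<^sub>o x)" "p \<in> Hom C ((x \<otimes>\<^sub>o y) \<otimes>\<^sub>o x) x" "p \<cdot> i = \<I> x"
proof -
  let ?u = "\<one>\<^sub>u"
  obtain y \<eta> \<epsilon> where dual: "duality x y \<eta> \<epsilon>"
    using assms unfolding rigid_object_iff by blast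
  note x = dualityD(1)[OF dual] and y = dualityD(2)[OF dual] and \<eta> = dualityD(3)[OF dual]
    and \<epsilon> = dualityD(4)[OF dual] and tri = dualityD(5)[OF dual]
  obtain l where l: "l \<in> Hom C x (?u \<otimes>\<^sub>o x)" "\<lambda>\<^sub>u x \<cdot> l = \<I> x"
    using lunit_iso[OF x] is_isoE by metis
  note simps = mon_simps x y Hom_iff
  have larr: "l \<in> Arr C" "Dom C l = x" "Cod C l = ?u \<otimes>\<^sub>o x"
    using l(1) by (simp_all add: Hom_iff)
  note arr = duality_arr[OF dual] larr
  show thesis
  proof (rule that[OF y])
    show "(\<eta> \<otimes>\<^sub>a \<I> x) \<cdot> l \<in> Hom C x ((x \<otimes>\<^sub>o y) \<otimes>\<^sub>o x)" "\<rho>\<^sub>u x \<cdot> (\<I> x \<otimes>\<^sub>a \<epsilon>) \<cdot> \<alpha>\<^sub>u x y x \<in> Hom C ((x \<otimes>\<^sub>o y) \<otimes>\<^sub>o x) x"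
      by (simp_all add: simps arr)
    have "(\<rho>\<^sub>u x \<cdot> (\<I> x \<otimes>\<^sub>a \<epsilon>) \<cdot> \<alpha>\<^sub>u x y x) \<cdot> (\<eta> \<otimes>\<^sub>a \<I> x) \<cdot> l =
        (\<rho>\<^sub>u x \<cdot> (\<I> x \<otimes>\<^sub>a \<epsilon>) \<cdot> \<alpha>\<^sub>u x y x \<cdot> (\<eta> \<otimes>\<^sub>a \<I> x)) \<cdot> l"
      by (simp add: simps arr)
    then show "(\<rho>\<^sub>u x \<cdot> (\<I> x \<otimes>\<^sub>a \<epsilon>) \<cdot> \<alpha>\<^sub>u x y x) \<cdot> (\<eta> \<otimes>\<^sub>a \<I> x) \<cdot> l = \<I> x"
      using tri l(2) by simp
  qed
qed

lemma tens_zero_left: "\<lbrakk>x \<in> Obj C; y \<in> Obj C; w \<in> Obj C\<rbrakk> \<Longrightarrow> Zero C x y \<otimes>\<^sub>a \<I> w = Zero C (x \<otimes>\<^sub>o w) (y \<otimes>\<^sub>o w)"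
  using additive_endofunctor.map_zero[OF exact_endofunctor.axioms(1)[OF tens_exact_left] additive_category_axioms]
  by blast

lemma tens_zero_right: "\<lbrakk>x \<in> Obj C; y \<in> Obj C; w \<in> Obj C\<rbrakk> \<Longrightarrow> \<I> w \<otimes>\<^sub>a Zero C x y = Zero C (w \<otimes>\<^sub>o x) (w \<otimes>\<^sub>o y)"
  using additive_endofunctor.map_zero[OF exact_endofunctor.axioms(1)[OF tens_exact_right] additive_category_axioms]
  by blast

text \<open>Vanishing of \<open>\<I> x \<otimes>\<^sub>a v\<close> is detected on the mate of \<open>v\<close>: the point \<open>v\<close> slides along the
  string of \<open>x\<close> to the counit.\<close>

lemma rigid_tens_zero:
  assumes dual: "duality x y \<eta> \<epsilon>" and v: "v \<in> Hom C \<one>\<^sub>u f" and v\<epsilon>: "v \<cdot> \<epsilon> = Zero C (y \<otimes>\<^sub>o x) f"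
  shows "\<I> x \<otimes>\<^sub>a v = Zero C (x \<otimes>\<^sub>o \<one>\<^sub>u) (x \<otimes>\<^sub>o f)"
proof -
  let ?u = "\<one>\<^sub>u"
  note x = dualityD(1)[OF dual] and y = dualityD(2)[OF dual] and \<eta> = dualityD(3)[OF dual]
    and \<epsilon> = dualityD(4)[OF dual] and tri = dualityD(5)[OF dual]
  note u = unit_in_Obj
  have f: "f \<in> Obj C"
    using Hom_Obj[OF v] by blast
  note simps = mon_simps x y u f Hom_iff
  obtain r where r: "r \<in> Hom C x (x \<otimes>\<^sub>o ?u)" "r \<cdot> \<rho>\<^sub>u x = \<I> (x \<otimes>\<^sub>o ?u)"
    using runit_iso[OF x] is_isoE by metis
  obtain l where l: "l \<in> Hom C x (?u \<otimes>\<^sub>o x)" "\<lambda>\<^sub>u x \<cdot> l = \<I> x"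
    using lunit_iso[OF x] is_isoE by metis
  \<comment> \<open>\<open>X\<close> is the zigzag without its final unitor. It has the right
    inverse \<open>l \<cdot> \<rho>\<^sub>u x\<close>, so it suffices that
    \<open>\<I> x \<otimes>\<^sub>a v\<close> vanishes after \<open>X\<close>; there
    \<open>v\<close> meets \<open>\<epsilon>\<close>.\<close>
  define X where "X = (\<I> x \<otimes>\<^sub>a \<epsilon>) \<cdot> \<alpha>\<^sub>u x y x \<cdot> (\<eta> \<otimes>\<^sub>a \<I> x)"
  have arr': "r \<in> Arr C" "Dom C r = x" "Cod C r = x \<otimes>\<^sub>o ?u"
    "v \<in> Arr C" "Dom C v = ?u" "Cod C v = f"
    using v r(1) by (simp_all add: Hom_iff)
  note arr = duality_arr[OF dual] arr'
  have X: "X \<in> Hom C (?u \<otimes>\<^sub>o x) (x \<otimes>\<^sub>o ?u)"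
    unfolding X_def by (simp add: simps arr)
  have \<rho>: "\<rho>\<^sub>u x \<in> Hom C (x \<otimes>\<^sub>o ?u) x"
    using runit_iso[OF x] by blast
  have "X = (r \<cdot> \<rho>\<^sub>u x) \<cdot> X"
    using r(2) ident_comp[OF X] by simp
  also have "... = r \<cdot> \<lambda>\<^sub>u x"
    using comp_assoc[OF X \<rho> r(1)] tri unfolding X_def by simp
  finally have "X \<cdot> l = r"
    using comp_assoc[of l x "?u \<otimes>\<^sub>o x" "\<lambda>\<^sub>u x" x r] l r(1) comp_ident[OF r(1)] lunit_iso[OF x] by simp
  then have Xl: "X \<cdot> l \<cdot> \<rho>\<^sub>u x = \<I> (x \<otimes>\<^sub>o ?u)"
    using comp_assoc[OF \<rho> l(1) X] r(2) by simp
  have "(\<I> x \<otimes>\<^sub>a v) \<cdot> X = (\<I> x \<otimes>\<^sub>a (v \<cdot> \<epsilon>)) \<cdot> \<alpha>\<^sub>u x y x \<cdot> (\<eta> \<otimes>\<^sub>a \<I> x)"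
    unfolding X_def by (simp add: tens_comp_comp_arr simps arr)
  also have "... = Zero C (?u \<otimes>\<^sub>o x) (x \<otimes>\<^sub>o f)"
    unfolding v\<epsilon> tens_zero_right[OF tens_in_Obj[OF y x] f x]
    by (rule zero_comp) (simp_all add: simps arr)
  finally have *: "(\<I> x \<otimes>\<^sub>a v) \<cdot> X = Zero C (?u \<otimes>\<^sub>o x) (x \<otimes>\<^sub>o f)" .
  have xv: "\<I> x \<otimes>\<^sub>a v \<in> Hom C (x \<otimes>\<^sub>o ?u) (x \<otimes>\<^sub>o f)"
    using tens_in_Hom[OF ident_in_Hom[OF x] v] .
  have "\<I> x \<otimes>\<^sub>a v = ((\<I> x \<otimes>\<^sub>a v) \<cdot> X) \<cdot> l \<cdot> \<rho>\<^sub>u x"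
    using comp_assoc[OF comp_in_Hom[OF \<rho> l(1)] X xv] Xl comp_ident[OF xv] by simp
  then show ?thesis
    using * zero_comp[OF comp_in_Hom[OF \<rho> l(1)] tens_in_Obj[OF x f]] by simp
qed

text \<open>Tensoring with \<open>w\<close> is a left adjoint. Maps out of the tensored coproduct
  are exchanged, through the universal arrow \<open>e\<close>, for maps from \<open>c\<close> to the
  internal hom object \<open>h\<close>.\<close>

lemma tens_coproduct:
  assumes cop: "is_coproduct C I t c \<iota>" and w: "w \<in> Obj C"
  shows "is_coproduct C I (\<lambda>i. t i \<otimes>\<^sub>o w) (c \<otimes>\<^sub>o w) (\<lambda>i. \<iota> i \<otimes>\<^sub>a \<I> w)"
proof (rule coproductI)
  note c = cop_Obj(1)[OF cop] and t = cop_Obj(2)[OF cop] and \<iota> = coproductD(2)[OF cop]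
  note iw = ident_in_Hom[OF w]
  show "c \<otimes>\<^sub>o w \<in> Obj C"
    using tens_in_Obj[OF c w] .
  show "\<iota> i \<otimes>\<^sub>a \<I> w \<in> Hom C (t i \<otimes>\<^sub>o w) (c \<otimes>\<^sub>o w)" if "i \<in> I" for i
    using tens_in_Hom[OF \<iota>[OF that] iw] .
  have comp_tens: "e \<cdot> ((g \<cdot> \<iota> i) \<otimes>\<^sub>a \<I> w) = (e \<cdot> (g \<otimes>\<^sub>a \<I> w)) \<cdot> (\<iota> i \<otimes>\<^sub>a \<I> w)"
    if "i \<in> I" "g \<in> Hom C c h" "e \<in> Hom C (h \<otimes>\<^sub>o w) y" for i g h e y
    using comp_assoc[OF tens_in_Hom[OF \<iota>[OF that(1)] iw] tens_in_Hom[OF that(2) iw] that(3)]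
      tens_comp[OF \<iota>[OF that(1)] that(2) iw iw] ident_comp[OF iw] by simp
  show "\<exists>g \<in> Hom C (c \<otimes>\<^sub>o w) y. \<forall>i \<in> I. g \<cdot> (\<iota> i \<otimes>\<^sub>a \<I> w) = f i"
    if y: "y \<in> Obj C" and f: "\<And>i. i \<in> I \<Longrightarrow> f i \<in> Hom C (t i \<otimes>\<^sub>o w) y" for y f
  proof -
    obtain h e where h: "h \<in> Obj C" and e: "e \<in> Hom C (h \<otimes>\<^sub>o w) y"
      and un: "\<forall>z \<in> Obj C. \<forall>f \<in> Hom C (z \<otimes>\<^sub>o w) y. \<exists>!g. g \<in> Hom C z h \<and> e \<cdot> (g \<otimes>\<^sub>a \<I> w) = f"
      using closed[OF w y] by blast
    have "\<forall>i. \<exists>g. i \<in> I \<longrightarrow> g \<in> Hom C (t i) h \<and> e \<cdot> (g \<otimes>\<^sub>a \<I> w) = f i"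
      using un[rule_format, OF t f] by blast
    then obtain g where g: "\<And>i. i \<in> I \<Longrightarrow> g i \<in> Hom C (t i) h" "\<And>i. i \<in> I \<Longrightarrow> e \<cdot> (g i \<otimes>\<^sub>a \<I> w) = f i"
      by metis
    obtain k where k: "k \<in> Hom C c h" "\<And>i. i \<in> I \<Longrightarrow> k \<cdot> \<iota> i = g i"
      using coproduct_map[OF cop h g(1)] by blast
    have "(e \<cdot> (k \<otimes>\<^sub>a \<I> w)) \<cdot> (\<iota> i \<otimes>\<^sub>a \<I> w) = f i" if i: "i \<in> I" for i
      using comp_tens[OF i k(1) e] k(2)[OF i] g(2)[OF i] by simp
    then show ?thesis
      using comp_in_Hom[OF tens_in_Hom[OF k(1) iw] e] by blast
  qed
  show "f = g" if f: "f \<in> Hom C (c \<otimes>\<^sub>o w) y" and g: "g \<in> Hom C (c \<otimes>\<^sub>o w) y"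
    and eq: "\<And>i. i \<in> I \<Longrightarrow> f \<cdot> (\<iota> i \<otimes>\<^sub>a \<I> w) = g \<cdot> (\<iota> i \<otimes>\<^sub>a \<I> w)" for y f g
  proof -
    have y: "y \<in> Obj C"
      using Hom_Obj[OF f] by blast
    obtain h e where h: "h \<in> Obj C" and e: "e \<in> Hom C (h \<otimes>\<^sub>o w) y"
      and un: "\<forall>z \<in> Obj C. \<forall>f \<in> Hom C (z \<otimes>\<^sub>o w) y. \<exists>!g. g \<in> Hom C z h \<and> e \<cdot> (g \<otimes>\<^sub>a \<I> w) = f"
      using closed[OF w y] by blast
    obtain f' where f': "f' \<in> Hom C c h" "e \<cdot> (f' \<otimes>\<^sub>a \<I> w) = f"
      using un[rule_format, OF c f] by blast
    obtain g' where g': "g' \<in> Hom C c h" "e \<cdot> (g' \<otimes>\<^sub>a \<I> w) = g"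
      using un[rule_format, OF c g] by blast
    have "f' \<cdot> \<iota> i = g' \<cdot> \<iota> i" if i: "i \<in> I" for i
    proof -
      have "\<exists>!k. k \<in> Hom C (t i) h \<and> e \<cdot> (k \<otimes>\<^sub>a \<I> w) = f \<cdot> (\<iota> i \<otimes>\<^sub>a \<I> w)"
        using un[rule_format, OF t[OF i] comp_in_Hom[OF tens_in_Hom[OF \<iota>[OF i] iw] f]] .
      moreover have "f' \<cdot> \<iota> i \<in> Hom C (t i) h \<and> e \<cdot> ((f' \<cdot> \<iota> i) \<otimes>\<^sub>a \<I> w) = f \<cdot> (\<iota> i \<otimes>\<^sub>a \<I> w)"
        using comp_in_Hom[OF \<iota>[OF i] f'(1)] comp_tens[OF i f'(1) e] f'(2) by simp
      moreover have "g' \<cdot> \<iota> i \<in> Hom C (t i) h \<and> e \<cdot> ((g' \<cdot> \<iota> i) \<otimes>\<^sub>a \<I> w) = f \<cdot> (\<iota> i \<otimes>\<^sub>a \<I> w)"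
        using comp_in_Hom[OF \<iota>[OF i] g'(1)] comp_tens[OF i g'(1) e] g'(2) eq[OF i] by simp
      ultimately show ?thesis
        by blast
    qed
    then have "f' = g'"
      using coproduct_eqI[OF cop f'(1) g'(1)] by blast
    then show ?thesis
      using f'(2) g'(2) by simp
  qed
qed

lemma tens_truncation:
  assumes cop: "is_coproduct C I t c \<iota>" and w: "w \<in> Obj C"
  shows "truncation I (\<lambda>i. t i \<otimes>\<^sub>o w) (c \<otimes>\<^sub>o w) (\<lambda>i. \<iota> i \<otimes>\<^sub>a \<I> w) F =
    truncation I t c \<iota> F \<otimes>\<^sub>a \<I> w"
proof (rule truncation_unique[OF tens_coproduct[OF cop w]])
  note e = truncation_in_Hom[OF cop] and iw = ident_in_Hom[OF w]
  show "truncation I t c \<iota> F \<otimes>\<^sub>a \<I> w \<in> Hom C (c \<otimes>\<^sub>o w) (c \<otimes>\<^sub>o w)"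
    using tens_in_Hom[OF e iw] .
  fix i assume i: "i \<in> I"
  show "(truncation I t c \<iota> F \<otimes>\<^sub>a \<I> w) \<cdot> (\<iota> i \<otimes>\<^sub>a \<I> w) =
      (if i \<in> F then \<iota> i \<otimes>\<^sub>a \<I> w else Zero C (t i \<otimes>\<^sub>o w) (c \<otimes>\<^sub>o w))"
    using tens_comp[OF coproductD(2)[OF cop i] e iw iw, symmetric] ident_comp[OF iw]
      truncation_comp[OF cop i] tens_zero_left[OF cop_Obj(2)[OF cop i] cop_Obj(1)[OF cop] w]
    by simp
qed

text \<open>The adjunction between \<open>_ \<otimes>\<^sub>o x\<close> and \<open>_ \<otimes>\<^sub>o y\<close> for a dual \<open>y\<close> of \<open>x\<close>: a map \<open>\<phi>\<close> out of
  \<open>z \<otimes>\<^sub>o x\<close> is recovered from its adjunct \<open>(\<phi> \<otimes>\<^sub>a \<I> y) \<cdot> k\<close> and a counit that is natural in \<open>d\<close>.\<close>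

lemma rigid_adjunct:
  assumes dual: "duality x y \<eta> \<epsilon>" and z: "z \<in> Obj C"
  obtains k where "k \<in> Hom C (z \<otimes>\<^sub>o \<one>\<^sub>u) ((z \<otimes>\<^sub>o x) \<otimes>\<^sub>o y)"
    "\<And>\<phi> d. \<phi> \<in> Hom C (z \<otimes>\<^sub>o x) d \<Longrightarrow>
       \<phi> \<cdot> (\<rho>\<^sub>u z \<otimes>\<^sub>a \<I> x) = \<rho>\<^sub>u d \<cdot> (\<I> d \<otimes>\<^sub>a \<epsilon>) \<cdot> \<alpha>\<^sub>u d y x \<cdot> (((\<phi> \<otimes>\<^sub>a \<I> y) \<cdot> k) \<otimes>\<^sub>a \<I> x)"
proof -
  let ?u = "\<one>\<^sub>u"
  note x = dualityD(1)[OF dual] and y = dualityD(2)[OF dual] and \<eta> = dualityD(3)[OF dual]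
    and \<epsilon> = dualityD(4)[OF dual] and tri = dualityD(5)[OF dual]
  note u = unit_in_Obj
  note simps = mon_simps x y z u Hom_iff
  have a: "\<alpha>\<^sub>u z x y \<in> Hom C ((z \<otimes>\<^sub>o x) \<otimes>\<^sub>o y) (z \<otimes>\<^sub>o (x \<otimes>\<^sub>o y))" "is_iso C (\<alpha>\<^sub>u z x y)"
    using assoc_iso x y z by auto
  obtain a' where a': "a' \<in> Hom C (z \<otimes>\<^sub>o (x \<otimes>\<^sub>o y)) ((z \<otimes>\<^sub>o x) \<otimes>\<^sub>o y)" "\<alpha>\<^sub>u z x y \<cdot> a' = \<I> (z \<otimes>\<^sub>o (x \<otimes>\<^sub>o y))"
    using is_isoE[OF a(2,1)] .
  \<comment> \<open>The unit of the adjunction at \<open>z\<close>, with the inverse associator and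
    a spare unit factor left in place.\<close>
  define k where "k = a' \<cdot> (\<I> z \<otimes>\<^sub>a \<eta>)"
  have z\<eta>: "\<I> z \<otimes>\<^sub>a \<eta> \<in> Hom C (z \<otimes>\<^sub>o ?u) (z \<otimes>\<^sub>o (x \<otimes>\<^sub>o y))"
    using tens_in_Hom[OF ident_in_Hom[OF z] \<eta>] .
  have k: "k \<in> Hom C (z \<otimes>\<^sub>o ?u) ((z \<otimes>\<^sub>o x) \<otimes>\<^sub>o y)"
    unfolding k_def using comp_in_Hom[OF z\<eta> a'(1)] .
  have ak: "\<alpha>\<^sub>u z x y \<cdot> k = \<I> z \<otimes>\<^sub>a \<eta>"
    unfolding k_def using comp_assoc[OF z\<eta> a'(1) a(1)] a'(2) ident_comp[OF z\<eta>] by simp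
  have karr: "k \<in> Arr C" "Dom C k = z \<otimes>\<^sub>o ?u" "Cod C k = (z \<otimes>\<^sub>o x) \<otimes>\<^sub>o y"
    using k by (simp_all add: Hom_iff)
  note arr = duality_arr[OF dual] karr
  \<comment> \<open>The zigzag of \<open>x\<close> carried along by the spectator \<open>z\<close>:
    \<open>runit_tens\<close>, the pentagon and naturality of the associator move \<open>z\<close>
    out of the way, and the triangle identity absorbs what remains.\<close>
  have "\<rho>\<^sub>u (z \<otimes>\<^sub>o x) \<cdot> (\<I> (z \<otimes>\<^sub>o x) \<otimes>\<^sub>a \<epsilon>) \<cdot> \<alpha>\<^sub>u (z \<otimes>\<^sub>o x) y x \<cdot> (k \<otimes>\<^sub>a \<I> x) =
      (\<I> z \<otimes>\<^sub>a \<rho>\<^sub>u x) \<cdot> (\<alpha>\<^sub>u z x ?u \<cdot> ((\<I> z \<otimes>\<^sub>a \<I> x) \<otimes>\<^sub>a \<epsilon>)) \<cdot> \<alpha>\<^sub>u (z \<otimes>\<^sub>o x) y x \<cdot> (k \<otimes>\<^sub>a \<I> x)"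
    unfolding runit_tens[OF z x] by (simp add: simps arr)
  also have "... = (\<I> z \<otimes>\<^sub>a \<rho>\<^sub>u x) \<cdot> ((\<I> z \<otimes>\<^sub>a (\<I> x \<otimes>\<^sub>a \<epsilon>)) \<cdot> \<alpha>\<^sub>u z x (y \<otimes>\<^sub>o x)) \<cdot> \<alpha>\<^sub>u (z \<otimes>\<^sub>o x) y x \<cdot> (k \<otimes>\<^sub>a \<I> x)"
    using assoc_natural[OF ident_in_Hom[OF z] ident_in_Hom[OF x] \<epsilon>] by simp
  also have "... = (\<I> z \<otimes>\<^sub>a \<rho>\<^sub>u x) \<cdot> (\<I> z \<otimes>\<^sub>a (\<I> x \<otimes>\<^sub>a \<epsilon>)) \<cdot> (\<alpha>\<^sub>u z x (y \<otimes>\<^sub>o x) \<cdot> \<alpha>\<^sub>u (z \<otimes>\<^sub>o x) y x) \<cdot> (k \<otimes>\<^sub>a \<I> x)"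
    by (simp add: simps arr)
  also have "... = (\<I> z \<otimes>\<^sub>a \<rho>\<^sub>u x) \<cdot> (\<I> z \<otimes>\<^sub>a (\<I> x \<otimes>\<^sub>a \<epsilon>)) \<cdot>
      ((\<I> z \<otimes>\<^sub>a \<alpha>\<^sub>u x y x) \<cdot> \<alpha>\<^sub>u z (x \<otimes>\<^sub>o y) x \<cdot> (\<alpha>\<^sub>u z x y \<otimes>\<^sub>a \<I> x)) \<cdot> (k \<otimes>\<^sub>a \<I> x)"
    using pentagon[OF z x y x] by simp
  also have "... = (\<I> z \<otimes>\<^sub>a (\<rho>\<^sub>u x \<cdot> (\<I> x \<otimes>\<^sub>a \<epsilon>) \<cdot> \<alpha>\<^sub>u x y x)) \<cdot> \<alpha>\<^sub>u z (x \<otimes>\<^sub>o y) x \<cdot> ((\<alpha>\<^sub>u z x y \<cdot> k) \<otimes>\<^sub>a \<I> x)"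
    by (simp add: tens_comp_arr tens_comp_comp_arr simps arr)
  also have "... = (\<I> z \<otimes>\<^sub>a (\<rho>\<^sub>u x \<cdot> (\<I> x \<otimes>\<^sub>a \<epsilon>) \<cdot> \<alpha>\<^sub>u x y x)) \<cdot> (\<I> z \<otimes>\<^sub>a (\<eta> \<otimes>\<^sub>a \<I> x)) \<cdot> \<alpha>\<^sub>u z ?u x"
    unfolding ak using assoc_natural[OF ident_in_Hom[OF z] \<eta> ident_in_Hom[OF x]] by simp
  also have "... = (\<I> z \<otimes>\<^sub>a (\<rho>\<^sub>u x \<cdot> (\<I> x \<otimes>\<^sub>a \<epsilon>) \<cdot> \<alpha>\<^sub>u x y x \<cdot> (\<eta> \<otimes>\<^sub>a \<I> x))) \<cdot> \<alpha>\<^sub>u z ?u x"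
    by (simp add: tens_comp_comp_arr simps arr)
  also have "... = \<rho>\<^sub>u z \<otimes>\<^sub>a \<I> x"
    unfolding tri using triangle_identity[OF z x] .
  finally have zigzag: "\<rho>\<^sub>u (z \<otimes>\<^sub>o x) \<cdot> (\<I> (z \<otimes>\<^sub>o x) \<otimes>\<^sub>a \<epsilon>) \<cdot> \<alpha>\<^sub>u (z \<otimes>\<^sub>o x) y x \<cdot> (k \<otimes>\<^sub>a \<I> x) = \<rho>\<^sub>u z \<otimes>\<^sub>a \<I> x" .
  show thesis
  proof (rule that[OF k])
    fix \<phi> d assume \<phi>: "\<phi> \<in> Hom C (z \<otimes>\<^sub>o x) d"
    have d: "d \<in> Obj C"
      using Hom_Obj[OF \<phi>] by blast
    have \<phi>': "\<phi> \<in> Arr C" "Dom C \<phi> = z \<otimes>\<^sub>o x" "Cod C \<phi> = d"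
      using \<phi> by (simp_all add: Hom_iff)
    have "\<phi> \<cdot> (\<rho>\<^sub>u z \<otimes>\<^sub>a \<I> x) =
        (\<phi> \<cdot> \<rho>\<^sub>u (z \<otimes>\<^sub>o x)) \<cdot> (\<I> (z \<otimes>\<^sub>o x) \<otimes>\<^sub>a \<epsilon>) \<cdot> \<alpha>\<^sub>u (z \<otimes>\<^sub>o x) y x \<cdot> (k \<otimes>\<^sub>a \<I> x)"
      unfolding zigzag[symmetric] by (simp add: simps arr d \<phi>')
    also have "... = (\<rho>\<^sub>u d \<cdot> (\<phi> \<otimes>\<^sub>a \<I> ?u)) \<cdot> (\<I> (z \<otimes>\<^sub>o x) \<otimes>\<^sub>a \<epsilon>) \<cdot> \<alpha>\<^sub>u (z \<otimes>\<^sub>o x) y x \<cdot> (k \<otimes>\<^sub>a \<I> x)"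
      using runit_natural[OF \<phi>] by simp
    also have "... = \<rho>\<^sub>u d \<cdot> (\<phi> \<otimes>\<^sub>a \<epsilon>) \<cdot> \<alpha>\<^sub>u (z \<otimes>\<^sub>o x) y x \<cdot> (k \<otimes>\<^sub>a \<I> x)"
      by (simp add: tens_comp_comp_arr simps arr d \<phi>')
    also have "... = \<rho>\<^sub>u d \<cdot> (\<I> d \<otimes>\<^sub>a \<epsilon>) \<cdot> ((\<phi> \<otimes>\<^sub>a (\<I> y \<otimes>\<^sub>a \<I> x)) \<cdot> \<alpha>\<^sub>u (z \<otimes>\<^sub>o x) y x) \<cdot> (k \<otimes>\<^sub>a \<I> x)"
      by (simp add: tens_comp_comp_arr simps arr d \<phi>')
    also have "... = \<rho>\<^sub>u d \<cdot> (\<I> d \<otimes>\<^sub>a \<epsilon>) \<cdot> (\<alpha>\<^sub>u d y x \<cdot> ((\<phi> \<otimes>\<^sub>a \<I> y) \<otimes>\<^sub>a \<I> x)) \<cdot> (k \<otimes>\<^sub>a \<I> x)"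
      using assoc_natural[OF \<phi> ident_in_Hom[OF y] ident_in_Hom[OF x]] by simp
    also have "... = \<rho>\<^sub>u d \<cdot> (\<I> d \<otimes>\<^sub>a \<epsilon>) \<cdot> \<alpha>\<^sub>u d y x \<cdot> (((\<phi> \<otimes>\<^sub>a \<I> y) \<cdot> k) \<otimes>\<^sub>a \<I> x)"
      by (simp add: tens_comp_arr simps arr d \<phi>')
    finally show "\<phi> \<cdot> (\<rho>\<^sub>u z \<otimes>\<^sub>a \<I> x) =
        \<rho>\<^sub>u d \<cdot> (\<I> d \<otimes>\<^sub>a \<epsilon>) \<cdot> \<alpha>\<^sub>u d y x \<cdot> (((\<phi> \<otimes>\<^sub>a \<I> y) \<cdot> k) \<otimes>\<^sub>a \<I> x)" .
  qed
qed

text \<open>The adjunct of a map from \<open>z \<otimes>\<^sub>o x\<close> to \<open>c\<close>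
  starts at a compact object and ends in a coproduct of the \<open>t i \<otimes>\<^sub>o y\<close>,
  so a finite truncation fixes it. Truncations commute with tensoring, and a map is determined by
  its adjunct.\<close>

lemma compact_tens_rigid:
  assumes z: "compact_object (\<kappa> :: 'k rel) C z" and rigid: "rigid_object C x"
  shows "compact_object \<kappa> C (z \<otimes>\<^sub>o x)"
proof (rule compactI)
  let ?u = "\<one>\<^sub>u"
  obtain y \<eta> \<epsilon> where dual: "duality x y \<eta> \<epsilon>"
    using rigid unfolding rigid_object_iff by blast
  note x = dualityD(1)[OF dual] and y = dualityD(2)[OF dual]
  note zo = compact_Obj[OF z] and u = unit_in_Obj
  have \<rho>: "\<rho>\<^sub>u z \<in> Hom C (z \<otimes>\<^sub>o ?u) z" "is_iso C (\<rho>\<^sub>u z)"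
    using runit_iso[OF zo] by auto
  have "isomorphic C z (z \<otimes>\<^sub>o ?u)"
    using \<rho> isomorphic_sym unfolding isomorphic_def by blast
  then have z1: "compact_object \<kappa> C (z \<otimes>\<^sub>o ?u)"
    using compact_isomorphic[OF z] by blast
  show "z \<otimes>\<^sub>o x \<in> Obj C"
    using tens_in_Obj[OF zo x] .
  obtain k where k: "k \<in> Hom C (z \<otimes>\<^sub>o ?u) ((z \<otimes>\<^sub>o x) \<otimes>\<^sub>o y)"
    "\<And>\<phi> d. \<phi> \<in> Hom C (z \<otimes>\<^sub>o x) d \<Longrightarrow>
       \<phi> \<cdot> (\<rho>\<^sub>u z \<otimes>\<^sub>a \<I> x) = \<rho>\<^sub>u d \<cdot> (\<I> d \<otimes>\<^sub>a \<epsilon>) \<cdot> \<alpha>\<^sub>u d y x \<cdot> (((\<phi> \<otimes>\<^sub>a \<I> y) \<cdot> k) \<otimes>\<^sub>a \<I> x)"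
    using rigid_adjunct[OF dual zo] by metis
  fix I :: "'k set" and t c \<iota> \<phi>
  assume I: "|I| <o \<kappa>" and cop: "is_coproduct C I t c \<iota>" and \<phi>: "\<phi> \<in> Hom C (z \<otimes>\<^sub>o x) c"
  let ?e = "truncation I t c \<iota>"
  note e = truncation_in_Hom[OF cop] and iy = ident_in_Hom[OF y]
  obtain F where F: "F \<subseteq> I" "finite F" "(?e F \<otimes>\<^sub>a \<I> y) \<cdot> (\<phi> \<otimes>\<^sub>a \<I> y) \<cdot> k = (\<phi> \<otimes>\<^sub>a \<I> y) \<cdot> k"
    using compactE[OF z1 I tens_coproduct[OF cop y] comp_in_Hom[OF k(1) tens_in_Hom[OF \<phi> iy]]]
      tens_truncation[OF cop y] by metis
  have e\<phi>: "?e F \<cdot> \<phi> \<in> Hom C (z \<otimes>\<^sub>o x) c"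
    using comp_in_Hom[OF \<phi> e] .
  have "((?e F \<cdot> \<phi>) \<otimes>\<^sub>a \<I> y) \<cdot> k = (\<phi> \<otimes>\<^sub>a \<I> y) \<cdot> k"
    using F(3) tens_comp[OF \<phi> e[of F] iy iy] ident_comp[OF iy]
      comp_assoc[OF k(1) tens_in_Hom[OF \<phi> iy] tens_in_Hom[OF e[of F] iy]] by simp
  then have "(?e F \<cdot> \<phi>) \<cdot> (\<rho>\<^sub>u z \<otimes>\<^sub>a \<I> x) = \<phi> \<cdot> (\<rho>\<^sub>u z \<otimes>\<^sub>a \<I> x)"
    using k(2)[OF e\<phi>] k(2)[OF \<phi>] by simp
  then have "?e F \<cdot> \<phi> = \<phi>"
    using iso_cancel_right[OF is_iso_tens[OF \<rho>(1) ident_in_Hom[OF x] \<rho>(2)] tens_in_Hom[OF \<rho>(1) ident_in_Hom[OF x]] e\<phi> \<phi>]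
      is_isoI[OF ident_in_Hom[OF x] ident_in_Hom[OF x]] ident_comp[OF ident_in_Hom[OF x]] by simp
  then show "\<exists>F \<subseteq> I. finite F \<and> ?e F \<cdot> \<phi> = \<phi>"
    using F by blast
qed

text \<open>A map from \<open>y\<close> to \<open>c\<close> is recovered from its mate, a map from
  the compact unit to \<open>x \<otimes>\<^sub>o c\<close>. The rule for truncations concerns
  tensoring on the right, so the mate is moved through the braiding into
  \<open>c \<otimes>\<^sub>o x\<close> and back.\<close>

lemma compact_dual:
  assumes u1: "compact_object (\<kappa> :: 'k rel) C \<one>\<^sub>u" and dual: "duality x y \<eta> \<epsilon>"
  shows "compact_object \<kappa> C y"
proof (rule compactI)
  let ?u = "\<one>\<^sub>u"
  note x = dualityD(1)[OF dual] and y = dualityD(2)[OF dual] and \<eta> = dualityD(3)[OF dual]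
    and \<epsilon> = dualityD(4)[OF dual] and tri = dualityD(6)[OF dual]
  show "y \<in> Obj C" by fact
  note u = unit_in_Obj and arr = duality_arr[OF dual]
  have inv: "inv_arrow C (\<alpha>\<^sub>u y x d) \<in> Arr C" "Dom C (inv_arrow C (\<alpha>\<^sub>u y x d)) = y \<otimes>\<^sub>o (x \<otimes>\<^sub>o d)"
    "Cod C (inv_arrow C (\<alpha>\<^sub>u y x d)) = (y \<otimes>\<^sub>o x) \<otimes>\<^sub>o d" if "d \<in> Obj C" for d
    using inv_arrow_props(1) assoc_iso[OF y x that] by (simp_all add: Hom_iff)
  \<comment> \<open>The second zigzag identity with \<open>\<phi>\<close> slid along the string of
    \<open>y\<close> onto the coevaluation.\<close>
  have adjunct: "\<phi> \<cdot> \<rho>\<^sub>u y = \<lambda>\<^sub>u d \<cdot> (\<epsilon> \<otimes>\<^sub>a \<I> d) \<cdot> inv_arrow C (\<alpha>\<^sub>u y x d) \<cdot> (\<I> y \<otimes>\<^sub>a ((\<I> x \<otimes>\<^sub>a \<phi>) \<cdot> \<eta>))"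
    if \<phi>: "\<phi> \<in> Hom C y d" for \<phi> d
  proof -
    have d: "d \<in> Obj C"
      using Hom_Obj[OF \<phi>] by blast
    have \<phi>': "\<phi> \<in> Arr C" "Dom C \<phi> = y" "Cod C \<phi> = d"
      using \<phi> by (simp_all add: Hom_iff)
    note simps = mon_simps x y u d Hom_iff inv arr \<phi>'
    have "\<phi> \<cdot> \<rho>\<^sub>u y = (\<phi> \<cdot> \<lambda>\<^sub>u y) \<cdot> (\<epsilon> \<otimes>\<^sub>a \<I> y) \<cdot> inv_arrow C (\<alpha>\<^sub>u y x y) \<cdot> (\<I> y \<otimes>\<^sub>a \<eta>)"
      unfolding tri[symmetric] by (simp add: simps)
    also have "... = (\<lambda>\<^sub>u d \<cdot> (\<I> ?u \<otimes>\<^sub>a \<phi>)) \<cdot> (\<epsilon> \<otimes>\<^sub>a \<I> y) \<cdot> inv_arrow C (\<alpha>\<^sub>u y x y) \<cdot> (\<I> y \<otimes>\<^sub>a \<eta>)"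
      using lunit_natural[OF \<phi>] by simp
    also have "... = \<lambda>\<^sub>u d \<cdot> (\<epsilon> \<otimes>\<^sub>a \<phi>) \<cdot> inv_arrow C (\<alpha>\<^sub>u y x y) \<cdot> (\<I> y \<otimes>\<^sub>a \<eta>)"
      by (simp add: tens_comp_comp_arr simps)
    also have "... = \<lambda>\<^sub>u d \<cdot> (\<epsilon> \<otimes>\<^sub>a \<I> d) \<cdot> (((\<I> y \<otimes>\<^sub>a \<I> x) \<otimes>\<^sub>a \<phi>) \<cdot> inv_arrow C (\<alpha>\<^sub>u y x y)) \<cdot> (\<I> y \<otimes>\<^sub>a \<eta>)"
      by (simp add: tens_comp_comp_arr simps)
    also have "... = \<lambda>\<^sub>u d \<cdot> (\<epsilon> \<otimes>\<^sub>a \<I> d) \<cdot> (inv_arrow C (\<alpha>\<^sub>u y x d) \<cdot> (\<I> y \<otimes>\<^sub>a (\<I> x \<otimes>\<^sub>a \<phi>))) \<cdot> (\<I> y \<otimes>\<^sub>a \<eta>)"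
      using inv_assoc_natural[OF ident_in_Hom[OF y] ident_in_Hom[OF x] \<phi>] by simp
    also have "... = \<lambda>\<^sub>u d \<cdot> (\<epsilon> \<otimes>\<^sub>a \<I> d) \<cdot> inv_arrow C (\<alpha>\<^sub>u y x d) \<cdot> (\<I> y \<otimes>\<^sub>a ((\<I> x \<otimes>\<^sub>a \<phi>) \<cdot> \<eta>))"
      by (simp add: tens_comp_arr simps)
    finally show ?thesis .
  qed
  fix I :: "'k set" and t c \<iota> \<phi>
  assume I: "|I| <o \<kappa>" and cop: "is_coproduct C I t c \<iota>" and \<phi>: "\<phi> \<in> Hom C y c"
  let ?e = "truncation I t c \<iota>"
  note e = truncation_in_Hom[OF cop] and ix = ident_in_Hom[OF x] and c = cop_Obj(1)[OF cop]
  have \<phi>x: "\<psi> \<otimes>\<^sub>a \<I> x \<in> Hom C (y \<otimes>\<^sub>o x) (c \<otimes>\<^sub>o x)" if "\<psi> \<in> Hom C y c" for \<psi>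
    using tens_in_Hom[OF that ix] .
  have \<beta>\<eta>: "\<beta>\<^sub>u x y \<cdot> \<eta> \<in> Hom C ?u (y \<otimes>\<^sub>o x)"
    using comp_in_Hom[OF \<eta> braid_in_Hom[OF x y]] .
  obtain F where F: "F \<subseteq> I" "finite F"
      "(?e F \<otimes>\<^sub>a \<I> x) \<cdot> (\<phi> \<otimes>\<^sub>a \<I> x) \<cdot> \<beta>\<^sub>u x y \<cdot> \<eta> = (\<phi> \<otimes>\<^sub>a \<I> x) \<cdot> \<beta>\<^sub>u x y \<cdot> \<eta>"
    using compactE[OF u1 I tens_coproduct[OF cop x] comp_in_Hom[OF \<beta>\<eta> \<phi>x[OF \<phi>]]]
      tens_truncation[OF cop x] by metis
  have e\<phi>: "?e F \<cdot> \<phi> \<in> Hom C y c"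
    using comp_in_Hom[OF \<phi> e] .
  have braid: "\<beta>\<^sub>u c x \<cdot> (\<psi> \<otimes>\<^sub>a \<I> x) \<cdot> \<beta>\<^sub>u x y \<cdot> \<eta> = (\<I> x \<otimes>\<^sub>a \<psi>) \<cdot> \<eta>" if \<psi>: "\<psi> \<in> Hom C y c" for \<psi>
  proof -
    note \<beta>1 = braid_in_Hom[OF c x] and \<beta>2 = braid_in_Hom[OF y x] and \<beta>3 = braid_in_Hom[OF x y]
    have x\<psi>: "\<I> x \<otimes>\<^sub>a \<psi> \<in> Hom C (x \<otimes>\<^sub>o y) (x \<otimes>\<^sub>o c)"
      using tens_in_Hom[OF ix \<psi>] .
    have "\<beta>\<^sub>u c x \<cdot> (\<psi> \<otimes>\<^sub>a \<I> x) \<cdot> \<beta>\<^sub>u x y \<cdot> \<eta> = (\<beta>\<^sub>u c x \<cdot> (\<psi> \<otimes>\<^sub>a \<I> x)) \<cdot> \<beta>\<^sub>u x y \<cdot> \<eta>"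
      using comp_assoc[OF \<beta>\<eta> \<phi>x[OF \<psi>] \<beta>1] by simp
    also have "... = ((\<I> x \<otimes>\<^sub>a \<psi>) \<cdot> \<beta>\<^sub>u y x) \<cdot> \<beta>\<^sub>u x y \<cdot> \<eta>"
      using braid_natural[OF \<psi> ix] by simp
    also have "... = (\<I> x \<otimes>\<^sub>a \<psi>) \<cdot> (\<beta>\<^sub>u y x \<cdot> \<beta>\<^sub>u x y) \<cdot> \<eta>"
      using comp_assoc[OF \<beta>\<eta> \<beta>2 x\<psi>] comp_assoc[OF \<eta> \<beta>3 \<beta>2] by simp
    finally show ?thesis
      using braid_symmetric[OF x y] ident_comp[OF \<eta>] by simp
  qed
  have "((?e F \<cdot> \<phi>) \<otimes>\<^sub>a \<I> x) \<cdot> \<beta>\<^sub>u x y \<cdot> \<eta> = (\<phi> \<otimes>\<^sub>a \<I> x) \<cdot> \<beta>\<^sub>u x y \<cdot> \<eta>"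
    using F(3) tens_comp[OF \<phi> e[of F] ix ix] ident_comp[OF ix]
      comp_assoc[OF \<beta>\<eta> \<phi>x[OF \<phi>] tens_in_Hom[OF e[of F] ix]] by simp
  then have "(\<I> x \<otimes>\<^sub>a (?e F \<cdot> \<phi>)) \<cdot> \<eta> = (\<I> x \<otimes>\<^sub>a \<phi>) \<cdot> \<eta>"
    using braid[OF e\<phi>] braid[OF \<phi>] by simp
  then have "(?e F \<cdot> \<phi>) \<cdot> \<rho>\<^sub>u y = \<phi> \<cdot> \<rho>\<^sub>u y"
    using adjunct[OF e\<phi>] adjunct[OF \<phi>] by simp
  then have "?e F \<cdot> \<phi> = \<phi>"
    using iso_cancel_right[OF _ _ e\<phi> \<phi>] runit_iso[OF y] by blast
  then show "\<exists>F \<subseteq> I. finite F \<and> ?e F \<cdot> \<phi> = \<phi>"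
    using F by blast
qed

end


section \<open>Tensor ideals and prime ideals\<close>

context triangulated_category
begin

text \<open>The comparison isomorphism that accompanies an exact functor handles the suspension and
  supplies the third map of each image triangle; the zero object shows that the preimage is
  nonempty.\<close>

lemma triangulated_preimage:
  assumes F: "exact_endofunctor C Fo Fa" and S: "triangulated_subcategory C S"
  shows "triangulated_subcategory C {x \<in> Obj C. Fo x \<in> S}"
proof -
  interpret F: exact_endofunctor C Fo Fa
    by (rule F)
  obtain \<phi> where \<phi>: "\<forall>x \<in> Obj C. \<phi> x \<in> Hom C (Fo (\<Sigma>\<^sub>o x)) (\<Sigma>\<^sub>o (Fo x)) \<and> is_iso C (\<phi> x)"
    and tri: "\<forall>x y z f g h. exact_triangle C x y z f g h \<longrightarrow>
            exact_triangle C (Fo x) (Fo y) (Fo z) (Fa f) (Fa g) (\<phi> x \<cdot> Fa h)"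
    using F.exact by blast
  obtain o' where o': "is_zero_object C o'"
    using ex_zero_object by blast
  note o = zero_objectD(1)[OF o']
  have "is_zero_object C (Fo o')"
  proof (rule zero_objectI)
    show "Fo o' \<in> Obj C"
      using F.map_Obj[OF o] .
    show "\<I> (Fo o') = Zero C (Fo o') (Fo o')"
      using zero_objectD(2)[OF o' ident_in_Hom[OF o]] F.map_ident[OF o]
        F.map_zero[OF additive_category_axioms o o] by simp
  qed
  then have "Fo o' \<in> S"
    using sub_zero[OF S] by blast
  moreover have "\<Sigma>\<^sub>o x \<in> {x \<in> Obj C. Fo x \<in> S} \<longleftrightarrow> x \<in> {x \<in> Obj C. Fo x \<in> S}" if x: "x \<in> Obj C" for x
  proof -
    have "isomorphic C (Fo (\<Sigma>\<^sub>o x)) (\<Sigma>\<^sub>o (Fo x))"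
      using \<phi> x unfolding isomorphic_def by blast
    then have "Fo (\<Sigma>\<^sub>o x) \<in> S \<longleftrightarrow> Fo x \<in> S"
      using sub_iso[OF S] isomorphic_sym sub_susp[OF S F.map_Obj[OF x]] by blast
    then show ?thesis
      using x susp.map_Obj[OF x] by simp
  qed
  moreover have "y \<in> {x \<in> Obj C. Fo x \<in> S}" if "x \<in> {x \<in> Obj C. Fo x \<in> S}" "isomorphic C x y" for x y
    using that sub_iso[OF S] F.map_isomorphic[OF that(2)] isomorphic_Obj[OF that(2)] by blast
  moreover have "z \<in> {x \<in> Obj C. Fo x \<in> S}"
    if "exact_triangle C x y z f g h" "x \<in> {x \<in> Obj C. Fo x \<in> S}" "y \<in> {x \<in> Obj C. Fo x \<in> S}" for x y z f g h
    using sub_cone[OF S tri[rule_format, OF that(1)]] that exact_Hom(6)[OF that(1)] by blast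
  ultimately show ?thesis
    unfolding triangulated_subcategory_def using o by blast
qed

lemma triangulated_Inter:
  assumes "\<S> \<noteq> {}" "\<And>S. S \<in> \<S> \<Longrightarrow> triangulated_subcategory C S"
  shows "triangulated_subcategory C (\<Inter>\<S>)"
proof -
  note sub = sub_Obj[OF assms(2)] sub_iso[OF assms(2)] sub_susp[OF assms(2)] sub_cone[OF assms(2)]
  obtain o' where "is_zero_object C o'"
    using ex_zero_object by blast
  then have "o' \<in> \<Inter>\<S>"
    using sub_zero[OF assms(2)] by blast
  moreover have "\<Inter>\<S> \<subseteq> Obj C"
    using assms(1) sub(1) by blast
  moreover have "y \<in> \<Inter>\<S>" if "x \<in> \<Inter>\<S>" "isomorphic C x y" for x y
    using that sub(2) by blast
  moreover have "\<Sigma>\<^sub>o x \<in> \<Inter>\<S> \<longleftrightarrow> x \<in> \<Inter>\<S>" if "x \<in> Obj C" for x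
    using that sub(3) by blast
  moreover have "z \<in> \<Inter>\<S>" if "exact_triangle C x y z f g h" "x \<in> \<Inter>\<S>" "y \<in> \<Inter>\<S>" for x y z f g h
    using that sub(4) by blast
  ultimately show ?thesis
    unfolding triangulated_subcategory_def by blast
qed

lemma triangulated_Int:
  "\<lbrakk>triangulated_subcategory C S; triangulated_subcategory C S'\<rbrakk> \<Longrightarrow> triangulated_subcategory C (S \<inter> S')"
  using triangulated_Inter[of "{S, S'}"] by auto

lemma localizing_Inter:
  assumes "\<S> \<noteq> {}" "\<And>S. S \<in> \<S> \<Longrightarrow> localizing_subcategory (\<kappa> :: 'k rel) C S"
  shows "localizing_subcategory \<kappa> C (\<Inter>\<S>)"
  unfolding localizing_subcategory_def
proof (intro conjI allI impI)
  show "triangulated_subcategory C (\<Inter>\<S>)"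
    using triangulated_Inter[OF assms(1)] localizing_triangulated[OF assms(2)] by blast
  fix I :: "'k set" and t c \<iota>
  assume "|I| <o \<kappa>" "t \<in> I \<rightarrow> \<Inter>\<S>" "is_coproduct C I t c \<iota>"
  then show "c \<in> \<Inter>\<S>"
    using localizing_coproduct[OF assms(2), of _ I t c \<iota>] by blast
qed

lemma Loc_least: "\<lbrakk>localizing_subcategory \<kappa> C S; E \<subseteq> S\<rbrakk> \<Longrightarrow> Loc \<kappa> C E \<subseteq> S"
  unfolding Loc_def by blast

lemma triangulated_compact_objects: "triangulated_subcategory C (compact_objects (\<kappa> :: 'k rel) C)"
proof -
  obtain o' where o': "is_zero_object C o'"
    using ex_zero_object by blast
  note o = zero_objectD(1)[OF o']
  have "compact_object \<kappa> C o'"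
  proof (rule compactI[OF o])
    fix I :: "'k set" and t c \<iota> \<phi>
    assume "is_coproduct C I t c \<iota>" "\<phi> \<in> Hom C o' c"
    then have "truncation I t c \<iota> {} \<cdot> \<phi> = \<phi>"
      using zero_objectD(2)[OF o'] comp_zero[OF truncation_in_Hom o] by metis
    then show "\<exists>F \<subseteq> I. finite F \<and> truncation I t c \<iota> F \<cdot> \<phi> = \<phi>"
      by blast
  qed
  then have "compact_objects \<kappa> C \<noteq> {}"
    unfolding compact_objects_def by blast
  moreover have "compact_objects \<kappa> C \<subseteq> Obj C"
    unfolding compact_objects_def using compact_Obj by blast
  moreover have "y \<in> compact_objects \<kappa> C" if "x \<in> compact_objects \<kappa> C" "isomorphic C x y" for x y
    using that compact_isomorphic unfolding compact_objects_def by blast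
  moreover have "\<Sigma>\<^sub>o x \<in> compact_objects \<kappa> C \<longleftrightarrow> x \<in> compact_objects \<kappa> C" if "x \<in> Obj C" for x
    using that compact_susp compact_desusp unfolding compact_objects_def by blast
  moreover have "z \<in> compact_objects \<kappa> C"
    if "exact_triangle C x y z f g h" "x \<in> compact_objects \<kappa> C" "y \<in> compact_objects \<kappa> C" for x y z f g h
    using that compact_susp compact_cone unfolding compact_objects_def by blast
  ultimately show ?thesis
    unfolding triangulated_subcategory_def by blast
qed

lemma retract_of_direct_summand:
  assumes "direct_summand C x b"
  obtains i p where "i \<in> Hom C x b" "p \<in> Hom C b x" "p \<cdot> i = \<I> x"
  using assms unfolding direct_summand_def is_biproduct_def by blast

lemma thick_compact_objects: "thick_subcategory C (compact_objects (\<kappa> :: 'k rel) C)"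
  unfolding thick_subcategory_def
proof (intro conjI allI impI)
  fix x y assume "y \<in> compact_objects \<kappa> C" "direct_summand C x y"
  then show "x \<in> compact_objects \<kappa> C"
    using compact_retract unfolding compact_objects_def by (blast elim: retract_of_direct_summand)
qed (rule triangulated_compact_objects)

end


section \<open>Localizing ideals\<close>

context tt_category
begin

lemma triangulated_tens_preimage:
  "\<lbrakk>triangulated_subcategory C S; w \<in> Obj C\<rbrakk> \<Longrightarrow> triangulated_subcategory C {x \<in> Obj C. x \<otimes>\<^sub>o w \<in> S}"
  using triangulated_preimage tens_exact_left by blast

text \<open>The device for extending a membership \<open>x \<otimes>\<^sub>o w \<in> S\<close> from
  generators \<open>x\<close> to everything they generate under triangles and coproducts.\<close>

lemma localizing_tens_preimage:
  assumes S: "localizing_subcategory (\<kappa> :: 'k rel) C S" and w: "w \<in> Obj C"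
  shows "localizing_subcategory \<kappa> C {x \<in> Obj C. x \<otimes>\<^sub>o w \<in> S}"
  unfolding localizing_subcategory_def
proof (intro conjI allI impI)
  show "triangulated_subcategory C {x \<in> Obj C. x \<otimes>\<^sub>o w \<in> S}"
    using triangulated_tens_preimage localizing_triangulated[OF S] w by blast
  fix I :: "'k set" and t c \<iota>
  assume "|I| <o \<kappa>" "t \<in> I \<rightarrow> {x \<in> Obj C. x \<otimes>\<^sub>o w \<in> S}" "is_coproduct C I t c \<iota>"
  then show "c \<in> {x \<in> Obj C. x \<otimes>\<^sub>o w \<in> S}"
    using localizing_coproduct[OF S _ _ tens_coproduct[OF _ w], of I t c \<iota>] coproductD(1) by blast
qed

lemma tens_map_retract:
  assumes "i \<in> Hom C x b" "p \<in> Hom C b x" "p \<cdot> i = \<I> x" and w: "w \<in> Obj C"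
  shows "i \<otimes>\<^sub>a \<I> w \<in> Hom C (x \<otimes>\<^sub>o w) (b \<otimes>\<^sub>o w)" "p \<otimes>\<^sub>a \<I> w \<in> Hom C (b \<otimes>\<^sub>o w) (x \<otimes>\<^sub>o w)"
    "(p \<otimes>\<^sub>a \<I> w) \<cdot> (i \<otimes>\<^sub>a \<I> w) = \<I> (x \<otimes>\<^sub>o w)"
  using tens_in_Hom[OF assms(1) ident_in_Hom[OF w]] tens_in_Hom[OF assms(2) ident_in_Hom[OF w]]
    tens_comp[OF assms(1,2) ident_in_Hom[OF w] ident_in_Hom[OF w]] assms(3) ident_comp[OF ident_in_Hom[OF w]]
    tens_ident[OF _ w] Hom_Obj[OF assms(1)] by auto

context
  fixes \<kappa> :: "'k rel" and S
  assumes S: "localizing_ideal \<kappa> C S"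
begin

lemma ideal_localizing: "localizing_subcategory \<kappa> C S"
  using S unfolding localizing_ideal_def by blast

lemmas ideal_triangulated = localizing_triangulated[OF ideal_localizing]
lemmas ideal_Obj = sub_Obj[OF ideal_triangulated]
lemmas ideal_iso = sub_iso[OF ideal_triangulated]

lemma ideal_tens_left: "\<lbrakk>t \<in> Obj C; x \<in> S\<rbrakk> \<Longrightarrow> t \<otimes>\<^sub>o x \<in> S"
  using S unfolding localizing_ideal_def by blast

lemma ideal_tens_right: "\<lbrakk>t \<in> Obj C; x \<in> S\<rbrakk> \<Longrightarrow> x \<otimes>\<^sub>o t \<in> S"
  using ideal_tens_left ideal_iso isomorphic_braid ideal_Obj by blast

lemma ideal_left_commute:
  "\<lbrakk>x \<otimes>\<^sub>o (y \<otimes>\<^sub>o z) \<in> S; x \<in> Obj C; y \<in> Obj C; z \<in> Obj C\<rbrakk> \<Longrightarrow> y \<otimes>\<^sub>o (x \<otimes>\<^sub>o z) \<in> S"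
  using ideal_iso isomorphic_left_commute by blast

lemma ideal_assoc_iff:
  "\<lbrakk>x \<in> Obj C; y \<in> Obj C; z \<in> Obj C\<rbrakk> \<Longrightarrow> (x \<otimes>\<^sub>o y) \<otimes>\<^sub>o z \<in> S \<longleftrightarrow> x \<otimes>\<^sub>o (y \<otimes>\<^sub>o z) \<in> S"
  using ideal_iso isomorphic_assoc isomorphic_sym by blast

lemma ideal_commute: "\<lbrakk>x \<otimes>\<^sub>o y \<in> S; x \<in> Obj C; y \<in> Obj C\<rbrakk> \<Longrightarrow> y \<otimes>\<^sub>o x \<in> S"
  using ideal_iso isomorphic_braid by blast

lemma ideal_tens_preimage:
  assumes w: "w \<in> Obj C"
  shows "localizing_ideal \<kappa> C {x \<in> Obj C. x \<otimes>\<^sub>o w \<in> S}"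
  unfolding localizing_ideal_def
proof (intro conjI ballI)
  show "localizing_subcategory \<kappa> C {x \<in> Obj C. x \<otimes>\<^sub>o w \<in> S}"
    using localizing_tens_preimage[OF ideal_localizing w] .
  fix t x assume t: "t \<in> Obj C" and "x \<in> {x \<in> Obj C. x \<otimes>\<^sub>o w \<in> S}"
  then show "t \<otimes>\<^sub>o x \<in> {x \<in> Obj C. x \<otimes>\<^sub>o w \<in> S}"
    using ideal_tens_left[OF t] ideal_assoc_iff[OF t _ w] tens_in_Obj[OF t] by blast
qed

end

lemma ideal_Inter:
  assumes "\<S> \<noteq> {}" "\<And>S. S \<in> \<S> \<Longrightarrow> localizing_ideal (\<kappa> :: 'k rel) C S"
  shows "localizing_ideal \<kappa> C (\<Inter>\<S>)"
  unfolding localizing_ideal_def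
proof (intro conjI ballI)
  show "localizing_subcategory \<kappa> C (\<Inter>\<S>)"
    using localizing_Inter[OF assms(1)] ideal_localizing[OF assms(2)] by blast
  fix t x assume "t \<in> Obj C" "x \<in> \<Inter>\<S>"
  then show "t \<otimes>\<^sub>o x \<in> \<Inter>\<S>"
    using ideal_tens_left[OF assms(2)] by blast
qed

lemma localizing_ideal_Obj: "localizing_ideal \<kappa> C (Obj C)"
  unfolding localizing_ideal_def localizing_subcategory_def triangulated_subcategory_def
  using unit_in_Obj isomorphic_Obj susp.map_Obj exact_Hom(6) coproductD(1) tens_in_Obj by blast

text \<open>The bound on \<open>E\<close> makes \<open>Obj C\<close> a member of the family that is
  intersected; over an empty family the intersection would be the whole type.\<close>

lemma localizing_ideal_Loc_ideal:
  assumes "E \<subseteq> Obj C"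
  shows "localizing_ideal \<kappa> C (Loc_ideal \<kappa> C E)"
  unfolding Loc_ideal_def
proof (rule ideal_Inter)
  show "{S. localizing_ideal \<kappa> C S \<and> E \<subseteq> S} \<noteq> {}"
    using localizing_ideal_Obj assms by blast
qed blast

lemma Loc_ideal_least: "\<lbrakk>localizing_ideal \<kappa> C S; E \<subseteq> S\<rbrakk> \<Longrightarrow> Loc_ideal \<kappa> C E \<subseteq> S"
  unfolding Loc_ideal_def by blast

lemma Loc_ideal_contains: "E \<subseteq> Loc_ideal \<kappa> C E"
  unfolding Loc_ideal_def by blast

end

text \<open>The multiplicative set generated by \<open>B\<close>. Every bracketing is a separate
  word, as the tensor product is associative only up to isomorphism; for a singleton
  \<open>B\<close> these are the tensor powers.\<close>

inductive_set tensor_words :: "('o, 'a, 'm) pre_tt_category_scheme \<Rightarrow> 'o set \<Rightarrow> 'o set"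
  for C :: "('o, 'a, 'm) pre_tt_category_scheme" and B :: "'o set" where
  letter: "b \<in> B \<Longrightarrow> b \<in> tensor_words C B"
| word: "\<lbrakk>c \<in> tensor_words C B; d \<in> tensor_words C B\<rbrakk> \<Longrightarrow> c \<otimes>\<^sub>o\<^bsub>C\<^esub> d \<in> tensor_words C B"


section \<open>Radicality, thick tensor ideals and prime avoidance\<close>

context rigidly_compactly_generated_tt_category
begin

abbreviation "compacts \<equiv> compact_objects \<kappa> C"
abbreviation "thick_ideal \<equiv> thick_tensor_ideal \<kappa> C"
abbreviation "loc_ideal \<equiv> localizing_ideal \<kappa> C"
abbreviation "Spec \<equiv> Spc \<kappa> C"
abbreviation "support \<equiv> supp \<kappa> C"

lemma compact_objects_iff: "x \<in> compacts \<longleftrightarrow> compact_object \<kappa> C x"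
  unfolding compact_objects_def by simp

lemma compact_in_Obj: "x \<in> compacts \<Longrightarrow> x \<in> Obj C"
  using compact_Obj unfolding compact_objects_iff by blast

lemma compact_unit: "\<one>\<^sub>u \<in> compacts"
  unfolding compact_objects_iff compact_iff_rigid by (rule rigid_unit)

lemma compact_tens:
  "\<lbrakk>a \<in> compacts; b \<in> compacts\<rbrakk> \<Longrightarrow> a \<otimes>\<^sub>o b \<in> compacts"
  using compact_tens_rigid compact_iff_rigid unfolding compact_objects_iff by blast

lemma ideal_retract:
  "\<lbrakk>loc_ideal S; b \<in> S; i \<in> Hom C x b; p \<in> Hom C b x; p \<cdot> i = \<I> x\<rbrakk> \<Longrightarrow> x \<in> S"
  using localizing_retract[OF inaccessible small_coproducts ideal_localizing] by blast

text \<open>By duality \<open>b\<close> is a retract of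
  \<open>(b \<otimes>\<^sub>o y) \<otimes>\<^sub>o b\<close>, so
  \<open>b \<otimes>\<^sub>o w\<close> is a retract of a multiple of
  \<open>b \<otimes>\<^sub>o (b \<otimes>\<^sub>o w)\<close>.\<close>

lemma ideal_tens_square:
  assumes S: "loc_ideal S" and b: "b \<in> compacts" and w: "w \<in> Obj C"
    and bb: "b \<otimes>\<^sub>o (b \<otimes>\<^sub>o w) \<in> S"
  shows "b \<otimes>\<^sub>o w \<in> S"
proof -
  have bo: "b \<in> Obj C"
    using compact_in_Obj[OF b] .
  have rigid: "rigid_object C b"
    using b compact_iff_rigid unfolding compact_objects_iff by blast
  obtain y i p where y: "y \<in> Obj C" and ip: "i \<in> Hom C b ((b \<otimes>\<^sub>o y) \<otimes>\<^sub>o b)"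
      "p \<in> Hom C ((b \<otimes>\<^sub>o y) \<otimes>\<^sub>o b) b" "p \<cdot> i = \<I> b"
    using rigid_retract[OF rigid] .
  have "y \<otimes>\<^sub>o (b \<otimes>\<^sub>o (b \<otimes>\<^sub>o w)) \<in> S"
    using ideal_tens_left[OF S y bb] .
  then have "b \<otimes>\<^sub>o (y \<otimes>\<^sub>o (b \<otimes>\<^sub>o w)) \<in> S"
    using ideal_left_commute[OF S _ y bo tens_in_Obj[OF bo w]] by blast
  then have "((b \<otimes>\<^sub>o y) \<otimes>\<^sub>o b) \<otimes>\<^sub>o w \<in> S"
    using ideal_assoc_iff[OF S] bo y w tens_in_Obj by simp
  then show ?thesis
    using ideal_retract[OF S _ tens_map_retract[OF ip w]] by blast
qed

text \<open>The factor \<open>w\<close> is quantified so that the induction can enlarge it. In a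
  word with halves \<open>c\<close> and \<open>d\<close>, first \<open>c\<close> is traded for
  \<open>b\<close> with \<open>d \<otimes>\<^sub>o w\<close> as the remaining factor, then
  \<open>d\<close> with \<open>b \<otimes>\<^sub>o w\<close>; the resulting square of
  \<open>b\<close> is removed by \<open>ideal_tens_square\<close>.\<close>

lemma ideal_tensor_words_radical:
  assumes S: "loc_ideal S" and b: "b \<in> compacts"
    and c: "c \<in> tensor_words C {b}"
  shows "c \<in> Obj C \<and> (\<forall>w \<in> Obj C. c \<otimes>\<^sub>o w \<in> S \<longrightarrow> b \<otimes>\<^sub>o w \<in> S)"
  using c
proof (induction rule: tensor_words.induct)
  case (letter c)
  then show ?case
    using compact_in_Obj[OF b] by simp
next
  case (word c d)
  then have co: "c \<in> Obj C" and do: "d \<in> Obj C" and bo: "b \<in> Obj C"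
    using compact_in_Obj[OF b] by auto
  have "b \<otimes>\<^sub>o w \<in> S" if w: "w \<in> Obj C" and "(c \<otimes>\<^sub>o d) \<otimes>\<^sub>o w \<in> S" for w
  proof -
    have "c \<otimes>\<^sub>o (d \<otimes>\<^sub>o w) \<in> S"
      using that ideal_assoc_iff[OF S co do w] by blast
    then have "b \<otimes>\<^sub>o (d \<otimes>\<^sub>o w) \<in> S"
      using word.IH(1) tens_in_Obj[OF do w] by blast
    then have "d \<otimes>\<^sub>o (b \<otimes>\<^sub>o w) \<in> S"
      using ideal_left_commute[OF S _ bo do w] by blast
    then have "b \<otimes>\<^sub>o (b \<otimes>\<^sub>o w) \<in> S"
      using word.IH(2) tens_in_Obj[OF bo w] by blast
    then show ?thesis
      using ideal_tens_square[OF S b w] by blast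
  qed
  then show ?case
    using tens_in_Obj[OF co do] by blast
qed

lemma ideal_radical:
  assumes S: "loc_ideal S" and b: "b \<in> compacts"
    and c: "c \<in> tensor_words C {b}" "c \<in> S"
  shows "b \<in> S"
proof -
  note bo = compact_in_Obj[OF b] and u = unit_in_Obj
  have "b \<otimes>\<^sub>o \<one>\<^sub>u \<in> S"
    using ideal_tensor_words_radical[OF S b c(1)] ideal_tens_right[OF S u c(2)] u by blast
  then have "\<one>\<^sub>u \<otimes>\<^sub>o b \<in> S"
    using ideal_commute[OF S _ bo u] by blast
  then show ?thesis
    using ideal_iso[OF S] isomorphic_lunit[OF bo] by blast
qed

context
  fixes P
  assumes P: "thick_ideal P"
begin

lemma thick_compact: "x \<in> P \<Longrightarrow> x \<in> compacts"
  using P unfolding thick_tensor_ideal_def by blast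

lemma thick_triangulated: "triangulated_subcategory C P"
  using P unfolding thick_tensor_ideal_def thick_subcategory_def by blast

lemma thick_summand: "\<lbrakk>y \<in> P; direct_summand C x y\<rbrakk> \<Longrightarrow> x \<in> P"
  using P unfolding thick_tensor_ideal_def thick_subcategory_def by blast

lemma thick_tens_left: "\<lbrakk>a \<in> compacts; b \<in> P\<rbrakk> \<Longrightarrow> a \<otimes>\<^sub>o b \<in> P"
  using P unfolding thick_tensor_ideal_def by blast

lemma thick_commute:
  "\<lbrakk>a \<otimes>\<^sub>o b \<in> P; a \<in> compacts; b \<in> compacts\<rbrakk> \<Longrightarrow> b \<otimes>\<^sub>o a \<in> P"
  using sub_iso[OF thick_triangulated] isomorphic_braid compact_in_Obj by blast

lemma thick_tens_right: "\<lbrakk>a \<in> compacts; b \<in> P\<rbrakk> \<Longrightarrow> b \<otimes>\<^sub>o a \<in> P"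
  using thick_tens_left thick_commute thick_compact by blast

text \<open>The ideal quotient of \<open>P\<close> by \<open>d\<close>, with which a non-prime ideal
  will be enlarged. Closure under summands rests on additive functors preserving biproducts.\<close>

lemma thick_tens_preimage:
  assumes d: "d \<in> compacts"
  shows "thick_ideal {z \<in> compacts. z \<otimes>\<^sub>o d \<in> P}"
proof -
  let ?R = "{z \<in> compacts. z \<otimes>\<^sub>o d \<in> P}"
  note dO = compact_in_Obj[OF d]
  have "?R = compacts \<inter> {z \<in> Obj C. z \<otimes>\<^sub>o d \<in> P}"
    using compact_in_Obj by blast
  then have "triangulated_subcategory C ?R"
    using triangulated_Int[OF triangulated_compact_objects[of \<kappa>] triangulated_tens_preimage[OF thick_triangulated dO]]
    by simp
  moreover have "x \<in> ?R" if yR: "y \<in> ?R" and summand: "direct_summand C x y" for x y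
  proof -
    have y: "y \<in> compacts" "y \<otimes>\<^sub>o d \<in> P"
      using yR by auto
    have x: "x \<in> compacts"
      using y(1) summand thick_compact_objects unfolding thick_subcategory_def by blast
    obtain y' i j p q where bi: "is_biproduct C x y' y i j p q"
      using summand unfolding direct_summand_def by blast
    have h: "i \<in> Hom C x y" "j \<in> Hom C y' y" "p \<in> Hom C y x" "q \<in> Hom C y y'"
      "p \<cdot> i = \<I> x" "q \<cdot> j = \<I> y'" "p \<cdot> j = Zero C y' x" "q \<cdot> i = Zero C x y'"
      "Plus C (i \<cdot> p) (j \<cdot> q) = \<I> y"
      using bi unfolding is_biproduct_def by auto
    have obj: "x \<in> Obj C" "y \<in> Obj C" "y' \<in> Obj C"
      using Hom_Obj h(1,2) by auto
    interpret T: exact_endofunctor C "\<lambda>x. x \<otimes>\<^sub>o d" "\<lambda>f. f \<otimes>\<^sub>a \<I> d"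
      using tens_exact_left[OF dO] .
    have "is_biproduct C (x \<otimes>\<^sub>o d) (y' \<otimes>\<^sub>o d) (y \<otimes>\<^sub>o d) (i \<otimes>\<^sub>a \<I> d) (j \<otimes>\<^sub>a \<I> d) (p \<otimes>\<^sub>a \<I> d) (q \<otimes>\<^sub>a \<I> d)"
      unfolding is_biproduct_def
      using T.map_Hom[OF h(1)] T.map_Hom[OF h(2)] T.map_Hom[OF h(3)] T.map_Hom[OF h(4)]
        T.map_comp[OF h(1,3)] T.map_comp[OF h(2,4)] T.map_comp[OF h(2,3)] T.map_comp[OF h(1,4)]
        T.map_ident obj T.map_plus[OF comp_in_Hom[OF h(3,1)] comp_in_Hom[OF h(4,2)]]
        T.map_comp[OF h(3,1)] T.map_comp[OF h(4,2)] tens_zero_left dO h(5-9) by simp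
    then have "direct_summand C (x \<otimes>\<^sub>o d) (y \<otimes>\<^sub>o d)"
      unfolding direct_summand_def by blast
    then show ?thesis
      using x thick_summand[OF y(2)] by simp
  qed
  moreover have "a \<otimes>\<^sub>o z \<in> ?R" if a: "a \<in> compacts" and z: "z \<in> ?R" for a z
  proof -
    have zc: "z \<in> compacts"
      using z by simp
    have "a \<otimes>\<^sub>o (z \<otimes>\<^sub>o d) \<in> P"
      using thick_tens_left[OF a] z by simp
    from sub_iso[OF thick_triangulated this
        isomorphic_sym[OF isomorphic_assoc[OF compact_in_Obj[OF a] compact_in_Obj[OF zc] dO]]]
    have "(a \<otimes>\<^sub>o z) \<otimes>\<^sub>o d \<in> P" .
    then show ?thesis
      using compact_tens[OF a] z by simp
  qed
  ultimately show ?thesis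
    unfolding thick_tensor_ideal_def thick_subcategory_def by blast
qed

end

lemma thick_tensor_ideal_compact_objects: "thick_ideal (compacts)"
  unfolding thick_tensor_ideal_def using thick_compact_objects compact_tens by blast

lemma thick_tensor_ideal_localizing:
  assumes S: "loc_ideal S"
  shows "thick_ideal (compacts \<inter> S)"
proof -
  have "triangulated_subcategory C (compacts \<inter> S)"
    using triangulated_Int[OF triangulated_compact_objects ideal_triangulated[OF S]] .
  moreover have "x \<in> compacts \<inter> S" if "y \<in> compacts \<inter> S" "direct_summand C x y" for x y
  proof -
    have "x \<in> compacts"
      using that thick_compact_objects unfolding thick_subcategory_def by blast
    moreover have "x \<in> S"
      using that ideal_retract[OF S] by (blast elim: retract_of_direct_summand)
    ultimately show ?thesis
      by blast
  qed
  ultimately show ?thesis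
    unfolding thick_tensor_ideal_def thick_subcategory_def
    using compact_tens ideal_tens_left[OF S] compact_in_Obj by blast
qed

lemma thick_tensor_ideal_Inter:
  assumes "\<P> \<noteq> {}" "\<And>P. P \<in> \<P> \<Longrightarrow> thick_ideal P"
  shows "thick_ideal (\<Inter>\<P>)"
proof -
  have "triangulated_subcategory C (\<Inter>\<P>)"
    using triangulated_Inter[OF assms(1)] thick_triangulated[OF assms(2)] by blast
  moreover have "\<Inter>\<P> \<subseteq> compacts"
    using assms(1) thick_compact[OF assms(2)] by blast
  moreover have "x \<in> \<Inter>\<P>" if "y \<in> \<Inter>\<P>" "direct_summand C x y" for x y
    using that thick_summand[OF assms(2)] by blast
  moreover have "a \<otimes>\<^sub>o b \<in> \<Inter>\<P>" if "a \<in> compacts" "b \<in> \<Inter>\<P>" for a b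
    using that thick_tens_left[OF assms(2)] by blast
  ultimately show ?thesis
    unfolding thick_tensor_ideal_def thick_subcategory_def by blast
qed

lemma thick_tensor_ideal_chain_Union:
  assumes ne: "\<P> \<noteq> {}" and P: "\<And>P. P \<in> \<P> \<Longrightarrow> thick_ideal P"
    and chain: "\<And>P Q. \<lbrakk>P \<in> \<P>; Q \<in> \<P>\<rbrakk> \<Longrightarrow> P \<subseteq> Q \<or> Q \<subseteq> P"
  shows "thick_ideal (\<Union>\<P>)"
proof -
  note sub = sub_Obj[OF thick_triangulated[OF P]] sub_iso[OF thick_triangulated[OF P]]
    sub_susp[OF thick_triangulated[OF P]] sub_cone[OF thick_triangulated[OF P]]
  obtain o' where "is_zero_object C o'"
    using ex_zero_object by blast
  then have "o' \<in> \<Union>\<P>"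
    using sub_zero[OF thick_triangulated[OF P]] ne by blast
  moreover have "\<Union>\<P> \<subseteq> compacts"
    using thick_compact[OF P] by blast
  moreover have "\<Union>\<P> \<subseteq> Obj C"
    using sub(1) by blast
  moreover have "y \<in> \<Union>\<P>" if "x \<in> \<Union>\<P>" "isomorphic C x y" for x y
    using that sub(2) by blast
  moreover have "\<Sigma>\<^sub>o x \<in> \<Union>\<P> \<longleftrightarrow> x \<in> \<Union>\<P>" if "x \<in> Obj C" for x
    using that sub(3) by blast
  moreover have "z \<in> \<Union>\<P>" if T: "exact_triangle C x y z f g h" and xy: "x \<in> \<Union>\<P>" "y \<in> \<Union>\<P>" for x y z f g h
  proof -
    \<comment> \<open>The larger of the two members that contain \<open>x\<close> and
      \<open>y\<close> contains both, so it also contains the cone.\<close>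
    obtain Q where "Q \<in> \<P>" "x \<in> Q" "y \<in> Q"
      using xy chain by blast
    then show ?thesis
      using sub(4)[OF _ T] by blast
  qed
  moreover have "x \<in> \<Union>\<P>" if "y \<in> \<Union>\<P>" "direct_summand C x y" for x y
    using that thick_summand[OF P] by blast
  moreover have "a \<otimes>\<^sub>o b \<in> \<Union>\<P>" if "a \<in> compacts" "b \<in> \<Union>\<P>" for a b
    using that thick_tens_left[OF P] by blast
  ultimately show ?thesis
    unfolding thick_tensor_ideal_def thick_subcategory_def triangulated_subcategory_def by blast
qed

text \<open>The Krull argument: Zorn's lemma gives an ideal \<open>Q\<close> maximal among those
  that contain \<open>J\<close> and miss \<open>M\<close>, and maximality together with
  multiplicativity of \<open>M\<close> makes it prime.\<close>

lemma prime_avoiding: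
  assumes J: "thick_ideal J" and M: "M \<subseteq> compacts" "M \<noteq> {}"
    and mult: "\<And>a b. \<lbrakk>a \<in> M; b \<in> M\<rbrakk> \<Longrightarrow> a \<otimes>\<^sub>o b \<in> M" and disj: "J \<inter> M = {}"
  obtains Q where "Q \<in> Spec" "J \<subseteq> Q" "Q \<inter> M = {}"
proof -
  define \<A> where "\<A> = {Q. thick_ideal Q \<and> J \<subseteq> Q \<and> Q \<inter> M = {}}"
  have "\<exists>Q \<in> \<A>. \<forall>X \<in> \<A>. Q \<subseteq> X \<longrightarrow> X = Q"
  proof (rule subset_Zorn_nonempty)
    show "\<A> \<noteq> {}"
      using J disj unfolding \<A>_def by blast
    fix \<C> assume \<C>: "\<C> \<noteq> {}" "subset.chain \<A> \<C>"
    then have sub: "\<C> \<subseteq> \<A>" and chain: "\<And>P Q. \<lbrakk>P \<in> \<C>; Q \<in> \<C>\<rbrakk> \<Longrightarrow> P \<subseteq> Q \<or> Q \<subseteq> P"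
      unfolding subset.chain_def by blast+
    have "thick_ideal (\<Union>\<C>)"
      using sub chain thick_tensor_ideal_chain_Union[OF \<C>(1)] unfolding \<A>_def by blast
    then show "\<Union>\<C> \<in> \<A>"
      using sub \<C>(1) unfolding \<A>_def by blast
  qed
  then obtain Q where Q: "thick_ideal Q" "J \<subseteq> Q" "Q \<inter> M = {}"
    and "\<forall>X \<in> \<A>. Q \<subseteq> X \<longrightarrow> X = Q"
    unfolding \<A>_def by blast
  then have max: "X = Q" if "thick_ideal X" "Q \<subseteq> X" "X \<inter> M = {}" for X
    using that unfolding \<A>_def by blast
  \<comment> \<open>The quotient of \<open>Q\<close> by \<open>d\<close> contains \<open>Q\<close>
    and also \<open>c\<close>, hence is strictly larger and meets \<open>M\<close>. Used twice, this
    turns a failure of primality into an element of \<open>Q\<close> that is a product of two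
    members of \<open>M\<close>.\<close>
  have enlarge: "\<exists>m \<in> M. m \<otimes>\<^sub>o d \<in> Q"
    if c: "c \<in> compacts" "c \<notin> Q" and d: "d \<in> compacts" and cd: "c \<otimes>\<^sub>o d \<in> Q" for c d
  proof -
    let ?R = "{z \<in> compacts. z \<otimes>\<^sub>o d \<in> Q}"
    have "Q \<subseteq> ?R"
      using thick_tens_right[OF Q(1) d] thick_compact[OF Q(1)] by blast
    moreover have "?R \<noteq> Q"
      using c cd by blast
    ultimately have "?R \<inter> M \<noteq> {}"
      using max[OF thick_tens_preimage[OF Q(1) d]] by blast
    then show ?thesis
      by blast
  qed
  have "a \<in> Q \<or> b \<in> Q"
    if a: "a \<in> compacts" and b: "b \<in> compacts" and ab: "a \<otimes>\<^sub>o b \<in> Q" for a b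
  proof (rule ccontr)
    assume "\<not> (a \<in> Q \<or> b \<in> Q)"
    then have aQ: "a \<notin> Q" and bQ: "b \<notin> Q"
      by auto
    obtain m where m: "m \<in> M" "m \<otimes>\<^sub>o b \<in> Q"
      using enlarge[OF a aQ b ab] by blast
    have mc: "m \<in> compacts"
      using M(1) m(1) by blast
    obtain n where "n \<in> M" "n \<otimes>\<^sub>o m \<in> Q"
      using enlarge[OF b bQ mc thick_commute[OF Q(1) m(2) mc b]] by blast
    then show False
      using mult m(1) Q(3) by blast
  qed
  moreover have "Q \<noteq> compacts"
    using M Q(3) by blast
  ultimately have "Q \<in> Spec"
    using Q(1) unfolding Spc_def by blast
  with Q that show thesis
    by blast
qed

lemma tensor_words_compact:
  assumes "B \<subseteq> compacts" "c \<in> tensor_words C B"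
  shows "c \<in> compacts"
  using assms(2)
proof (induction rule: tensor_words.induct)
  case (letter b)
  then show ?case
    using assms(1) by blast
next
  case (word c d)
  then show ?case
    using compact_tens by blast
qed

text \<open>If \<open>b\<close> were outside \<open>S\<close>, so would be all its tensor powers, by
  radicality. A prime containing the compact part of \<open>S\<close> and avoiding these powers lies
  in the support of \<open>b\<close> but in no support of the cover.\<close>

lemma supp_subset_radical:
  assumes S: "loc_ideal S" and b: "b \<in> compacts"
    and cover: "support b \<subseteq> (\<Union>a \<in> compacts \<inter> S. support a)"
  shows "b \<in> S"
proof (rule ccontr)
  assume nb: "b \<notin> S"
  have words: "tensor_words C {b} \<subseteq> compacts"
    using tensor_words_compact[of "{b}"] b by blast
  have bw: "b \<in> tensor_words C {b}"
    by (rule tensor_words.letter) simp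
  have disj: "compacts \<inter> S \<inter> tensor_words C {b} = {}"
    using ideal_radical[OF S b] nb by blast
  obtain Q where Q: "Q \<in> Spec" "compacts \<inter> S \<subseteq> Q" "Q \<inter> tensor_words C {b} = {}"
    using prime_avoiding[OF thick_tensor_ideal_localizing[OF S] words _ tensor_words.word disj] bw by blast
  then have "Q \<in> support b"
    using bw unfolding supp_def by blast
  then obtain a where "a \<in> compacts \<inter> S" "Q \<in> support a"
    using cover by blast
  then show False
    using Q(2) unfolding supp_def by blast
qed

end


section \<open>The spectrum and the local-to-global principle\<close>

context rigidly_compactly_generated_tt_category
begin

lemma Spc_thick: "Q \<in> Spec \<Longrightarrow> thick_ideal Q"
  unfolding Spc_def by blast

lemma supp_tens:
  assumes a: "a \<in> compacts" and b: "b \<in> compacts"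
  shows "support (a \<otimes>\<^sub>o b) = support a \<inter> support b"
proof -
  have "a \<otimes>\<^sub>o b \<in> Q \<longleftrightarrow> a \<in> Q \<or> b \<in> Q" if Q: "Q \<in> Spec" for Q
    using thick_tens_left[OF Spc_thick[OF Q] a] thick_tens_right[OF Spc_thick[OF Q] b] a b Q
    unfolding Spc_def by blast
  then show ?thesis
    unfolding supp_def by blast
qed

lemma supp_unit: "support \<one>\<^sub>u = Spec"
proof -
  have "\<one>\<^sub>u \<notin> Q" if Q: "Q \<in> Spec" for Q
  proof
    assume u: "\<one>\<^sub>u \<in> Q"
    have "a \<in> Q" if a: "a \<in> compacts" for a
      using sub_iso[OF thick_triangulated[OF Spc_thick[OF Q]] thick_tens_right[OF Spc_thick[OF Q] a u]
          isomorphic_lunit[OF compact_in_Obj[OF a]]] .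
    then show False
      using Q thick_compact[OF Spc_thick[OF Q]] unfolding Spc_def by blast
  qed
  then show ?thesis
    unfolding supp_def by blast
qed

lemma supp_Un:
  assumes a: "a \<in> compacts" and b: "b \<in> compacts"
  obtains c where "c \<in> compacts" "support c = support a \<union> support b"
proof -
  obtain c i j p q where c: "is_biproduct C a b c i j p q"
    using ex_biproduct[OF compact_in_Obj[OF a] compact_in_Obj[OF b]] by blast
  \<comment> \<open>\<open>direct_summand\<close> speaks of the first factor of a biproduct, so the
    biproduct is also read with its factors exchanged.\<close>
  have "Plus C (j \<cdot> q) (i \<cdot> p) = Plus C (i \<cdot> p) (j \<cdot> q)"
    using c plus_comm comp_in_Hom unfolding is_biproduct_def by blast
  then have c': "is_biproduct C b a c j i q p"
    using c unfolding is_biproduct_def by simp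
  have "c \<in> Q \<longleftrightarrow> a \<in> Q \<and> b \<in> Q" if "Q \<in> Spec" for Q
    using sub_biproduct[OF thick_triangulated[OF Spc_thick[OF that]] c] thick_summand[OF Spc_thick[OF that]] c c'
    unfolding direct_summand_def by blast
  then have "support c = support a \<union> support b"
    unfolding supp_def by blast
  moreover have "c \<in> compacts"
    using sub_biproduct[OF triangulated_compact_objects c a b] .
  ultimately show thesis
    using that by blast
qed

section \<open>The topology of the spectrum and its Thomason sets\<close>

abbreviation "spectrum \<equiv> Balmer_spectrum \<kappa> C"
abbreviation "dual_space \<equiv> Hochster_dual spectrum"

text \<open>Complements of supports are closed under binary intersection by \<open>supp_Un\<close>,
  so they form a basis and openness can be tested pointwise.\<close>

lemma openin_spectrum:
  "openin spectrum U \<longleftrightarrow> (\<forall>x \<in> U. \<exists>a \<in> compacts. x \<in> Spec - support a \<and> Spec - support a \<subseteq> U)"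
proof -
  let ?B = "\<lambda>U. \<exists>a \<in> compacts. U = Spec - support a"
  have "istopology (arbitrary union_of ?B)"
  proof (rule istopology_base)
    fix S T assume "?B S" "?B T"
    then obtain a b where ab: "a \<in> compacts" "b \<in> compacts"
      "S = Spec - support a" "T = Spec - support b"
      by blast
    obtain c where c: "c \<in> compacts" "support c = support a \<union> support b"
      using supp_Un[OF ab(1,2)] .
    show "?B (S \<inter> T)"
      using ab c by (intro bexI[of _ c]) auto
  qed
  then have "openin spectrum U \<longleftrightarrow> (\<forall>x \<in> U. \<exists>V. ?B V \<and> x \<in> V \<and> V \<subseteq> U)"
    unfolding Balmer_spectrum_def by (simp add: topology_inverse' arbitrary_union_of_alt)
  moreover have "(\<exists>V. ?B V \<and> R V) \<longleftrightarrow> (\<exists>a \<in> compacts. R (Spec - support a))" for R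
    by blast
  ultimately show ?thesis
    by simp
qed

lemma topspace_spectrum: "topspace spectrum = Spec"
proof
  show "topspace spectrum \<subseteq> Spec"
    using openin_topspace[of spectrum] unfolding openin_spectrum by blast
  obtain z where z: "is_zero_object C z"
    using ex_zero_object by blast
  have "support z = {}"
    using sub_zero[OF thick_triangulated[OF Spc_thick] z] unfolding supp_def by blast
  moreover have "z \<in> compacts"
    using sub_zero[OF triangulated_compact_objects z] .
  ultimately have "openin spectrum Spec"
    unfolding openin_spectrum by blast
  then show "Spec \<subseteq> topspace spectrum"
    by (rule openin_subset)
qed

lemma supp_subset_Spc: "support a \<subseteq> Spec"
  unfolding supp_def by blast

lemma openin_supp_complement: "a \<in> compacts \<Longrightarrow> openin spectrum (Spec - support a)"
  unfolding openin_spectrum by blast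

text \<open>Let \<open>J\<close> be the ideal generated by \<open>a\<close>, and \<open>M\<close>
  the multiplicative set of those \<open>b\<close> whose basic open set fits into a member of the
  cover. Were they disjoint, an avoiding prime would contain \<open>a\<close> and so be covered,
  which puts some \<open>b\<close> from \<open>M\<close> into it. A common element of
  \<open>J\<close> and \<open>M\<close> is a finite tensor word and yields the finite
  subcover.\<close>

lemma compactin_supp_complement:
  assumes a: "a \<in> compacts"
  shows "compactin spectrum (Spec - support a)"
  unfolding compactin_def
proof (intro conjI allI impI)
  show "Spec - support a \<subseteq> topspace spectrum"
    unfolding topspace_spectrum by blast
  fix \<U> assume "Ball \<U> (openin spectrum) \<and> Spec - support a \<subseteq> \<Union>\<U>"
  then have open_\<U>: "\<And>U. U \<in> \<U> \<Longrightarrow> openin spectrum U" and cover: "Spec - support a \<subseteq> \<Union>\<U>"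
    by blast+
  define B where "B = {b \<in> compacts. \<exists>U \<in> \<U>. Spec - support b \<subseteq> U}"
  \<comment> \<open>The unit keeps \<open>M\<close> nonempty even for an empty cover. As a letter it
    costs no member of the cover, because the complement of its support is empty.\<close>
  define M where "M = tensor_words C (insert \<one>\<^sub>u B)"
  define J where "J = \<Inter>{P. thick_ideal P \<and> a \<in> P}"
  have B: "insert \<one>\<^sub>u B \<subseteq> compacts"
    unfolding B_def using compact_unit by blast
  have M: "M \<subseteq> compacts"
    unfolding M_def using tensor_words_compact[OF B] by blast
  have J: "thick_ideal J"
    unfolding J_def
  proof (rule thick_tensor_ideal_Inter)
    show "{P. thick_ideal P \<and> a \<in> P} \<noteq> {}"
      using thick_tensor_ideal_compact_objects a by blast
  qed blast
  have "J \<inter> M \<noteq> {}"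
  proof
    assume disj: "J \<inter> M = {}"
    have "\<one>\<^sub>u \<in> M"
      unfolding M_def by (rule tensor_words.letter) simp
    then obtain Q where Q: "Q \<in> Spec" "J \<subseteq> Q" "Q \<inter> M = {}"
      using prime_avoiding[OF J M _ _ disj] tensor_words.word[of _ C "insert \<one>\<^sub>u B"] unfolding M_def by blast
    have "a \<in> Q"
      using Q(2) unfolding J_def by blast
    then have "Q \<in> Spec - support a"
      using Q(1) unfolding supp_def by blast
    then obtain U where U: "U \<in> \<U>" "Q \<in> U"
      using cover by blast
    obtain b where b: "b \<in> compacts" "Q \<in> Spec - support b" "Spec - support b \<subseteq> U"
      using open_\<U>[OF U(1)] U(2) unfolding openin_spectrum by blast
    have "b \<in> M"
      unfolding M_def by (rule tensor_words.letter) (use b U in \<open>auto simp: B_def\<close>)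
    moreover have "b \<in> Q"
      using b(2) unfolding supp_def by blast
    ultimately show False
      using Q(3) by blast
  qed
  then obtain c where c: "c \<in> J" "c \<in> M"
    by blast
  have "support c \<subseteq> support a"
    using c(1) Spc_thick unfolding J_def supp_def by blast
  moreover have "\<exists>\<F>. finite \<F> \<and> \<F> \<subseteq> \<U> \<and> Spec - support c \<subseteq> \<Union>\<F>"
    using c(2) unfolding M_def
  proof (induction rule: tensor_words.induct)
    case (letter b)
    show ?case
    proof (cases "b = \<one>\<^sub>u")
      case True
      then show ?thesis
        using supp_unit by auto
    next
      case False
      then obtain U where "U \<in> \<U>" "Spec - support b \<subseteq> U"
        using letter unfolding B_def by blast
      then show ?thesis
        by (intro exI[of _ "{U}"]) simp
    qed
  next
    case (word c d)
    then obtain \<F> \<G> where FG: "finite \<F>" "\<F> \<subseteq> \<U>" "Spec - support c \<subseteq> \<Union>\<F>"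
      "finite \<G>" "\<G> \<subseteq> \<U>" "Spec - support d \<subseteq> \<Union>\<G>"
      by blast
    have "support (c \<otimes>\<^sub>o d) = support c \<inter> support d"
      using supp_tens tensor_words_compact[OF B] word.hyps by blast
    then show ?case
      using FG by (intro exI[of _ "\<F> \<union> \<G>"]) auto
  qed
  ultimately show "\<exists>\<F>. finite \<F> \<and> \<F> \<subseteq> \<U> \<and> Spec - support a \<subseteq> \<Union>\<F>"
    by blast
qed

lemma thomason_Union_supp:
  assumes "A \<subseteq> compacts"
  shows "thomason spectrum (\<Union>a \<in> A. support a)"
  unfolding thomason_def
proof (intro exI[of _ "support ` A"] conjI refl ballI)
  fix Z assume "Z \<in> support ` A"
  then obtain a where a: "a \<in> compacts" "Z = support a"
    using assms by blast
  show "closedin spectrum Z"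
    unfolding closedin_def topspace_spectrum using openin_supp_complement[OF a(1)] supp_subset_Spc a(2) by simp
  show "compactin spectrum (topspace spectrum - Z)"
    unfolding topspace_spectrum using compactin_supp_complement[OF a(1)] a(2) by simp
qed

text \<open>A closed set with quasi-compact complement is itself a support: finitely many basic open
  sets make up the complement, and their union is the complement of the support of a tensor
  product.\<close>

lemma thomason_supp_nhd:
  assumes U: "thomason spectrum U" and x: "x \<in> U"
  obtains a where "a \<in> compacts" "x \<in> support a" "support a \<subseteq> U"
proof -
  obtain Z where Z: "closedin spectrum Z" "compactin spectrum (topspace spectrum - Z)" "x \<in> Z" "Z \<subseteq> U"
    using U x unfolding thomason_def by blast
  have ZS: "Z \<subseteq> Spec"
    using closedin_subset[OF Z(1)] topspace_spectrum by simp
  let ?\<U> = "{V. \<exists>b \<in> compacts. V = Spec - support b \<and> V \<subseteq> Spec - Z}"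
  have "openin spectrum (Spec - Z)"
    using Z(1) unfolding closedin_def topspace_spectrum by blast
  then have nhd: "\<forall>x \<in> Spec - Z. \<exists>b \<in> compacts.
      x \<in> Spec - support b \<and> Spec - support b \<subseteq> Spec - Z"
    unfolding openin_spectrum .
  have "Spec - Z \<subseteq> \<Union>?\<U>"
  proof
    fix x assume "x \<in> Spec - Z"
    then obtain b where "b \<in> compacts" "x \<in> Spec - support b"
      "Spec - support b \<subseteq> Spec - Z"
      using nhd by (elim ballE bexE conjE) auto
    then show "x \<in> \<Union>?\<U>"
      by (intro UnionI[of "Spec - support b"] CollectI bexI[of _ b] conjI refl)
  qed
  moreover have "\<And>V. V \<in> ?\<U> \<Longrightarrow> openin spectrum V"
    using openin_supp_complement by blast
  ultimately obtain \<F> where \<F>: "finite \<F>" "\<F> \<subseteq> ?\<U>" "Spec - Z \<subseteq> \<Union>\<F>"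
    using compactinD[OF Z(2), of ?\<U>] topspace_spectrum by auto
  have "\<exists>a \<in> compacts. \<Union>\<F> = Spec - support a"
    using \<F>(1,2)
  proof (induction \<F>)
    \<comment> \<open>The empty tensor product is the unit, whose support is the whole
      spectrum.\<close>
    case empty
    then show ?case
      using compact_unit supp_unit by (intro bexI[of _ "\<one>\<^sub>u"]) auto
  next
    case (insert V \<F>)
    obtain a where a: "a \<in> compacts" "\<Union>\<F> = Spec - support a"
      using insert.IH insert.prems by auto
    obtain b where b: "b \<in> compacts" "V = Spec - support b"
      using insert.prems by auto
    have "\<Union>(insert V \<F>) = Spec - support (b \<otimes>\<^sub>o a)"
      using a(2) b(2) supp_tens[OF b(1) a(1)] by auto
    then show ?case
      using compact_tens[OF b(1) a(1)] by blast
  qed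
  then obtain a where a: "a \<in> compacts" "\<Union>\<F> = Spec - support a"
    by blast
  have "\<Union>\<F> \<subseteq> Spec - Z"
    using \<F>(2) by (intro Union_least) auto
  then have "Spec - Z = Spec - support a"
    using \<F>(3) a(2) by simp
  then have "Z = support a"
    using double_diff[OF ZS order_refl] double_diff[OF supp_subset_Spc order_refl] by metis
  then show thesis
    using that[OF a(1)] Z(3,4) by simp
qed

lemma topspace_Hochster_dual: "topspace dual_space = Spec"
proof
  have "thomason spectrum (\<Union>a \<in> {\<one>\<^sub>u}. support a)"
    using thomason_Union_supp compact_unit by blast
  then have "openin dual_space Spec"
    unfolding openin_Hochster_dual using supp_unit by simp
  then show "Spec \<subseteq> topspace dual_space"
    by (rule openin_subset)
  show "topspace dual_space \<subseteq> Spec"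
  proof
    fix x assume x: "x \<in> topspace dual_space"
    have "thomason spectrum (topspace dual_space)"
      using openin_topspace[of dual_space] unfolding openin_Hochster_dual .
    from thomason_supp_nhd[OF this x] show "x \<in> Spec"
      using supp_subset_Spc by blast
  qed
qed

section \<open>Idempotent triangles and membership in localizing ideals\<close>

lemma idempotent_Obj:
  assumes Y: "idempotent_triangle \<kappa> C Y e f"
  shows "e \<in> Obj C" "f \<in> Obj C"
proof -
  obtain u v w where "exact_triangle C e \<one>\<^sub>u f u v w"
    using Y unfolding idempotent_triangle_def by blast
  then show "e \<in> Obj C" "f \<in> Obj C"
    using exact_Hom(4,6) by auto
qed

context
  fixes Y e f S
  assumes Y: "idempotent_triangle \<kappa> C Y e f" and S: "loc_ideal S"
begin

text \<open>\<open>e\<close> lies in the localizing subcategory generated by the compact objects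
  supported on \<open>Y\<close>, so the condition need only be checked on those.\<close>

lemma idempotent_tens_left:
  assumes w: "w \<in> Obj C" and b: "\<And>b. b \<in> compacts_supported_on \<kappa> C Y \<Longrightarrow> b \<otimes>\<^sub>o w \<in> S"
  shows "e \<otimes>\<^sub>o w \<in> S"
proof -
  have "compacts_supported_on \<kappa> C Y \<subseteq> {x \<in> Obj C. x \<otimes>\<^sub>o w \<in> S}"
    using b compact_in_Obj unfolding compacts_supported_on_def by blast
  then have "Loc \<kappa> C (compacts_supported_on \<kappa> C Y) \<subseteq> {x \<in> Obj C. x \<otimes>\<^sub>o w \<in> S}"
    using Loc_least[OF localizing_tens_preimage[OF ideal_localizing[OF S] w]] by blast
  then show ?thesis
    using Y unfolding idempotent_triangle_def by blast
qed

text \<open>Tensoring the triangle of \<open>Y\<close> with \<open>w\<close> places the unit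
  multiple of \<open>w\<close> between the two given members of \<open>S\<close>.\<close>

lemma idempotent_tens_middle:
  assumes w: "w \<in> Obj C" and e: "e \<otimes>\<^sub>o w \<in> S" and f: "f \<otimes>\<^sub>o w \<in> S"
  shows "w \<in> S"
proof -
  obtain u v k where tri: "exact_triangle C e \<one>\<^sub>u f u v k"
    using Y unfolding idempotent_triangle_def by blast
  obtain g where "exact_triangle C (e \<otimes>\<^sub>o w) (\<one>\<^sub>u \<otimes>\<^sub>o w) (f \<otimes>\<^sub>o w) (u \<otimes>\<^sub>a \<I> w) (v \<otimes>\<^sub>a \<I> w) g"
    using exact_endofunctor.exact[OF tens_exact_left[OF w]] tri by blast
  then have "\<one>\<^sub>u \<otimes>\<^sub>o w \<in> S"
    using sub_middle[OF ideal_triangulated[OF S]] e f by blast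
  then show ?thesis
    using ideal_iso[OF S] isomorphic_lunit[OF w] by blast
qed

text \<open>A compact object \<open>a\<close> supported on \<open>Y\<close> satisfies \<open>a \<otimes> f = 0\<close>; only the vanishing of
  \<open>a \<rightarrow> a \<otimes> f\<close> is needed, which makes \<open>a\<close> a retract of \<open>a \<otimes> e\<close>.\<close>

lemma idempotent_absorbs_supported:
  assumes a: "a \<in> compacts_supported_on \<kappa> C Y" and w: "w \<in> Obj C" and e: "e \<otimes>\<^sub>o (a \<otimes>\<^sub>o w) \<in> S"
  shows "a \<otimes>\<^sub>o w \<in> S"
proof -
  obtain u v k where tri: "exact_triangle C e \<one>\<^sub>u f u v k"
    and van: "\<And>s. s \<in> Loc \<kappa> C (compacts_supported_on \<kappa> C Y) \<Longrightarrow> Hom C s f = {Zero C s f}"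
    using Y unfolding idempotent_triangle_def by blast
  note T = exact_Hom[OF tri]
  have ac: "a \<in> compacts" "support a \<subseteq> Y"
    using a unfolding compacts_supported_on_def by auto
  then have rigid: "rigid_object C a"
    using compact_iff_rigid unfolding compact_objects_iff by blast
  obtain y \<eta> \<epsilon> where dual: "duality a y \<eta> \<epsilon>"
    using rigid unfolding rigid_object_iff by blast
  note ao = dualityD(1)[OF dual] and \<epsilon> = dualityD(4)[OF dual]
  have yc: "y \<in> compacts"
    using compact_dual[OF _ dual] compact_unit unfolding compact_objects_iff by blast
  \<comment> \<open>Tensoring with the dual can only shrink the support of \<open>a\<close>, so the
    source of \<open>v \<cdot> \<epsilon>\<close> belongs to the subcategory from which all maps to
    \<open>f\<close> vanish.\<close>
  have "y \<otimes>\<^sub>o a \<in> compacts_supported_on \<kappa> C Y"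
    unfolding compacts_supported_on_def using compact_tens[OF yc ac(1)] supp_tens[OF yc ac(1)] ac(2) by blast
  then have "y \<otimes>\<^sub>o a \<in> Loc \<kappa> C (compacts_supported_on \<kappa> C Y)"
    unfolding Loc_def by blast
  then have "v \<cdot> \<epsilon> = Zero C (y \<otimes>\<^sub>o a) f"
    using van comp_in_Hom[OF \<epsilon> T(2)] by blast
  then have av: "\<I> a \<otimes>\<^sub>a v = Zero C (a \<otimes>\<^sub>o \<one>\<^sub>u) (a \<otimes>\<^sub>o f)"
    using rigid_tens_zero[OF dual T(2)] by blast
  obtain k' where tri': "exact_triangle C (a \<otimes>\<^sub>o e) (a \<otimes>\<^sub>o \<one>\<^sub>u) (a \<otimes>\<^sub>o f) (\<I> a \<otimes>\<^sub>a u) (\<I> a \<otimes>\<^sub>a v) k'"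
    using exact_endofunctor.exact[OF tens_exact_right[OF ao]] tri by blast
  note T' = exact_Hom[OF tri']
  have "(\<I> a \<otimes>\<^sub>a v) \<cdot> \<I> (a \<otimes>\<^sub>o \<one>\<^sub>u) = Zero C (a \<otimes>\<^sub>o \<one>\<^sub>u) (a \<otimes>\<^sub>o f)"
    using comp_ident[OF T'(2)] av by simp
  \<comment> \<open>As the second map of the tensored triangle is zero, the identity lifts through
    the first; the lift \<open>s\<close> is a section.\<close>
  then obtain s where s: "s \<in> Hom C (a \<otimes>\<^sub>o \<one>\<^sub>u) (a \<otimes>\<^sub>o e)" "(\<I> a \<otimes>\<^sub>a u) \<cdot> s = \<I> (a \<otimes>\<^sub>o \<one>\<^sub>u)"
    using weak_kernel[OF tri' ident_in_Hom[OF T'(5)]] by blast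
  have "a \<otimes>\<^sub>o (e \<otimes>\<^sub>o w) \<in> S"
    using ideal_left_commute[OF S e idempotent_Obj(1)[OF Y] ao w] .
  then have "(a \<otimes>\<^sub>o e) \<otimes>\<^sub>o w \<in> S"
    using ideal_assoc_iff[OF S ao idempotent_Obj(1)[OF Y] w] by blast
  then have "(a \<otimes>\<^sub>o \<one>\<^sub>u) \<otimes>\<^sub>o w \<in> S"
    using ideal_retract[OF S _ tens_map_retract[OF s(1) T'(1) s(2) w]] by blast
  moreover have "isomorphic C (a \<otimes>\<^sub>o \<one>\<^sub>u) a"
    using runit_iso[OF ao] unfolding isomorphic_def by blast
  ultimately show ?thesis
    using ideal_iso[OF S] isomorphic_tens[OF _ isomorphic_refl[OF w]] by blast
qed

end

text \<open>Stated for an arbitrary localizing ideal \<open>L\<close>, with an object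
  \<open>g\<close> supplied for each \<open>W\<close>; the theorem applies it to the ideal generated
  by one fixed choice of representatives.\<close>

lemma weakly_scattered_generates:
  assumes scattered: "Hochster_weakly_scattered spectrum" and L: "loc_ideal L" and t: "t \<in> Obj C"
    and \<W>: "Spec = \<Union>\<W>" "\<And>W. W \<in> \<W> \<Longrightarrow> \<exists>g. is_g \<kappa> C W g \<and> t \<otimes>\<^sub>o g \<in> L"
  shows "t \<in> L"
proof -
  \<comment> \<open>The quotient of \<open>L\<close> by \<open>t\<close> turns the goal into the
    membership of the unit in a localizing ideal, which can be decided on supports.\<close>
  define M where "M = {x \<in> Obj C. x \<otimes>\<^sub>o t \<in> L}"
  have M: "loc_ideal M"
    unfolding M_def using ideal_tens_preimage[OF L t] .
  define Y where "Y = (\<Union>a \<in> compacts \<inter> M. support a)"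
  have in_M: "b \<in> M" if "b \<in> compacts" "support b \<subseteq> Y" for b
    using supp_subset_radical[OF M that(1)] that(2) unfolding Y_def by blast
  have thomason_Y: "thomason spectrum Y"
    unfolding Y_def using thomason_Union_supp by blast
  have YS: "Y \<subseteq> Spec"
    unfolding Y_def using supp_subset_Spc by blast
  have "Y = Spec"
  proof (rule ccontr)
    assume "Y \<noteq> Spec"
    then have ne: "Spec - Y \<noteq> {}"
      using YS by blast
    have "Spec - (Spec - Y) = Y"
      using YS by blast
    then have "closedin dual_space (Spec - Y)"
      unfolding closedin_def topspace_Hochster_dual openin_Hochster_dual using thomason_Y by simp
    then obtain x where "weakly_isolated_point dual_space (Spec - Y) x"
      using scattered ne unfolding Hochster_weakly_scattered_def weakly_scattered_def by blast
    then obtain U0 where U0: "thomason spectrum U0" "x \<in> U0" "x \<in> Spec - Y"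
      "U0 \<inter> (Spec - Y) \<subseteq> dual_space closure_of {x}"
      unfolding weakly_isolated_point_def openin_Hochster_dual by blast
    obtain W where W: "W \<in> \<W>" "x \<in> W"
      using U0(3) \<W>(1) by blast
    obtain g where g: "is_g \<kappa> C W g" "t \<otimes>\<^sub>o g \<in> L"
      using \<W>(2)[OF W(1)] by blast
    obtain U V eU fU eV fV where U: "thomason spectrum U" and V: "thomason spectrum V" and WUV: "W = U \<inter> (Spec - V)"
      and triU: "idempotent_triangle \<kappa> C U eU fU" and triV: "idempotent_triangle \<kappa> C V eV fV"
      and g_eq: "g = eU \<otimes>\<^sub>o fV"
      using g(1) unfolding is_g_def by blast
    have obj: "eU \<in> Obj C" "eV \<in> Obj C" "fV \<in> Obj C"
      using idempotent_Obj[OF triU] idempotent_Obj[OF triV] by auto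
    \<comment> \<open>One support must fit into both sets: \<open>U0\<close> keeps its trace on
      \<open>V\<close> inside \<open>Y\<close>, and \<open>U\<close> allows \<open>a\<close> to be
      recovered from \<open>eU \<otimes>\<^sub>o a\<close>.\<close>
    have "thomason spectrum (U0 \<inter> U)"
      using U0(1) U openin_Int[of dual_space] unfolding openin_Hochster_dual by blast
    moreover have "x \<in> U0 \<inter> U"
      using U0(2) W(2) WUV by blast
    ultimately obtain a where a: "a \<in> compacts" "x \<in> support a" "support a \<subseteq> U0 \<inter> U"
      using thomason_supp_nhd by blast
    note ao = compact_in_Obj[OF a(1)]
    have at: "a \<otimes>\<^sub>o t \<in> Obj C"
      using tens_in_Obj[OF ao t] .
    have "V \<subseteq> Spec"
      using V openin_subset[of dual_space] unfolding openin_Hochster_dual topspace_Hochster_dual by blast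
    then have "Spec - (Spec - V) = V"
      by blast
    then have "closedin dual_space (Spec - V)"
      unfolding closedin_def topspace_Hochster_dual openin_Hochster_dual using V by simp
    then have "dual_space closure_of {x} \<subseteq> Spec - V"
      using W(2) WUV by (intro closure_of_minimal) auto
    then have UV: "V \<inter> U0 \<subseteq> Y"
      using U0(4) \<open>V \<subseteq> Spec\<close> by blast
    \<comment> \<open>For \<open>b\<close> supported on \<open>V\<close>, the support of
      \<open>b \<otimes>\<^sub>o a\<close> lies in the intersection of \<open>V\<close> and
      \<open>U0\<close>, hence in \<open>Y\<close>.\<close>
    have eV: "eV \<otimes>\<^sub>o (a \<otimes>\<^sub>o t) \<in> L"
    proof (rule idempotent_tens_left[OF triV L at])
      fix b assume "b \<in> compacts_supported_on \<kappa> C V"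
      then have b: "b \<in> compacts" "support b \<subseteq> V"
        unfolding compacts_supported_on_def by auto
      have "b \<otimes>\<^sub>o a \<in> M"
        using in_M[OF compact_tens[OF b(1) a(1)]] supp_tens[OF b(1) a(1)] b(2) a(3) UV by blast
      then show "b \<otimes>\<^sub>o (a \<otimes>\<^sub>o t) \<in> L"
        unfolding M_def using ideal_assoc_iff[OF L compact_in_Obj[OF b(1)] ao t] by blast
    qed
    \<comment> \<open>The triangle of \<open>V\<close> is tensored with this object. Its
      \<open>eV\<close> end comes from the preceding step; its \<open>fV\<close> end is a multiple
      of the given \<open>t \<otimes>\<^sub>o g\<close>, after reordering factors.\<close>
    have e: "eU \<otimes>\<^sub>o (a \<otimes>\<^sub>o t) \<in> L"
    proof (rule idempotent_tens_middle[OF triV L tens_in_Obj[OF obj(1) at]])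
      show "eV \<otimes>\<^sub>o (eU \<otimes>\<^sub>o (a \<otimes>\<^sub>o t)) \<in> L"
        using ideal_left_commute[OF L ideal_tens_left[OF L obj(1) eV] obj(1,2) at] .
      have "(eU \<otimes>\<^sub>o fV) \<otimes>\<^sub>o t \<in> L"
        using ideal_commute[OF L g(2) t] g_eq tens_in_Obj[OF obj(1,3)] by simp
      then have "eU \<otimes>\<^sub>o fV \<in> M"
        unfolding M_def using tens_in_Obj[OF obj(1,3)] by simp
      then have "fV \<otimes>\<^sub>o eU \<in> M"
        using ideal_commute[OF M _ obj(1,3)] by blast
      then have "((fV \<otimes>\<^sub>o eU) \<otimes>\<^sub>o a) \<otimes>\<^sub>o t \<in> L"
        using ideal_tens_right[OF M ao] unfolding M_def by blast
      then show "fV \<otimes>\<^sub>o (eU \<otimes>\<^sub>o (a \<otimes>\<^sub>o t)) \<in> L"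
        using ideal_assoc_iff[OF L] obj ao t at tens_in_Obj by simp
    qed
    have "a \<in> compacts_supported_on \<kappa> C U"
      unfolding compacts_supported_on_def using a by blast
    then have "a \<otimes>\<^sub>o t \<in> L"
      using idempotent_absorbs_supported[OF triU L _ t e] by blast
    then have "x \<in> Y"
      unfolding Y_def M_def using a(1,2) ao by blast
    then show False
      using U0(3) by blast
  qed
  then have "\<one>\<^sub>u \<in> M"
    using in_M[OF compact_unit] supp_subset_Spc by blast
  then show ?thesis
    unfolding M_def using ideal_iso[OF L] isomorphic_lunit[OF t] by blast
qed

end

theorem theorem2:
  fixes T :: "('o, 'a, 'm) pre_tt_category_scheme" and \<kappa> :: "'k rel"
  assumes "rigidly_compactly_generated_tt_category T \<kappa>"
    and "Hochster_weakly_scattered (Balmer_spectrum \<kappa> T)"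
  shows "local_to_global_principle \<kappa> T"
proof -
  interpret rigidly_compactly_generated_tt_category T \<kappa>
    by (rule assms(1))
  show ?thesis
    unfolding local_to_global_principle_def
  proof (intro ballI allI impI)
    fix t \<W> g
    assume t: "t \<in> Obj T"
      and W: "\<forall>W \<in> \<W>. weakly_visible (Balmer_spectrum \<kappa> T) W \<and> is_g \<kappa> T W (g W)"
      and cover: "Spc \<kappa> T = \<Union>\<W>"
    let ?E = "{t \<otimes>\<^sub>o\<^bsub>T\<^esub> g W | W. W \<in> \<W>}"
    \<comment> \<open>Needed to keep the generators among the objects, so that
      \<open>Loc_ideal\<close> really is a localizing ideal.\<close>
    have gO: "g W \<in> Obj T" if "W \<in> \<W>" for W
    proof -
      have "is_g \<kappa> T W (g W)"
        using W that by blast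
      then obtain U V eU fU eV fV where "idempotent_triangle \<kappa> T U eU fU" "idempotent_triangle \<kappa> T V eV fV"
        and gW: "g W = eU \<otimes>\<^sub>o\<^bsub>T\<^esub> fV"
        unfolding is_g_def by blast
      then have "eU \<in> Obj T" "fV \<in> Obj T"
        using idempotent_Obj by auto
      then show ?thesis
        unfolding gW by (rule tens_in_Obj)
    qed
    then have E: "?E \<subseteq> Obj T"
      using tens_in_Obj[OF t] by blast
    have tO: "{t} \<subseteq> Obj T"
      using t by blast
    show "Loc_ideal \<kappa> T {t} = Loc_ideal \<kappa> T ?E"
    proof
      have "t \<in> Loc_ideal \<kappa> T ?E"
      proof (rule weakly_scattered_generates[OF assms(2) localizing_ideal_Loc_ideal[OF E] t cover])
        fix V assume "V \<in> \<W>"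
        then show "\<exists>h. is_g \<kappa> T V h \<and> t \<otimes>\<^sub>o\<^bsub>T\<^esub> h \<in> Loc_ideal \<kappa> T ?E"
          using W Loc_ideal_contains[of ?E \<kappa>] by blast
      qed
      then show "Loc_ideal \<kappa> T {t} \<subseteq> Loc_ideal \<kappa> T ?E"
        using Loc_ideal_least[OF localizing_ideal_Loc_ideal[OF E]] by blast
      have "?E \<subseteq> Loc_ideal \<kappa> T {t}"
        using ideal_tens_right[OF localizing_ideal_Loc_ideal[OF tO]] gO Loc_ideal_contains[of "{t}" \<kappa>] by blast
      then show "Loc_ideal \<kappa> T ?E \<subseteq> Loc_ideal \<kappa> T {t}"
        using Loc_ideal_least[OF localizing_ideal_Loc_ideal[OF tO]] by blast
    qed
  qed
qed

end
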